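(* Let $k,\sigma_0,\sigma_1>0$, $\varrho>1$, and let $\breve{\mathscr B}(v,\phi)=(\boldsymbol{C}\nabla(wv),\nabla(w\phi))_{\Omega_{\rm c}}-k^2(n|w|^2v,\phi)_{\Omega_{\rm c}}$ be the PAL sesquilinear form (with $\boldsymbol C$, $n$, $w$ and all other notation given in the context). Then $\breve{\mathscr B}$ takes the form $$\breve{\mathscr B}(v,\phi)=(\boldsymbol{T}\breve{\boldsymbol B}\boldsymbol{T}^t\nabla v,\nabla\phi)_{\Omega_{\rm c}}+(\boldsymbol{T}\boldsymbol{p}\cdot\nabla v,\phi)_{\Omega_{\rm c}}+(v,\boldsymbol{T}\boldsymbol{q}^*\cdot\nabla\phi)_{\Omega_{\rm c}}+(\breve n\,v,\phi)_{\Omega_{\rm c}},$$ where in $\Omega$ we have $\breve{\boldsymbol B}=\boldsymbol I$, $\boldsymbol p=\boldsymbol q=\boldsymbol 0$ and $\breve n=-k^2$, while in $\Omega_\varrho^{\rm PAL}$ the scalar $\breve n$, the entries of the symmetric matrix $\breve{\boldsymbol B}=(\breve B_{ij})$, and the vectors $\boldsymbol p=(p_1,p_2)^t$, $\boldsymbol q$ are given by $$\breve n=k^2\Big(\frac{\beta\sigma_1^2}{\alpha}-\alpha\beta+\frac{\sigma_1^2R_1'^2t^2}{\alpha\beta}\Big)\frac{\gamma_1}{r}+\frac{9\gamma_1\sigma_1^2t^2}{4rR_1^2}\Big(\frac\beta\alpha+\frac{R_1'^2}{\alpha\beta R_1^2}(R_1t+\alpha\tau)^2\Big),$$ $$\breve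 B_{11}=\frac{\beta t^2}{\alpha\gamma_1r}\big(t^2+(R_1't^2+\alpha\gamma_2)^2\beta^{-2}\big),\quad \breve B_{12}=-(R_1't^2+\alpha\gamma_2)\frac{t^2}{\beta},\quad \breve B_{22}=\frac{\alpha\gamma_1r}{\beta}t^2,$$ $$p_1=-\frac{\beta\sigma_1}{\alpha r}\Big(\frac{3t}{2R_1}+\mathrm{i}k\Big)t^2-\Big\{\frac{3R_1'\sigma_1}{2rR_1\alpha\beta}\Big(t+\frac{\alpha\tau}{R_1}\Big)+\frac{\mathrm{i}k\sigma_1R_1'}{r\alpha\beta}\Big\}(R_1't^2+\alpha\gamma_2)t^2,$$ $$p_2=\frac{3R_1'\gamma_1\sigma_1}{2R_1\beta}\Big(t+\frac{\alpha\tau}{R_1}\Big)t^2+\mathrm{i}k\sigma_1\frac{R_1'\gamma_1}{\beta}t^2,$$ and the entries of $\boldsymbol q$ are obtained from those of $\boldsymbol p$ by replacing $\mathrm{i}k$ with $-\mathrm{i}k$.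
   Context: Geometry: $D\subset\mathbb{R}^2$ is a bounded scatterer with Lipschitz boundary $\Gamma=\partial D$; $\Omega_{\rm s}\supset\bar D$ is a star-shaped domain with respect to the origin with piecewise smooth boundary $\{r=R_1(\theta),\ \theta\in[0,2\pi)\}$; $R_1'=dR_1/d\theta$; $R_2(\theta)=\varrho R_1(\theta)$; $\Omega=\Omega_{\rm s}\setminus\bar D$; $\Omega_\varrho^{\rm PAL}=\{R_1(\theta)<r<R_2(\theta)\}$; $\Omega_{\rm c}=\Omega\cup\Omega_\varrho^{\rm PAL}$. $(r,\theta)$ are polar coordinates of $(x,y)$, and $\nabla=(\partial_x,\partial_y)^t$. $(\cdot,\cdot)_{\Omega_{\rm c}}$ is the complex $L^2(\Omega_{\rm c})$ inner product (conjugate-linear in the second argument), and $*$ denotes complex conjugation. $v,\phi\in H^1_{0,\Gamma}(\Omega_{\rm c})=\{\phi\in H^1(\Omega_{\rm c}):\phi|_\Gamma=0\}$. Coefficients: $S=r$ in $\Omega$; in $\Omega_\varrho^{\rm PAL}$, $S=R_1+\sigma_1T+\mathrm{i}\sigma_0T$, $T=T(r,\theta)=\frac{(R_2-R_1)(r-R_1)}{R_2-r}$. Then $\boldsymbol C=\boldsymbol T\boldsymbol B\boldsymbol T^t$, $n=\frac{SS_r}{r}$, where $$\boldsymbol B=\begin{pmatrix}\frac{S}{rS_r}\big(1+\frac{S_\theta^2}{S^2}\big)&-\frac{S_\theta}{S}\\-\frac{S_\theta}{S}&\frac{rS_r}{S}\end{pmatrix},\qquad \boldsymbol T=\begin{pmatrix}\cos\theta&-\sin\theta\\\sin\theta&\cos\theta\end{pmatrix}$$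 (so $\boldsymbol C=\boldsymbol I$, $n=1$ in $\Omega$). The substitution factor is $w=1$ in $\Omega$ and $w=t^{3/2}e^{\mathrm{i}k\sigma_1T(r,\theta)}$ in $\Omega_\varrho^{\rm PAL}$. Auxiliary functions in $\Omega_\varrho^{\rm PAL}$, with $E:=R_1(R_2-r)+\sigma_1(\varrho-1)R_1(r-R_1)$: $$t=\frac{R_1}{R_1+\sigma_1T}=\frac{R_1(R_2-r)}{E},\quad \alpha=\sigma_1+\mathrm{i}\sigma_0,\quad \tau=tT=\frac{(\varrho-1)R_1^2(r-R_1)}{E},\quad \beta=tS=R_1+(\alpha-\sigma_1)\tau,$$ $$\gamma_1=t^2T_r=\frac{(\varrho-1)^2R_1^4}{E^2},\qquad \gamma_2=t^2T_\theta=(1-\varrho)R_1^2R_1'\,\frac{R_1(R_2-r)+r(r-R_1)}{E^2}.$$ Subscripts $r,\theta$ denote partial derivatives. In terms of $w$, the quantities are defined by $\breve{\boldsymbol B}=|w|^2\boldsymbol B$, $\boldsymbol p=w\boldsymbol B\breve\nabla w^*$, $\boldsymbol q=w^*\boldsymbol B\breve\nabla w$, $\breve n=(\breve\nabla w^* )^t\boldsymbol B\breve\nabla w-k^2|w|^2n$, with $\breve\nabla=(\partial_r,\partial_\theta/r)^t$. *)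

theory Defs
  imports "HOL-Analysis.Analysis"
begin

section \<open>Complex vectors and matrices over the plane\<close>

text \<open>The product \<open>a \<cdot> b\<close> without complex conjugation; conjugation only enters through
  the \<open>L\<^sup>2\<close> inner products below.\<close>

definition bdot :: "complex^2 \<Rightarrow> complex^2 \<Rightarrow> complex" where
  "bdot a b = (\<Sum>i\<in>UNIV. a $ i * b $ i)"

definition cnj_vec :: "complex^2 \<Rightarrow> complex^2" where
  "cnj_vec a = (\<chi> i. cnj (a $ i))"

definition smult_mat :: "complex \<Rightarrow> complex^2^2 \<Rightarrow> complex^2^2" where
  "smult_mat c A = (\<chi> i j. c * A $ i $ j)"

definition L2_inner :: "(real^2) set \<Rightarrow> (real^2 \<Rightarrow> complex) \<Rightarrow> (real^2 \<Rightarrow> complex) \<Rightarrow> complex" where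
  "L2_inner U f g = (LINT x:U|lebesgue. f x * cnj (g x))"

definition L2_inner_vec ::
  "(real^2) set \<Rightarrow> (real^2 \<Rightarrow> complex^2) \<Rightarrow> (real^2 \<Rightarrow> complex^2) \<Rightarrow> complex" where
  "L2_inner_vec U f g = (LINT x:U|lebesgue. bdot (f x) (cnj_vec (g x)))"


section \<open>First-order Sobolev spaces\<close>

definition square_integrable_on :: "(real^2) set \<Rightarrow> (real^2 \<Rightarrow> 'b::euclidean_space) \<Rightarrow> bool" where
  "square_integrable_on U u \<longleftrightarrow>
     set_borel_measurable lebesgue U u \<and> set_integrable lebesgue U (\<lambda>x. (norm (u x))\<^sup>2)"

definition locally_integrable_on :: "(real^2) set \<Rightarrow> (real^2 \<Rightarrow> 'b::euclidean_space) \<Rightarrow> bool" where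
  "locally_integrable_on U u \<longleftrightarrow> (\<forall>K. compact K \<and> K \<subseteq> U \<longrightarrow> set_integrable lebesgue K u)"

definition grad :: "(real^2 \<Rightarrow> 'b::real_normed_vector) \<Rightarrow> real^2 \<Rightarrow> 'b^2" where
  "grad f x = (\<chi> i. frechet_derivative f (at x) (axis i 1))"

definition C1_function :: "(real^2 \<Rightarrow> 'b::real_normed_vector) \<Rightarrow> bool" where
  "C1_function f \<longleftrightarrow>
     (\<forall>x. f differentiable (at x)) \<and> (\<forall>i. continuous_on UNIV (\<lambda>x. grad f x $ i))"

definition test_function_on :: "(real^2) set \<Rightarrow> (real^2 \<Rightarrow> real) \<Rightarrow> bool" where
  "test_function_on U \<psi> \<longleftrightarrow>
     C1_function \<psi> \<and> (\<exists>K. compact K \<and> K \<subseteq> U \<and> (\<forall>x. x \<notin> K \<longrightarrow> \<psi> x = 0))"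

text \<open>Weak gradients are tested against compactly supported \<open>C\<^sup>1\<close> functions, as in Gilbarg and
  Trudinger; \<open>C\<^sup>\<infinity>\<close> test functions give the same notion.\<close>

definition has_weak_grad ::
  "(real^2) set \<Rightarrow> (real^2 \<Rightarrow> complex) \<Rightarrow> (real^2 \<Rightarrow> complex^2) \<Rightarrow> bool" where
  "has_weak_grad U u g \<longleftrightarrow>
     locally_integrable_on U u \<and> locally_integrable_on U g \<and>
     (\<forall>\<psi>. test_function_on U \<psi> \<longrightarrow>
        (\<forall>i. (LINT x:U|lebesgue. u x * of_real (grad \<psi> x $ i)) =
             - (LINT x:U|lebesgue. g x $ i * of_real (\<psi> x))))"

text \<open>A weak gradient on an open set is unique up to null sets, so the choice below does not
  affect any integral.\<close>

definition weak_grad :: "(real^2) set \<Rightarrow> (real^2 \<Rightarrow> complex) \<Rightarrow> real^2 \<Rightarrow> complex^2" where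
  "weak_grad U u = (SOME g. has_weak_grad U u g)"

definition H1 :: "(real^2) set \<Rightarrow> (real^2 \<Rightarrow> complex) set" where
  "H1 U = {u. square_integrable_on U u \<and>
              (\<exists>g. has_weak_grad U u g \<and> square_integrable_on U g)}"

text \<open>One-dimensional Hausdorff measure, that is, arc length on a Lipschitz curve. It is carried by
  the Caratheodory measurable sets, which include the Borel sets.\<close>

definition hausdorff1_outer :: "(real^2) set \<Rightarrow> ennreal" where
  "hausdorff1_outer A =
     (SUP \<delta>\<in>{0<..}. INF C\<in>{C :: nat \<Rightarrow> (real^2) set.
         A \<subseteq> (\<Union>i. C i) \<and> (\<forall>i. bounded (C i) \<and> diameter (C i) \<le> \<delta>)}.
       (\<Sum>i. ennreal (diameter (C i))))"

definition hausdorff1 :: "(real^2) measure" where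
  "hausdorff1 =
     measure_of UNIV (lambda_system UNIV (Pow UNIV) hausdorff1_outer) hausdorff1_outer"

text \<open>\<open>g\<close> is the trace of \<open>u\<close> on the boundary portion \<open>\<Gamma>\<close>: the value at \<open>u\<close> of the continuous
  extension to \<open>H\<^sup>1\<close> of the restriction map \<open>f \<mapsto> f|\<^sub>\<Gamma> \<in> L\<^sup>2(\<Gamma>)\<close> on functions that are smooth up to
  the boundary.\<close>

definition has_trace ::
  "(real^2) set \<Rightarrow> (real^2) set \<Rightarrow> (real^2 \<Rightarrow> complex) \<Rightarrow> (real^2 \<Rightarrow> complex) \<Rightarrow> bool" where
  "has_trace U \<Gamma> u g \<longleftrightarrow>
     (\<exists>f :: nat \<Rightarrow> real^2 \<Rightarrow> complex.
        (\<forall>n. C1_function (f n)) \<and>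
        (\<lambda>n. LINT x:U|lebesgue. (norm (f n x - u x))\<^sup>2) \<longlonglongrightarrow> 0 \<and>
        (\<lambda>n. LINT x:U|lebesgue. (norm (grad (f n) x - weak_grad U u x))\<^sup>2) \<longlonglongrightarrow> 0 \<and>
        (\<lambda>n. \<integral>\<^sup>+x\<in>\<Gamma>. ennreal ((norm (f n x - g x))\<^sup>2) \<partial>hausdorff1) \<longlonglongrightarrow> 0)"

definition H1_0 :: "(real^2) set \<Rightarrow> (real^2) set \<Rightarrow> (real^2 \<Rightarrow> complex) set" where
  "H1_0 \<Gamma> U = {u \<in> H1 U. has_trace U \<Gamma> u (\<lambda>_. 0)}"


section \<open>Geometry\<close>

definition polar_angle :: "real^2 \<Rightarrow> real" where
  "polar_angle x = Arg2pi (Complex (x $ 1) (x $ 2))"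

definition at_polar :: "(real \<Rightarrow> real \<Rightarrow> 'b) \<Rightarrow> real^2 \<Rightarrow> 'b" where
  "at_polar f x = f (norm x) (polar_angle x)"

text \<open>\<open>C\<^sup>1\<close> up to the end points on each of finitely many closed pieces (the library's
  \<open>piecewise_C1_differentiable_on\<close> would admit derivatives that blow up at a break point).\<close>

definition piecewise_smooth_on :: "real \<Rightarrow> real \<Rightarrow> (real \<Rightarrow> real) \<Rightarrow> bool" where
  "piecewise_smooth_on a b f \<longleftrightarrow>
     (\<exists>P. finite P \<and> a \<in> P \<and> b \<in> P \<and> P \<subseteq> {a..b} \<and>
        (\<forall>c\<in>P. \<forall>d\<in>P. c < d \<and> P \<inter> {c<..<d} = {} \<longrightarrow>
           (\<exists>f'. continuous_on {c..d} f' \<and>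
              (\<forall>x\<in>{c..d}. (f has_real_derivative f' x) (at x within {c..d})))))"

text \<open>The boundary curve is given by a \<open>2\<pi>\<close>-periodic function on the whole line, so that its
  derivative also makes sense at the angle \<open>0\<close>.\<close>

definition star_boundary :: "(real \<Rightarrow> real) \<Rightarrow> bool" where
  "star_boundary R1 \<longleftrightarrow>
     (\<forall>\<theta>. R1 (\<theta> + 2 * pi) = R1 \<theta>) \<and> (\<forall>\<theta>. R1 \<theta> > 0) \<and> piecewise_smooth_on 0 (2 * pi) R1"

definition lipschitz_boundary :: "(real^2) set \<Rightarrow> bool" where
  "lipschitz_boundary D \<longleftrightarrow>
     (\<forall>p\<in>frontier D. \<exists>e>0. \<exists>u :: real^2. \<exists>h :: real \<Rightarrow> real. \<exists>L.
        norm u = 1 \<and> L-lipschitz_on UNIV h \<and>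
        (\<forall>x\<in>ball p e. x \<in> D \<longleftrightarrow> (x - p) \<bullet> u > h ((x - p) \<bullet> vector [- u $ 2, u $ 1])))"

definition star_domain :: "(real \<Rightarrow> real) \<Rightarrow> (real^2) set" where
  "star_domain R1 = {x. norm x < R1 (polar_angle x)}"

definition scatterer :: "(real \<Rightarrow> real) \<Rightarrow> (real^2) set \<Rightarrow> bool" where
  "scatterer R1 D \<longleftrightarrow>
     open D \<and> D \<noteq> {} \<and> bounded D \<and> lipschitz_boundary D \<and> closure D \<subseteq> star_domain R1"

definition Omega :: "(real \<Rightarrow> real) \<Rightarrow> (real^2) set \<Rightarrow> (real^2) set" where
  "Omega R1 D = star_domain R1 - closure D"

definition in_PAL :: "real \<Rightarrow> (real \<Rightarrow> real) \<Rightarrow> real \<Rightarrow> real \<Rightarrow> bool" where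
  "in_PAL \<rho> R1 r \<theta> \<longleftrightarrow> R1 \<theta> < r \<and> r < \<rho> * R1 \<theta>"

text \<open>The computational domain contains the interface \<open>r = R1(\<theta>)\<close>, so that functions in
  \<open>H\<^sup>1\<close> do not jump across it.\<close>

definition Omega_c :: "real \<Rightarrow> (real \<Rightarrow> real) \<Rightarrow> (real^2) set \<Rightarrow> (real^2) set" where
  "Omega_c \<rho> R1 D =
     Omega R1 D \<union> {x. norm x = R1 (polar_angle x)} \<union> {x. at_polar (in_PAL \<rho> R1) x}"


section \<open>Coefficients of the PAL equation, in polar coordinates\<close>

definition pal_T :: "real \<Rightarrow> (real \<Rightarrow> real) \<Rightarrow> real \<Rightarrow> real \<Rightarrow> real" where
  "pal_T \<rho> R1 r \<theta> = (\<rho> * R1 \<theta> - R1 \<theta>) * (r - R1 \<theta>) / (\<rho> * R1 \<theta> - r)"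

definition pal_S :: "real \<Rightarrow> real \<Rightarrow> real \<Rightarrow> (real \<Rightarrow> real) \<Rightarrow> real \<Rightarrow> real \<Rightarrow> complex" where
  "pal_S \<sigma>0 \<sigma>1 \<rho> R1 r \<theta> =
     (if r \<le> R1 \<theta> then of_real r
      else of_real (R1 \<theta> + \<sigma>1 * pal_T \<rho> R1 r \<theta>) + \<i> * of_real (\<sigma>0 * pal_T \<rho> R1 r \<theta>))"

definition pd_r :: "(real \<Rightarrow> real \<Rightarrow> complex) \<Rightarrow> real \<Rightarrow> real \<Rightarrow> complex" where
  "pd_r f r \<theta> = vector_derivative (\<lambda>s. f s \<theta>) (at r)"

definition pd_theta :: "(real \<Rightarrow> real \<Rightarrow> complex) \<Rightarrow> real \<Rightarrow> real \<Rightarrow> complex" where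
  "pd_theta f r \<theta> = vector_derivative (\<lambda>\<phi>. f r \<phi>) (at \<theta>)"

definition polar_grad :: "(real \<Rightarrow> real \<Rightarrow> complex) \<Rightarrow> real \<Rightarrow> real \<Rightarrow> complex^2" where
  "polar_grad f r \<theta> = vector [pd_r f r \<theta>, pd_theta f r \<theta> / of_real r]"

definition pal_B :: "real \<Rightarrow> real \<Rightarrow> real \<Rightarrow> (real \<Rightarrow> real) \<Rightarrow> real \<Rightarrow> real \<Rightarrow> complex^2^2" where
  "pal_B \<sigma>0 \<sigma>1 \<rho> R1 r \<theta> =
     (let S = pal_S \<sigma>0 \<sigma>1 \<rho> R1 r \<theta>;
          S_r = pd_r (pal_S \<sigma>0 \<sigma>1 \<rho> R1) r \<theta>;
          S_\<theta> = pd_theta (pal_S \<sigma>0 \<sigma>1 \<rho> R1) r \<theta>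
      in vector [vector [S / (of_real r * S_r) * (1 + S_\<theta>\<^sup>2 / S\<^sup>2), - (S_\<theta> / S)],
                 vector [- (S_\<theta> / S), of_real r * S_r / S]])"

definition pal_n :: "real \<Rightarrow> real \<Rightarrow> real \<Rightarrow> (real \<Rightarrow> real) \<Rightarrow> real \<Rightarrow> real \<Rightarrow> complex" where
  "pal_n \<sigma>0 \<sigma>1 \<rho> R1 r \<theta> =
     pal_S \<sigma>0 \<sigma>1 \<rho> R1 r \<theta> * pd_r (pal_S \<sigma>0 \<sigma>1 \<rho> R1) r \<theta> / of_real r"

definition rot :: "real \<Rightarrow> complex^2^2" where
  "rot \<theta> = vector [vector [of_real (cos \<theta>), - of_real (sin \<theta>)],
                   vector [of_real (sin \<theta>), of_real (cos \<theta>)]]"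

definition pal_C :: "real \<Rightarrow> real \<Rightarrow> real \<Rightarrow> (real \<Rightarrow> real) \<Rightarrow> real \<Rightarrow> real \<Rightarrow> complex^2^2" where
  "pal_C \<sigma>0 \<sigma>1 \<rho> R1 r \<theta> = rot \<theta> ** pal_B \<sigma>0 \<sigma>1 \<rho> R1 r \<theta> ** transpose (rot \<theta>)"


section \<open>Substitution factor and auxiliary functions\<close>

definition pal_t :: "real \<Rightarrow> real \<Rightarrow> (real \<Rightarrow> real) \<Rightarrow> real \<Rightarrow> real \<Rightarrow> real" where
  "pal_t \<sigma>1 \<rho> R1 r \<theta> = R1 \<theta> / (R1 \<theta> + \<sigma>1 * pal_T \<rho> R1 r \<theta>)"

definition pal_w :: "real \<Rightarrow> real \<Rightarrow> real \<Rightarrow> (real \<Rightarrow> real) \<Rightarrow> real \<Rightarrow> real \<Rightarrow> complex" where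
  "pal_w k \<sigma>1 \<rho> R1 r \<theta> =
     (if r \<le> R1 \<theta> then 1
      else of_real (pal_t \<sigma>1 \<rho> R1 r \<theta> powr (3/2)) *
           exp (\<i> * of_real (k * \<sigma>1 * pal_T \<rho> R1 r \<theta>)))"

definition pal_E :: "real \<Rightarrow> real \<Rightarrow> (real \<Rightarrow> real) \<Rightarrow> real \<Rightarrow> real \<Rightarrow> real" where
  "pal_E \<sigma>1 \<rho> R1 r \<theta> = R1 \<theta> * (\<rho> * R1 \<theta> - r) + \<sigma>1 * (\<rho> - 1) * R1 \<theta> * (r - R1 \<theta>)"

definition pal_alpha :: "real \<Rightarrow> real \<Rightarrow> complex" where
  "pal_alpha \<sigma>0 \<sigma>1 = of_real \<sigma>1 + \<i> * of_real \<sigma>0"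

definition pal_tau :: "real \<Rightarrow> real \<Rightarrow> (real \<Rightarrow> real) \<Rightarrow> real \<Rightarrow> real \<Rightarrow> real" where
  "pal_tau \<sigma>1 \<rho> R1 r \<theta> = (\<rho> - 1) * (R1 \<theta>)\<^sup>2 * (r - R1 \<theta>) / pal_E \<sigma>1 \<rho> R1 r \<theta>"

definition pal_beta :: "real \<Rightarrow> real \<Rightarrow> real \<Rightarrow> (real \<Rightarrow> real) \<Rightarrow> real \<Rightarrow> real \<Rightarrow> complex" where
  "pal_beta \<sigma>0 \<sigma>1 \<rho> R1 r \<theta> =
     of_real (R1 \<theta>) + (pal_alpha \<sigma>0 \<sigma>1 - of_real \<sigma>1) * of_real (pal_tau \<sigma>1 \<rho> R1 r \<theta>)"

definition pal_gamma1 :: "real \<Rightarrow> real \<Rightarrow> (real \<Rightarrow> real) \<Rightarrow> real \<Rightarrow> real \<Rightarrow> real" where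
  "pal_gamma1 \<sigma>1 \<rho> R1 r \<theta> = (\<rho> - 1)\<^sup>2 * (R1 \<theta>) ^ 4 / (pal_E \<sigma>1 \<rho> R1 r \<theta>)\<^sup>2"

definition pal_gamma2 :: "real \<Rightarrow> real \<Rightarrow> (real \<Rightarrow> real) \<Rightarrow> real \<Rightarrow> real \<Rightarrow> real" where
  "pal_gamma2 \<sigma>1 \<rho> R1 r \<theta> =
     (1 - \<rho>) * (R1 \<theta>)\<^sup>2 * deriv R1 \<theta> *
       ((R1 \<theta> * (\<rho> * R1 \<theta> - r) + r * (r - R1 \<theta>)) / (pal_E \<sigma>1 \<rho> R1 r \<theta>)\<^sup>2)"

text \<open>The closed forms above agree with \<open>\<tau> = tT\<close>, \<open>\<beta> = tS\<close>, \<open>\<gamma>\<^sub>1 = t\<^sup>2 T\<^sub>r\<close>, \<open>\<gamma>\<^sub>2 = t\<^sup>2 T\<^sub>\<theta>\<close>.\<close>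

lemma pal_E_pos:
  assumes "\<rho> > 1" "\<sigma>1 > 0" "R1 \<theta> > 0" "in_PAL \<rho> R1 r \<theta>"
  shows "pal_E \<sigma>1 \<rho> R1 r \<theta> > 0"
  using assms by (auto simp: pal_E_def in_PAL_def intro!: add_pos_pos mult_pos_pos)

lemma pal_E_eq:
  assumes "in_PAL \<rho> R1 r \<theta>"
  shows "pal_E \<sigma>1 \<rho> R1 r \<theta> = (\<rho> * R1 \<theta> - r) * (R1 \<theta> + \<sigma>1 * pal_T \<rho> R1 r \<theta>)"
proof -
  have "\<rho> * R1 \<theta> - r \<noteq> 0"
    using assms by (auto simp: in_PAL_def)
  then show ?thesis
    by (simp add: pal_E_def pal_T_def field_simps)
qed

lemma pal_t_eq:
  assumes "in_PAL \<rho> R1 r \<theta>"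
  shows "pal_t \<sigma>1 \<rho> R1 r \<theta> = R1 \<theta> * (\<rho> * R1 \<theta> - r) / pal_E \<sigma>1 \<rho> R1 r \<theta>"
  using assms by (auto simp: pal_E_eq pal_t_def in_PAL_def)

lemma pal_tau_eq:
  assumes "in_PAL \<rho> R1 r \<theta>"
  shows "pal_tau \<sigma>1 \<rho> R1 r \<theta> = pal_t \<sigma>1 \<rho> R1 r \<theta> * pal_T \<rho> R1 r \<theta>"
proof -
  have "\<rho> * R1 \<theta> - r \<noteq> 0"
    using assms by (auto simp: in_PAL_def)
  then show ?thesis
    by (simp add: pal_t_eq[OF assms] pal_tau_def pal_T_def)
      (simp add: power2_eq_square algebra_simps)
qed

lemma pal_beta_eq:
  assumes "\<rho> > 1" "\<sigma>1 > 0" "R1 \<theta> > 0" "in_PAL \<rho> R1 r \<theta>"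
  shows "pal_beta \<sigma>0 \<sigma>1 \<rho> R1 r \<theta> =
    of_real (pal_t \<sigma>1 \<rho> R1 r \<theta>) * pal_S \<sigma>0 \<sigma>1 \<rho> R1 r \<theta>"
proof -
  define T where "T = pal_T \<rho> R1 r \<theta>"
  have "R1 \<theta> + \<sigma>1 * T \<noteq> 0"
    using pal_E_pos[OF assms] pal_E_eq[OF assms(4), of \<sigma>1] unfolding T_def by auto
  then have *: "R1 \<theta> / (R1 \<theta> + \<sigma>1 * T) * (R1 \<theta> + \<sigma>1 * T) = R1 \<theta>"
    by simp
  show ?thesis
    using assms(4) *
    by (auto simp: pal_beta_def pal_alpha_def pal_S_def pal_tau_eq[OF assms(4)] pal_t_def
        in_PAL_def T_def[symmetric] complex_eq_iff)
qed

lemma pal_gamma1_eq: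
  assumes "in_PAL \<rho> R1 r \<theta>"
  shows "pal_gamma1 \<sigma>1 \<rho> R1 r \<theta> =
    (pal_t \<sigma>1 \<rho> R1 r \<theta>)\<^sup>2 * deriv (\<lambda>s. pal_T \<rho> R1 s \<theta>) r"
proof -
  have nz: "\<rho> * R1 \<theta> - r \<noteq> 0"
    using assms by (auto simp: in_PAL_def)
  have "((\<lambda>s. pal_T \<rho> R1 s \<theta>) has_real_derivative
      ((\<rho> - 1)\<^sup>2 * (R1 \<theta>)\<^sup>2) / (\<rho> * R1 \<theta> - r)\<^sup>2) (at r)"
    unfolding pal_T_def
    by (rule derivative_eq_intros refl nz | use nz in \<open>simp add: field_simps power2_eq_square\<close>)+
  then have "deriv (\<lambda>s. pal_T \<rho> R1 s \<theta>) r = ((\<rho> - 1)\<^sup>2 * (R1 \<theta>)\<^sup>2) / (\<rho> * R1 \<theta> - r)\<^sup>2"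
    by (rule DERIV_imp_deriv)
  then show ?thesis
    using nz by (simp add: pal_t_eq[OF assms] pal_gamma1_def power_divide power_mult_distrib)
qed

lemma pal_gamma2_eq:
  assumes "in_PAL \<rho> R1 r \<theta>" "R1 differentiable (at \<theta>)"
  shows "pal_gamma2 \<sigma>1 \<rho> R1 r \<theta> =
    (pal_t \<sigma>1 \<rho> R1 r \<theta>)\<^sup>2 * deriv (\<lambda>\<phi>. pal_T \<rho> R1 r \<phi>) \<theta>"
proof -
  have nz: "\<rho> * R1 \<theta> - r \<noteq> 0"
    using assms by (auto simp: in_PAL_def)
  have R1': "(R1 has_real_derivative deriv R1 \<theta>) (at \<theta>)"
    using assms(2) by (metis DERIV_deriv_iff_real_differentiable)
  have "((\<lambda>\<phi>. pal_T \<rho> R1 r \<phi>) has_real_derivative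
      (1 - \<rho>) * deriv R1 \<theta> * (R1 \<theta> * (\<rho> * R1 \<theta> - r) + r * (r - R1 \<theta>)) /
        (\<rho> * R1 \<theta> - r)\<^sup>2) (at \<theta>)"
    unfolding pal_T_def
    by (rule derivative_eq_intros refl nz R1' | use nz in \<open>simp add: field_simps power2_eq_square\<close>)+
  then have "deriv (\<lambda>\<phi>. pal_T \<rho> R1 r \<phi>) \<theta> =
      (1 - \<rho>) * deriv R1 \<theta> * (R1 \<theta> * (\<rho> * R1 \<theta> - r) + r * (r - R1 \<theta>)) /
        (\<rho> * R1 \<theta> - r)\<^sup>2"
    by (rule DERIV_imp_deriv)
  then show ?thesis
    using nz by (simp add: pal_t_eq[OF assms(1)] pal_gamma2_def power_divide power_mult_distrib)
qed


section \<open>The sesquilinear form and its transformed coefficients\<close>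

definition pal_form ::
  "real \<Rightarrow> real \<Rightarrow> real \<Rightarrow> real \<Rightarrow> (real \<Rightarrow> real) \<Rightarrow> (real^2) set \<Rightarrow>
     (real^2 \<Rightarrow> complex) \<Rightarrow> (real^2 \<Rightarrow> complex) \<Rightarrow> complex" where
  "pal_form k \<sigma>0 \<sigma>1 \<rho> R1 D v \<phi> =
     (let U = Omega_c \<rho> R1 D;
          w = at_polar (pal_w k \<sigma>1 \<rho> R1);
          C = at_polar (pal_C \<sigma>0 \<sigma>1 \<rho> R1);
          n = at_polar (pal_n \<sigma>0 \<sigma>1 \<rho> R1)
      in L2_inner_vec U (\<lambda>x. C x *v weak_grad U (\<lambda>y. w y * v y) x)
                        (weak_grad U (\<lambda>y. w y * \<phi> y))
         - of_real (k\<^sup>2) * L2_inner U (\<lambda>x. n x * of_real ((cmod (w x))\<^sup>2) * v x) \<phi>)"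

definition Bbreve ::
  "real \<Rightarrow> real \<Rightarrow> real \<Rightarrow> real \<Rightarrow> (real \<Rightarrow> real) \<Rightarrow> real \<Rightarrow> real \<Rightarrow> complex^2^2" where
  "Bbreve k \<sigma>0 \<sigma>1 \<rho> R1 r \<theta> =
     smult_mat (of_real ((cmod (pal_w k \<sigma>1 \<rho> R1 r \<theta>))\<^sup>2)) (pal_B \<sigma>0 \<sigma>1 \<rho> R1 r \<theta>)"

definition pvec ::
  "real \<Rightarrow> real \<Rightarrow> real \<Rightarrow> real \<Rightarrow> (real \<Rightarrow> real) \<Rightarrow> real \<Rightarrow> real \<Rightarrow> complex^2" where
  "pvec k \<sigma>0 \<sigma>1 \<rho> R1 r \<theta> =
     pal_w k \<sigma>1 \<rho> R1 r \<theta> *s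
       (pal_B \<sigma>0 \<sigma>1 \<rho> R1 r \<theta> *v polar_grad (\<lambda>s \<phi>. cnj (pal_w k \<sigma>1 \<rho> R1 s \<phi>)) r \<theta>)"

definition qvec ::
  "real \<Rightarrow> real \<Rightarrow> real \<Rightarrow> real \<Rightarrow> (real \<Rightarrow> real) \<Rightarrow> real \<Rightarrow> real \<Rightarrow> complex^2" where
  "qvec k \<sigma>0 \<sigma>1 \<rho> R1 r \<theta> =
     cnj (pal_w k \<sigma>1 \<rho> R1 r \<theta>) *s
       (pal_B \<sigma>0 \<sigma>1 \<rho> R1 r \<theta> *v polar_grad (pal_w k \<sigma>1 \<rho> R1) r \<theta>)"

definition nbreve ::
  "real \<Rightarrow> real \<Rightarrow> real \<Rightarrow> real \<Rightarrow> (real \<Rightarrow> real) \<Rightarrow> real \<Rightarrow> real \<Rightarrow> complex" where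
  "nbreve k \<sigma>0 \<sigma>1 \<rho> R1 r \<theta> =
     bdot (polar_grad (\<lambda>s \<phi>. cnj (pal_w k \<sigma>1 \<rho> R1 s \<phi>)) r \<theta>)
          (pal_B \<sigma>0 \<sigma>1 \<rho> R1 r \<theta> *v polar_grad (pal_w k \<sigma>1 \<rho> R1) r \<theta>)
     - of_real (k\<^sup>2 * (cmod (pal_w k \<sigma>1 \<rho> R1 r \<theta>))\<^sup>2) * pal_n \<sigma>0 \<sigma>1 \<rho> R1 r \<theta>"

end

theory Submission
  imports Defs
begin

text \<open>Expanding \<open>(C \<nabla>(wv), \<nabla>(w\<phi>))\<close> with the product rule gives the four terms pointwise; the work
  is to justify this. The factor \<open>w\<close> is only piecewise \<open>C\<^sup>1\<close>, but it is locally Lipschitz in the domain,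
  and \<open>C\<^sup>1\<close> off a closed null set consisting of the interface and finitely many lines through the origin.
  Averaging a compactly supported function of this kind over small squares yields \<open>C\<^sup>1\<close> test functions
  whose gradients converge boundedly almost everywhere, so weak gradients may be tested against such functions
  and the product rule holds for \<open>wv\<close>. Although \<open>B\<close> and \<open>\<nabla>w\<close> blow up at the outer boundary, the closed forms of the
  transformed coefficients are continuous in \<open>(r, R\<^sub>1, R\<^sub>1')\<close> on a compact set of parameters. They are therefore
  bounded, and each of the four terms is integrable separately.\<close>

section \<open>Steklov averages and weak gradients\<close>

text \<open>The exponent 3/2 in \<open>w\<close> is fixed by the mass term. Both \<beta> = t S and
  \<gamma>1 = t^2 T_r stay bounded and away from zero up to the outer boundary, so n = S S_r / r
  grows like t^(-3), which |w|^2 = t^3 compensates exactly. For the terms with derivatives of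
  \<open>w\<close> such a count of powers fails: taken separately, parts of them are of order
  t^(-2). They are bounded because completing the square in \<open>B\<close> pairs the radial and
  angular derivatives so that their most singular parts cancel. A second obstacle is that v grad w
  may grow like t^(-1/2) and need not be square integrable, so w v can lie outside H1, while
  \<open>weak_grad\<close> is a mere choice. Local integrability and uniqueness up to null sets
  identify the chosen gradient, and the integral of the original integrand is read off from the
  expanded terms. The jump of the polar angle is absorbed by the periodicity of \<open>R1\<close>.
  At the origin, where R1 of the angle has in general no limit, \<open>w\<close> is locally
  constant.\<close>

lemma grad_eqI:
  assumes "(f has_derivative f') (at x)"
  shows "grad f x $ i = f' (axis i 1)"
  using frechet_derivative_at[OF assms] by (simp add: grad_def)

lemma grad_cong_open:
  assumes "open S" "x \<in> S" "\<And>y. y \<in> S \<Longrightarrow> f y = g y"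
  shows "grad f x = grad g x"
proof -
  have "(f has_derivative f') (at x) \<longleftrightarrow> (g has_derivative f') (at x)" for f'
    using has_derivative_transform_within_open[OF _ assms(1,2), of f f' UNIV g]
      has_derivative_transform_within_open[OF _ assms(1,2), of g f' UNIV f] assms(3) by auto
  then show ?thesis
    by (simp add: grad_def frechet_derivative_def)
qed

lemma has_derivative_grad:
  fixes f :: "real^2 \<Rightarrow> 'b::real_normed_vector"
  assumes "f differentiable (at x)"
  shows "(f has_derivative (\<lambda>u. \<Sum>i\<in>UNIV. u $ i *\<^sub>R grad f x $ i)) (at x)"
proof -
  let ?D = "frechet_derivative f (at x)"
  have D: "(f has_derivative ?D) (at x)"
    using assms by (simp add: frechet_derivative_works)
  then have lin: "linear ?D"
    using has_derivative_linear by blast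
  have "?D u = (\<Sum>i\<in>UNIV. u $ i *\<^sub>R grad f x $ i)" for u
  proof -
    have "?D u = ?D (\<Sum>i\<in>UNIV. u $ i *\<^sub>R axis i 1)"
      using basis_expansion[of u] by (simp add: scalar_mult_eq_scaleR)
    also have "\<dots> = (\<Sum>i\<in>UNIV. u $ i *\<^sub>R ?D (axis i 1))"
      by (simp add: linear_sum[OF lin] linear_cmul[OF lin])
    finally show ?thesis
      by (simp add: grad_def)
  qed
  then show ?thesis
    using D by presburger
qed

text \<open>Difference quotients along an axis are bounded by \<open>L\<close>, and the bound
  survives the limit. A small ball suffices, so the estimate also serves locally Lipschitz
  functions.\<close>

lemma norm_grad_le_lipschitz:
  fixes f :: "real^2 \<Rightarrow> 'b::real_normed_vector"
  assumes lip: "L-lipschitz_on (ball x e) f" and e: "e > 0" and f: "f differentiable (at x)"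
  shows "norm (grad f x $ i) \<le> L"
proof -
  let ?g = "\<lambda>s. f (x + s *\<^sub>R axis i 1)"
  have "(?g has_derivative (\<lambda>s. frechet_derivative f (at x) (s *\<^sub>R axis i 1))) (at 0)"
    by (rule has_derivative_compose[where g=f, simplified]) 
      (use f frechet_derivative_works in \<open>auto intro!: derivative_eq_intros\<close>)
  then have "(?g has_vector_derivative grad f x $ i) (at 0)"
    using linear_cmul[OF linear_frechet_derivative[OF f]]
    by (simp add: has_vector_derivative_def grad_def)
  then have lim: "((\<lambda>s. norm (f (x + s *\<^sub>R axis i 1) - f x - s *\<^sub>R grad f x $ i) / \<bar>s\<bar>) \<longlongrightarrow> 0) (at 0)"
    by (simp add: has_vector_derivative_def has_derivative_at divide_inverse mult.commute)
  \<comment> \<open>The triangle inequality puts the remainder quotient above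
    \<open>norm (grad f x $ i) - L\<close>; since that quotient tends to 0, the constant below it
    cannot be positive.\<close>
  have "eventually (\<lambda>s. norm (grad f x $ i) - L \<le> norm (f (x + s *\<^sub>R axis i 1) - f x - s *\<^sub>R grad f x $ i) / \<bar>s\<bar>) (at 0)"
    unfolding eventually_at
  proof (intro exI[of _ e] conjI ballI impI e)
    fix s :: real assume s: "s \<noteq> 0 \<and> dist s 0 < e"
    have "norm (f (x + s *\<^sub>R axis i 1) - f x) \<le> L * norm (s *\<^sub>R axis i 1 :: real^2)"
      using lipschitz_on_normD[OF lip, of "x + s *\<^sub>R axis i 1" x] s e by (auto simp: dist_norm norm_axis_1)
    moreover have "\<bar>s\<bar> * norm (grad f x $ i)
        \<le> norm (f (x + s *\<^sub>R axis i 1) - f x) + norm (f (x + s *\<^sub>R axis i 1) - f x - s *\<^sub>R grad f x $ i)"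
      using norm_triangle_ineq4[of "f (x + s *\<^sub>R axis i 1) - f x" "f (x + s *\<^sub>R axis i 1) - f x - s *\<^sub>R grad f x $ i"]
      by simp
    ultimately show "norm (grad f x $ i) - L \<le> norm (f (x + s *\<^sub>R axis i 1) - f x - s *\<^sub>R grad f x $ i) / \<bar>s\<bar>"
      using s by (simp add: norm_axis_1 field_simps)
  qed
  from tendsto_lowerbound[OF lim this] show ?thesis
    by simp
qed

lemma AE_notin_negligible: "negligible N \<Longrightarrow> AE x in lebesgue. x \<notin> N"
  by (intro AE_I'[of N]) (auto simp: negligible_iff_null_sets)

text \<open>Completeness of \<open>lebesgue\<close>: the function agrees almost everywhere with its
  restriction to \<open>-N\<close> extended by zero, whatever its values on
  \<open>N\<close>.\<close>

lemma measurable_continuous_off_negligible: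
  fixes f :: "'a::euclidean_space \<Rightarrow> 'b::euclidean_space"
  assumes "continuous_on (-N) f" "negligible N"
  shows "f \<in> borel_measurable lebesgue"
proof -
  have N: "N \<in> sets lebesgue"
    using assms(2) negligible_imp_sets by blast
  then have "f \<in> borel_measurable (lebesgue_on (-N))"
    using assms(1) by (intro continuous_imp_measurable_on_sets_lebesgue)
      (simp_all only: Compl_in_sets_lebesgue)
  then have "(\<lambda>x. if x \<in> -N then f x else 0) \<in> borel_measurable lebesgue"
    using N by (intro borel_measurable_if_I) (simp_all only: Compl_in_sets_lebesgue)
  moreover have "AE x in lebesgue. (if x \<in> -N then f x else 0) = f x"
    using assms(2) by (intro AE_I'[of N]) (auto simp: negligible_iff_null_sets)
  ultimately show ?thesis
    by (rule borel_measurable_AE)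
qed

text \<open>The mean of \<open>h\<close> over the square with corner \<open>x\<close> and side |e|.
  The square is rescaled to the fixed unit box, so that \<open>x\<close> occurs only in the argument
  of \<open>h\<close> and derivatives pass under an integral over a set of measure one.\<close>

definition steklov :: "(real^2 \<Rightarrow> complex) \<Rightarrow> real \<Rightarrow> real^2 \<Rightarrow> complex" where
  "steklov h e x = (LINT z:cbox 0 One|lebesgue. h (x - e *\<^sub>R z))"

lemma indicator_cbox_measurable:
  fixes f :: "real^2 \<Rightarrow> complex"
  assumes "f \<in> borel_measurable lebesgue"
  shows "(\<lambda>x. indicat_real (cbox a b) x *\<^sub>R f x) \<in> borel_measurable lebesgue"
  by (intro borel_measurable_scaleR borel_measurable_indicator assms) auto

lemma unit_box_measure: "measure lebesgue (cbox (0::real^2) One) = 1"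
  using content_unit[where 'a="real^2"] by (simp add: measure_completion)

text \<open>The l1 norm gives 2 where the sharp constant is the square root of 2. This is the source
  of the factor 2 in all later estimates of how far an average reaches.\<close>

lemma unit_box_norm:
  assumes "z \<in> cbox (0::real^2) One"
  shows "norm z \<le> 2"
proof -
  have "(\<Sum>b\<in>Basis. \<bar>z \<bullet> b\<bar>) \<le> (\<Sum>b\<in>(Basis::(real^2) set). 1)"
    using assms by (intro sum_mono) (auto simp: mem_box)
  then show ?thesis
    using norm_le_l1[of z] by simp
qed

lemma unit_box_integral_tendsto:
  fixes F :: "nat \<Rightarrow> real^2 \<Rightarrow> complex"
  assumes "\<And>n. F n \<in> borel_measurable lebesgue" "f \<in> borel_measurable lebesgue"
    and "AE z in lebesgue. z \<in> cbox 0 One \<longrightarrow> (\<lambda>n. F n z) \<longlonglongrightarrow> f z"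
    and "\<And>n. AE z in lebesgue. z \<in> cbox 0 One \<longrightarrow> norm (F n z) \<le> C"
  shows "(\<lambda>n. LINT z:cbox 0 One|lebesgue. F n z) \<longlonglongrightarrow> (LINT z:cbox 0 One|lebesgue. f z)"
  unfolding set_lebesgue_integral_def
proof (rule integral_dominated_convergence[where w="\<lambda>z. indicator (cbox 0 One) z * C"])
  show "integrable lebesgue (\<lambda>z::real^2. indicator (cbox 0 One) z * C)"
    by (intro integrable_mult_left integrable_real_indicator) (auto simp: emeasure_lborel_cbox_eq)
  show "AE x in lebesgue. (\<lambda>i. indicat_real (cbox 0 One) x *\<^sub>R F i x) \<longlonglongrightarrow> indicat_real (cbox 0 One) x *\<^sub>R f x"
    using assms(3) by eventually_elim (auto simp: indicator_def)
  show "AE x in lebesgue. norm (indicat_real (cbox 0 One) x *\<^sub>R F i x) \<le> indicat_real (cbox 0 One) x * C" for i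
    using assms(4)[of i] by eventually_elim (auto simp: indicator_def)
qed (use assms indicator_cbox_measurable in auto)

lemma unit_box_bounded_integrable:
  fixes f :: "real^2 \<Rightarrow> complex"
  assumes "f \<in> borel_measurable lebesgue" "AE z in lebesgue. z \<in> cbox 0 One \<longrightarrow> norm (f z) \<le> C"
  shows "set_integrable lebesgue (cbox 0 One) f" "norm (LINT z:cbox 0 One|lebesgue. f z) \<le> C"
proof -
  let ?w = "\<lambda>z::real^2. indicator (cbox 0 One) z * C"
  have w: "integrable lebesgue ?w"
    by (intro integrable_mult_left integrable_real_indicator) (auto simp: emeasure_lborel_cbox_eq)
  have b: "AE x in lebesgue. norm (indicat_real (cbox 0 One) x *\<^sub>R f x) \<le> ?w x"
    using assms(2) by eventually_elim (auto simp: indicator_def)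
  show *: "set_integrable lebesgue (cbox 0 One) f"
    unfolding set_integrable_def
    by (rule Bochner_Integration.integrable_bound[OF w])
      (use b indicator_cbox_measurable[OF assms(1)] in auto)
  have "norm (LINT z:cbox 0 One|lebesgue. f z) \<le> (\<integral>x. norm (indicat_real (cbox 0 One) x *\<^sub>R f x) \<partial>lebesgue)"
    unfolding set_lebesgue_integral_def by (rule integral_norm_bound)
  also have "\<dots> \<le> integral\<^sup>L lebesgue ?w"
    using * by (intro integral_mono_AE w b integrable_norm) (simp add: set_integrable_def)
  also have "\<dots> = C"
    by (simp add: unit_box_measure)
  finally show "norm (LINT z:cbox 0 One|lebesgue. f z) \<le> C" .
qed

text \<open>The bad set lies in the image of \<open>N\<close> under the smooth map y -> (x - y)/e.
  Consequently the points at which \<open>h\<close> is evaluated avoid \<open>N\<close> for almost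
  every z, and this for each single \<open>x\<close>, including \<open>x\<close> in
  \<open>N\<close>.\<close>

lemma AE_shift_notin_negligible:
  fixes N :: "(real^2) set"
  assumes "negligible N" "e \<noteq> 0"
  shows "negligible {z. x - e *\<^sub>R z \<in> N}" "AE z in lebesgue. x - e *\<^sub>R z \<notin> N"
proof -
  have "negligible ((\<lambda>y. (1/e) *\<^sub>R (x - y)) ` N)"
    using assms(1) by (intro negligible_differentiable_image_negligible) (auto intro!: derivative_intros)
  moreover have "z \<in> (\<lambda>y. (1/e) *\<^sub>R (x - y)) ` N" if "x - e *\<^sub>R z \<in> N" for z
    using that assms(2) by (intro image_eqI[of _ _ "x - e *\<^sub>R z"]) auto
  ultimately show "negligible {z. x - e *\<^sub>R z \<in> N}"
    by (elim negligible_subset) auto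
  then show "AE z in lebesgue. x - e *\<^sub>R z \<notin> N"
    by (intro AE_I'[of "{z. x - e *\<^sub>R z \<in> N}"]) (auto simp: negligible_iff_null_sets)
qed

text \<open>The Lipschitz constant dominates all difference quotients, and closedness of
  \<open>N\<close> turns continuity of the gradient on \<open>-N\<close> into continuity at each of
  its points. These are the two inputs for dominated convergence below.\<close>

locale lipschitz_C1_off =
  fixes h :: "real^2 \<Rightarrow> complex" and N :: "(real^2) set" and L :: real
  assumes lip: "L-lipschitz_on UNIV h" and N: "closed N" "negligible N"
    and diff: "\<And>x. x \<notin> N \<Longrightarrow> h differentiable (at x)"
    and cont: "\<And>i. continuous_on (-N) (\<lambda>x. grad h x $ i)"
begin

lemma norm_grad_le: "x \<notin> N \<Longrightarrow> norm (grad h x $ i) \<le> L"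
  using norm_grad_le_lipschitz[of L x 1 h i] lipschitz_on_subset[OF lip] diff by auto

lemma grad_shift_measurable:
  assumes "e \<noteq> 0"
  shows "(\<lambda>z. grad h (x - e *\<^sub>R z) $ i) \<in> borel_measurable lebesgue"
proof (rule measurable_continuous_off_negligible[OF _ AE_shift_notin_negligible(1)[OF N(2) assms]])
  show "continuous_on (- {z. x - e *\<^sub>R z \<in> N}) (\<lambda>z. grad h (x - e *\<^sub>R z) $ i)"
    by (rule continuous_on_compose2[OF cont[of i]]) (auto intro!: continuous_intros)
qed

lemma shift_measurable: "(\<lambda>z. h (x - e *\<^sub>R z)) \<in> borel_measurable lebesgue"
proof (rule measurable_continuous_off_negligible[where N="{}"])
  show "continuous_on (- {}) (\<lambda>z. h (x - e *\<^sub>R z))"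
    by (rule continuous_on_compose2[OF lipschitz_on_continuous_on[OF lip]])
      (auto intro!: continuous_intros)
qed auto

lemma shift_integrable: "set_integrable lebesgue (cbox 0 One) (\<lambda>z. h (x - e *\<^sub>R z))"
proof -
  have "compact ((\<lambda>z. h (x - e *\<^sub>R z)) ` cbox 0 One)"
    by (intro compact_continuous_image continuous_on_compose2[OF lipschitz_on_continuous_on[OF lip]])
      (auto intro!: continuous_intros)
  then obtain C where "\<And>z. z \<in> cbox 0 One \<Longrightarrow> norm (h (x - e *\<^sub>R z)) \<le> C"
    using compact_imp_bounded[of "(\<lambda>z. h (x - e *\<^sub>R z)) ` cbox 0 One"] unfolding bounded_iff by blast
  then show ?thesis
    by (intro unit_box_bounded_integrable shift_measurable) auto
qed

lemma grad_shift_AE_le: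
  assumes "e \<noteq> 0"
  shows "AE z in lebesgue. norm (grad h (x - e *\<^sub>R z) $ i) \<le> L"
  using AE_shift_notin_negligible(2)[OF N(2) assms] by eventually_elim (rule norm_grad_le)

lemma grad_shift_integrable:
  assumes "e \<noteq> 0"
  shows "set_integrable lebesgue (cbox 0 One) (\<lambda>z. grad h (x - e *\<^sub>R z) $ i)"
    "norm (LINT z:cbox 0 One|lebesgue. grad h (x - e *\<^sub>R z) $ i) \<le> L"
proof -
  have "AE z in lebesgue. z \<in> cbox 0 One \<longrightarrow> norm (grad h (x - e *\<^sub>R z) $ i) \<le> L" for x i
    using grad_shift_AE_le[OF assms, of x i] by eventually_elim simp
  from unit_box_bounded_integrable[OF grad_shift_measurable[OF assms] this]
  show "set_integrable lebesgue (cbox 0 One) (\<lambda>z. grad h (x - e *\<^sub>R z) $ i)"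
    "norm (LINT z:cbox 0 One|lebesgue. grad h (x - e *\<^sub>R z) $ i) \<le> L" .
qed

text \<open>Differentiation under the integral: for almost every z the Taylor remainder at x - e z
  vanishes in the limit, and Lipschitz continuity bounds it uniformly. The derivative therefore
  exists at every \<open>x\<close>, although \<open>h\<close> may fail to be differentiable on
  \<open>N\<close>.\<close>

lemma has_derivative_steklov:
  assumes e: "e \<noteq> 0"
  shows "(steklov h e has_derivative
    (\<lambda>u. \<Sum>i\<in>UNIV. u $ i *\<^sub>R (LINT z:cbox 0 One|lebesgue. grad h (x - e *\<^sub>R z) $ i))) (at x)"
    (is "(_ has_derivative ?D) _")
proof -
  \<comment> \<open>The first order remainder of \<open>h\<close> at x - e z in direction
    \<open>u\<close>, divided by \<open>norm u\<close>.\<close>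
  define q where "q u z = (h (x + u - e *\<^sub>R z) - h (x - e *\<^sub>R z)
      - (\<Sum>i\<in>UNIV. u $ i *\<^sub>R grad h (x - e *\<^sub>R z) $ i)) /\<^sub>R norm u" for u z
  have q_meas: "q u \<in> borel_measurable lebesgue" for u
    unfolding q_def
    by (intro borel_measurable_scaleR borel_measurable_diff borel_measurable_sum shift_measurable
        grad_shift_measurable e borel_measurable_const)
  have eq: "(steklov h e (x + u) - steklov h e x - ?D u) /\<^sub>R norm u
      = (LINT z:cbox 0 One|lebesgue. q u z)" for u
  proof -
    have *: "set_integrable lebesgue (cbox 0 One)
        (\<lambda>z. \<Sum>i\<in>UNIV. u $ i *\<^sub>R grad h (x - e *\<^sub>R z) $ i)"
      unfolding set_integrable_def scaleR_sum_right
      by (intro Bochner_Integration.integrable_sum)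
        (use grad_shift_integrable(1)[OF e] in \<open>simp add: set_integrable_def scaleR_left_commute[of _ "u $ _"] del: scaleR_scaleR\<close>)
    have "(LINT z:cbox 0 One|lebesgue. \<Sum>i\<in>UNIV. u $ i *\<^sub>R grad h (x - e *\<^sub>R z) $ i) = ?D u"
      unfolding set_lebesgue_integral_def scaleR_sum_right
      by (subst Bochner_Integration.integral_sum)
        (use grad_shift_integrable(1)[OF e] in \<open>simp_all add: set_integrable_def scaleR_left_commute[of _ "u $ _"] del: scaleR_scaleR\<close>)
    then show ?thesis
      unfolding q_def
      by (simp add: set_integral_diff shift_integrable * steklov_def)
  qed
  have "((\<lambda>u. (steklov h e (x + u) - steklov h e x - ?D u) /\<^sub>R norm u) \<longlongrightarrow> 0) (at 0)"
    unfolding eq tendsto_at_iff_sequentially comp_def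
  proof (intro allI impI)
    fix X :: "nat \<Rightarrow> real^2"
    assume X: "\<forall>n. X n \<in> UNIV - {0}" "X \<longlonglongrightarrow> 0"
    have "(\<lambda>n. LINT z:cbox 0 One|lebesgue. q (X n) z) \<longlonglongrightarrow> (LINT z:cbox (0::real^2) One|lebesgue. 0)"
    \<comment> \<open>One \<open>L\<close> bounds the increment of \<open>h\<close>, and one further
      \<open>L\<close> for each coordinate bounds the linear part.\<close>
    proof (rule unit_box_integral_tendsto[OF q_meas, where C="L + (\<Sum>i\<in>(UNIV::2 set). L)"])
      show "AE z in lebesgue. z \<in> cbox 0 One \<longrightarrow> (\<lambda>n. q (X n) z) \<longlonglongrightarrow> 0"
        using AE_shift_notin_negligible(2)[OF N(2) e, of x]
      proof eventually_elim
        case (elim z)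
        have "((\<lambda>u. q u z) \<longlongrightarrow> 0) (at 0)"
          using has_derivative_grad[OF diff[OF elim]]
          unfolding has_derivative_at q_def
          by (subst tendsto_norm_zero_iff[symmetric]) (simp add: divide_inverse mult.commute diff_add_eq)
        then show ?case
          using X unfolding tendsto_at_iff_sequentially comp_def by blast
      qed
      show "AE z in lebesgue. z \<in> cbox 0 One \<longrightarrow> norm (q (X n) z) \<le> L + (\<Sum>i\<in>(UNIV::2 set). L)" for n
        using AE_shift_notin_negligible(2)[OF N(2) e, of x]
      proof eventually_elim
        case (elim z)
        let ?u = "X n"
        have u: "norm ?u > 0" using X by auto
        have "norm (h (x + ?u - e *\<^sub>R z) - h (x - e *\<^sub>R z)) \<le> L * norm ?u"
          using lipschitz_on_normD[OF lip, of "x + ?u - e *\<^sub>R z" "x - e *\<^sub>R z"] by simp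
        moreover have "norm (\<Sum>i\<in>UNIV. ?u $ i *\<^sub>R grad h (x - e *\<^sub>R z) $ i) \<le> (\<Sum>i\<in>(UNIV::2 set). norm ?u * L)"
          by (intro sum_norm_le)
            (use norm_grad_le[OF elim] component_le_norm_cart in \<open>auto intro!: mult_mono\<close>)
        ultimately have "norm (h (x + ?u - e *\<^sub>R z) - h (x - e *\<^sub>R z)
           - (\<Sum>i\<in>UNIV. ?u $ i *\<^sub>R grad h (x - e *\<^sub>R z) $ i)) \<le> (L + (\<Sum>i\<in>(UNIV::2 set). L)) * norm ?u"
          by (intro order.trans[OF norm_triangle_ineq4]) (simp only: ring_distribs sum_distrib_left sum_distrib_right mult.commute add_mono)
        then show ?case
          using u by (simp add: q_def inverse_eq_divide pos_divide_le_eq)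
      qed
    qed auto
    then show "(\<lambda>n. LINT z:cbox 0 One|lebesgue. q (X n) z) \<longlonglongrightarrow> 0"
      by simp
  qed
  then have "((\<lambda>u. norm (steklov h e (x + u) - steklov h e x - ?D u) / norm u) \<longlongrightarrow> 0) (at 0)"
    by (auto dest: tendsto_norm_zero simp: divide_inverse mult.commute)
  then show ?thesis
    unfolding has_derivative_at
    by (auto intro!: bounded_linear_sum bounded_linear_intros)
qed

lemma grad_steklov:
  "e \<noteq> 0 \<Longrightarrow> grad (steklov h e) x $ i = (LINT z:cbox 0 One|lebesgue. grad h (x - e *\<^sub>R z) $ i)"
  by (subst grad_eqI[OF has_derivative_steklov]) (auto simp: axis_def if_distrib[of "\<lambda>c. c *\<^sub>R _"] cong: if_cong)

text \<open>With \<open>e\<close> fixed, x - e z is a continuity point of the gradient for almost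
  every z, so the averaged gradient is continuous everywhere by dominated convergence.\<close>

lemma steklov_C1: 
  assumes e: "e \<noteq> 0"
  shows "C1_function (steklov h e)"
  unfolding C1_function_def
proof (intro conjI allI)
  show "steklov h e differentiable (at x)" for x
    using has_derivative_steklov[OF e] differentiableI by blast
  show "continuous_on UNIV (\<lambda>x. grad (steklov h e) x $ i)" for i
    unfolding grad_steklov[OF e] continuous_on_sequentially comp_def
  proof (intro allI ballI impI)
    fix X and x :: "real^2" assume X: "(\<forall>n. X n \<in> UNIV) \<and> X \<longlonglongrightarrow> x"
    show "(\<lambda>n. LINT z:cbox 0 One|lebesgue. grad h (X n - e *\<^sub>R z) $ i)
      \<longlonglongrightarrow> (LINT z:cbox 0 One|lebesgue. grad h (x - e *\<^sub>R z) $ i)"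
    proof (rule unit_box_integral_tendsto)
      show "AE z in lebesgue. z \<in> cbox 0 One \<longrightarrow> (\<lambda>n. grad h (X n - e *\<^sub>R z) $ i) \<longlonglongrightarrow> grad h (x - e *\<^sub>R z) $ i"
        using AE_shift_notin_negligible(2)[OF N(2) e, of x]
      proof eventually_elim
        case (elim z)
        then have "isCont (\<lambda>x. grad h x $ i) (x - e *\<^sub>R z)"
          using cont[of i] N(1) by (subst (asm) continuous_on_eq_continuous_at) auto
        then show ?case
          using X by (intro impI isCont_tendsto_compose[where g="\<lambda>x. grad h x $ i"] tendsto_intros) auto
      qed
      show "AE z in lebesgue. z \<in> cbox 0 One \<longrightarrow> norm (grad h (X n - e *\<^sub>R z) $ i) \<le> L" for n
        using grad_shift_AE_le[OF e, of "X n" i] by eventually_elim auto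
    qed (intro grad_shift_measurable e)+
  qed
qed

lemma norm_steklov_diff_le: "norm (steklov h e x - h x) \<le> 2 * L * \<bar>e\<bar>"
proof -
  have L0: "L \<ge> 0"
    using lip lipschitz_on_nonneg by blast
  have c: "set_integrable lebesgue (cbox 0 One) (\<lambda>z::real^2. h x)"
    "(LINT z:cbox (0::real^2) One|lebesgue. h x) = h x"
    by (auto simp: set_integrable_def set_lebesgue_integral_def emeasure_lborel_cbox_eq unit_box_measure)
  have "norm (LINT z:cbox 0 One|lebesgue. h (x - e *\<^sub>R z) - h x) \<le> 2 * L * \<bar>e\<bar>"
  proof (rule unit_box_bounded_integrable(2), intro borel_measurable_diff shift_measurable)
    show "AE z in lebesgue. z \<in> cbox 0 One \<longrightarrow> cmod (h (x - e *\<^sub>R z) - h x) \<le> 2 * L * \<bar>e\<bar>"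
    proof (intro AE_I2 impI)
      fix z :: "real^2" assume "z \<in> cbox 0 One"
      then have "norm z \<le> 2"
        by (rule unit_box_norm)
      then have "L * norm (e *\<^sub>R z) \<le> L * (\<bar>e\<bar> * 2)"
        using L0 by (intro mult_left_mono) (auto intro!: mult_left_mono)
      with lipschitz_on_normD[OF lip, of "x - e *\<^sub>R z" x]
      show "cmod (h (x - e *\<^sub>R z) - h x) \<le> 2 * L * \<bar>e\<bar>"
        by simp
    qed
  qed auto
  then show ?thesis
    by (simp add: set_integral_diff shift_integrable c steklov_def)
qed

text \<open>Here \<open>x\<close> itself is a continuity point of the gradient and the shifts shrink
  to it, so the integrand converges for every z. The integral of the limit is the value at
  \<open>x\<close>, since the unit box has measure one.\<close>

lemma grad_steklov_tendsto:
  fixes e :: "nat \<Rightarrow> real"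
  assumes e: "e \<longlonglongrightarrow> 0" "\<And>n. e n \<noteq> 0" and x: "x \<notin> N"
  shows "(\<lambda>n. grad (steklov h (e n)) x $ i) \<longlonglongrightarrow> grad h x $ i"
proof -
  have "(\<lambda>n. LINT z:cbox 0 One|lebesgue. grad h (x - e n *\<^sub>R z) $ i)
    \<longlonglongrightarrow> (LINT z:cbox (0::real^2) One|lebesgue. grad h x $ i)"
  proof (rule unit_box_integral_tendsto)
    show "AE z in lebesgue. z \<in> cbox 0 One \<longrightarrow> (\<lambda>n. grad h (x - e n *\<^sub>R z) $ i) \<longlonglongrightarrow> grad h x $ i"
    proof (intro AE_I2 impI)
      fix z :: "real^2"
      have "isCont (\<lambda>x. grad h x $ i) x"
        using cont[of i] N(1) x by (subst (asm) continuous_on_eq_continuous_at) auto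
      moreover have "(\<lambda>n. x - e n *\<^sub>R z) \<longlonglongrightarrow> x - 0 *\<^sub>R z"
        by (intro tendsto_intros e)
      ultimately show "(\<lambda>n. grad h (x - e n *\<^sub>R z) $ i) \<longlonglongrightarrow> grad h x $ i"
        using isCont_tendsto_compose[of x "\<lambda>x. grad h x $ i"] by simp
    qed
    show "AE z in lebesgue. z \<in> cbox 0 One \<longrightarrow> norm (grad h (x - e n *\<^sub>R z) $ i) \<le> L" for n
      using grad_shift_AE_le[OF e(2), of x n i] by eventually_elim auto
  qed (auto intro!: grad_shift_measurable e)
  then show ?thesis
    by (simp add: grad_steklov e set_lebesgue_integral_def unit_box_measure)
qed

lemma steklov_support:
  assumes "\<And>y. y \<notin> K \<Longrightarrow> h y = 0" "steklov h e x \<noteq> 0"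
  shows "\<exists>y\<in>K. dist y x \<le> 2 * \<bar>e\<bar>"
proof (rule ccontr)
  assume *: "\<not> ?thesis"
  have "h (x - e *\<^sub>R z) = 0" if "z \<in> cbox 0 One" for z
  proof -
    have "norm z \<le> 2"
      using that by (rule unit_box_norm)
    then have "dist (x - e *\<^sub>R z) x \<le> 2 * \<bar>e\<bar>"
      by (simp add: dist_norm mult.commute mult_left_mono)
    then show ?thesis
      using * assms(1) by blast
  qed
  then have "steklov h e x = (LINT z:cbox (0::real^2) One|lebesgue. 0)"
    unfolding steklov_def by (intro set_lebesgue_integral_cong) auto
  with assms(2) show False by simp
qed

end

section \<open>Testing weak gradients against compactly supported functions\<close>

lemma locally_integrable_nth:
  fixes g :: "real^2 \<Rightarrow> complex^2"
  assumes "locally_integrable_on U g"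
  shows "locally_integrable_on U (\<lambda>x. g x $ i)"
  unfolding locally_integrable_on_def set_integrable_def
proof (intro allI impI)
  fix K assume "compact K \<and> K \<subseteq> U"
  then have "integrable lebesgue (\<lambda>x. indicat_real K x *\<^sub>R g x)"
    using assms by (simp add: locally_integrable_on_def set_integrable_def)
  from integrable_bounded_linear[OF bounded_linear_vec_nth[of i] this]
  show "complex_integrable lebesgue (\<lambda>x. indicat_real K x *\<^sub>R g x $ i)"
    by simp
qed

text \<open>\<open>u\<close> is only locally integrable on \<open>U\<close>; the support of
  \<open>b\<close> moves the integral to \<open>K\<close>, where \<open>u\<close> is integrable and
  serves as a majorant up to the factor \<open>C\<close>.\<close>

lemma integrable_mult_compact_support:
  fixes u b :: "real^2 \<Rightarrow> complex"
  assumes "set_integrable lebesgue K u" "K \<subseteq> U" "b \<in> borel_measurable lebesgue"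
    and "AE x in lebesgue. norm (b x) \<le> C" "\<And>x. x \<notin> K \<Longrightarrow> b x = 0"
  shows "set_integrable lebesgue U (\<lambda>x. u x * b x)"
proof -
  have eq: "indicat_real U x *\<^sub>R (u x * b x) = (indicat_real K x *\<^sub>R u x) * b x" for x
    using assms(2,5) by (cases "x \<in> K") (auto simp: indicator_def)
  show ?thesis
    unfolding set_integrable_def eq
  proof (rule Bochner_Integration.integrable_bound)
    show "integrable lebesgue (\<lambda>x. C *\<^sub>R (indicat_real K x *\<^sub>R u x))"
      using assms(1) by (intro integrable_scaleR_right) (simp add: set_integrable_def)
    show "(\<lambda>x. indicat_real K x *\<^sub>R u x * b x) \<in> borel_measurable lebesgue"
      using assms(1,3) by (intro borel_measurable_times) (auto simp: set_integrable_def)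
    show "AE x in lebesgue. norm (indicat_real K x *\<^sub>R u x * b x) \<le> norm (C *\<^sub>R (indicat_real K x *\<^sub>R u x))"
      using assms(4)
    proof eventually_elim
      case (elim x)
      then have "norm (b x) \<le> \<bar>C\<bar>" by simp
      then show ?case
        by (simp only: norm_mult norm_scaleR mult.commute[of _ "norm (b x)"] mult_right_mono)
          (simp add: mult_right_mono)
    qed
  qed
qed

lemma compact_support_integral_tendsto:
  fixes u b' :: "real^2 \<Rightarrow> complex" and b :: "nat \<Rightarrow> real^2 \<Rightarrow> complex"
  assumes K: "set_integrable lebesgue K u" "K \<subseteq> U"
    and meas: "\<And>n. b n \<in> borel_measurable lebesgue" "b' \<in> borel_measurable lebesgue"
    and lim: "AE x in lebesgue. (\<lambda>n. b n x) \<longlonglongrightarrow> b' x"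
    and bound: "\<And>n. AE x in lebesgue. norm (b n x) \<le> C"
    and supp: "\<And>n x. x \<notin> K \<Longrightarrow> b n x = 0" "\<And>x. x \<notin> K \<Longrightarrow> b' x = 0"
  shows "(\<lambda>n. LINT x:U|lebesgue. u x * b n x) \<longlonglongrightarrow> (LINT x:U|lebesgue. u x * b' x)"
proof -
  have eq: "indicat_real U x *\<^sub>R (u x * b n x) = (indicat_real K x *\<^sub>R u x) * b n x"
    "indicat_real U x *\<^sub>R (u x * b' x) = (indicat_real K x *\<^sub>R u x) * b' x" for x n
    using assms(2) supp by (cases "x \<in> K"; force simp: indicator_def)+
  have u: "integrable lebesgue (\<lambda>x. indicat_real K x *\<^sub>R u x)"
    using K by (simp add: set_integrable_def)
  show ?thesis
    unfolding set_lebesgue_integral_def eq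
  proof (rule integral_dominated_convergence)
    show "integrable lebesgue (\<lambda>x. norm (indicat_real K x *\<^sub>R u x) * C)"
      using u by (intro integrable_mult_left integrable_norm)
    show "AE x in lebesgue. (\<lambda>n. indicat_real K x *\<^sub>R u x * b n x) \<longlonglongrightarrow> indicat_real K x *\<^sub>R u x * b' x"
      using lim by eventually_elim (intro tendsto_intros)
    show "AE x in lebesgue. norm (indicat_real K x *\<^sub>R u x * b n x) \<le> norm (indicat_real K x *\<^sub>R u x) * C" for n
      using bound[of n]
      by eventually_elim (simp only: norm_mult mult_left_mono norm_ge_zero)
  qed (intro borel_measurable_times meas borel_measurable_integrable u)+
qed

lemma grad_0_off_support:
  fixes f :: "real^2 \<Rightarrow> 'b::real_normed_vector"
  assumes "closed K" "\<And>x. x \<notin> K \<Longrightarrow> f x = 0" "x \<notin> K"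
  shows "grad f x $ i = 0"
proof -
  have "grad f x = grad (\<lambda>_. 0) x"
    using assms by (intro grad_cong_open[of "-K"]) auto
  then show ?thesis
    using grad_eqI[OF has_derivative_const[of 0 "at x"], of i] by simp
qed

lemma continuous_on_lebesgue_measurable:
  fixes f :: "'a::euclidean_space \<Rightarrow> 'b::euclidean_space"
  shows "continuous_on UNIV f \<Longrightarrow> f \<in> borel_measurable lebesgue"
  using measurable_continuous_off_negligible[of "{}" f] by simp

lemma continuous_compact_support_bounded:
  fixes f :: "real^2 \<Rightarrow> 'b::real_normed_vector"
  assumes "continuous_on UNIV f" "compact K" "\<And>x. x \<notin> K \<Longrightarrow> f x = 0"
  obtains C where "C \<ge> 0" "\<And>x. norm (f x) \<le> C"
proof -
  have "bounded (f ` K)"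
    using assms(1,2) continuous_on_subset by (blast intro: compact_imp_bounded compact_continuous_image)
  then obtain C where C: "C > 0" "\<And>x. x \<in> K \<Longrightarrow> norm (f x) \<le> C"
    by (auto simp: bounded_pos)
  have "norm (f x) \<le> C" for x
    using C assms(3)[of x] by (cases "x \<in> K") auto
  with C(1) that show ?thesis
    by (metis less_imp_le)
qed

lemma C1_function_continuous: "C1_function f \<Longrightarrow> continuous_on UNIV f"
  by (simp add: C1_function_def continuous_at_imp_continuous_on differentiable_imp_continuous_within)

lemma grad_bounded_linear:
  assumes "bounded_linear l" "f differentiable (at x)"
  shows "(\<lambda>x. l (f x)) differentiable (at x)" "grad (\<lambda>x. l (f x)) x $ i = l (grad f x $ i)"
proof -
  from assms(2) have "(f has_derivative frechet_derivative f (at x)) (at x)"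
    by (simp add: frechet_derivative_works)
  from bounded_linear.has_derivative[OF assms(1) this]
  show "(\<lambda>x. l (f x)) differentiable (at x)" "grad (\<lambda>x. l (f x)) x $ i = l (grad f x $ i)"
    by (auto simp: differentiable_def grad_eqI) (simp add: grad_def)
qed

text \<open>Weak gradients are defined through real test functions. Real and imaginary parts of a
  complex one are admissible, and the identity is complex linear in the test function.\<close>

lemma has_weak_grad_complex_test:
  assumes wg: "has_weak_grad U u g" and f: "C1_function f"
    and K: "compact K" "K \<subseteq> U" and supp: "\<And>x. x \<notin> K \<Longrightarrow> f x = 0"
  shows "(LINT x:U|lebesgue. u x * grad f x $ i) = - (LINT x:U|lebesgue. g x $ i * f x)"
proof -
  have int: "set_integrable lebesgue K u" "set_integrable lebesgue K (\<lambda>x. g x $ i)"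
    using wg K locally_integrable_nth[of U g i] by (auto simp: has_weak_grad_def locally_integrable_on_def)
  have d: "f differentiable (at x)" for x
    using f by (simp add: C1_function_def)
  have c: "continuous_on UNIV f" "continuous_on UNIV (\<lambda>x. grad f x $ i)" for i
    using f by (auto simp: C1_function_continuous C1_function_def)
  \<comment> \<open>The bounded linear \<open>l\<close> stands for \<open>Re\<close> and
    \<open>Im\<close>, which are treated at once.\<close>
  have *: "(LINT x:U|lebesgue. u x * of_real (l (grad f x $ i))) = - (LINT x:U|lebesgue. g x $ i * of_real (l (f x)))"
    "set_integrable lebesgue U (\<lambda>x. u x * of_real (l (grad f x $ i)))"
    "set_integrable lebesgue U (\<lambda>x. g x $ i * of_real (l (f x)))"
    if l: "bounded_linear l" for l :: "complex \<Rightarrow> real"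
  proof -
    interpret l: bounded_linear l by fact
    have "test_function_on U (\<lambda>x. l (f x))"
      unfolding test_function_on_def C1_function_def
      using K supp c l.zero by (auto simp: grad_bounded_linear[OF l d] intro!: l.continuous_on)
    then have "(LINT x:U|lebesgue. u x * of_real (grad (\<lambda>x. l (f x)) x $ i)) = - (LINT x:U|lebesgue. g x $ i * of_real (l (f x)))"
      using wg unfolding has_weak_grad_def by blast
    then show "(LINT x:U|lebesgue. u x * of_real (l (grad f x $ i))) = - (LINT x:U|lebesgue. g x $ i * of_real (l (f x)))"
      by (simp only: grad_bounded_linear(2)[OF l d])
    have cl: "continuous_on UNIV (\<lambda>x. complex_of_real (l (f x)))" "continuous_on UNIV (\<lambda>x. complex_of_real (l (grad f x $ i)))"
      using c by (auto intro!: continuous_on_of_real l.continuous_on)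
    have s: "complex_of_real (l (f x)) = 0" "complex_of_real (l (grad f x $ i)) = 0" if "x \<notin> K" for x
      using that supp grad_0_off_support[OF compact_imp_closed[OF K(1)] supp] l.zero by auto
    obtain C where "\<And>x. norm (complex_of_real (l (grad f x $ i))) \<le> C"
      using continuous_compact_support_bounded[OF cl(2) K(1) s(2)] by blast
    then show "set_integrable lebesgue U (\<lambda>x. u x * of_real (l (grad f x $ i)))"
      by (intro integrable_mult_compact_support[OF int(1) K(2)] continuous_on_lebesgue_measurable[OF cl(2)] s(2)) auto
    obtain C where "\<And>x. norm (complex_of_real (l (f x))) \<le> C"
      using continuous_compact_support_bounded[OF cl(1) K(1) s(1)] by blast
    then show "set_integrable lebesgue U (\<lambda>x. g x $ i * of_real (l (f x)))"
      by (intro integrable_mult_compact_support[OF int(2) K(2)] continuous_on_lebesgue_measurable[OF cl(1)] s(1)) auto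
  qed
  have split: "v * z = v * of_real (Re z) + \<i> * (v * of_real (Im z))" for v z :: complex
    by (simp add: complex_eq_iff)
  have "(LINT x:U|lebesgue. u x * grad f x $ i) =
      (LINT x:U|lebesgue. u x * of_real (Re (grad f x $ i))) + \<i> * (LINT x:U|lebesgue. u x * of_real (Im (grad f x $ i)))"
    by (subst split, subst set_integral_add) 
      (auto intro!: * bounded_linear_Re bounded_linear_Im)
  also have "\<dots> = - ((LINT x:U|lebesgue. g x $ i * of_real (Re (f x))) + \<i> * (LINT x:U|lebesgue. g x $ i * of_real (Im (f x))))"
    by (simp add: *(1)[OF bounded_linear_Re] *(1)[OF bounded_linear_Im])
  also have "\<dots> = - (LINT x:U|lebesgue. g x $ i * f x)"
    by (subst (3) split, subst set_integral_add) 
      (auto intro!: * bounded_linear_Re bounded_linear_Im)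
  finally show ?thesis .
qed

text \<open>Averaging enlarges supports. The set \<open>K'\<close> is the closed d-neighbourhood of
  \<open>K\<close>, a sum of compact sets, and provides a common compact support inside
  \<open>U\<close> for all sufficiently small averages.\<close>

lemma compact_thicken:
  fixes K :: "(real^2) set"
  assumes "compact K" "open U" "K \<subseteq> U"
  obtains d K' where "d > 0" "compact K'" "K' \<subseteq> U" "\<And>x. x \<in> K \<Longrightarrow> cball x d \<subseteq> K'"
proof -
  obtain d where d: "d > 0" "(\<Union>x\<in>K. cball x d) \<subseteq> U"
    using compact_subset_open_imp_cball_epsilon_subset[OF assms] by blast
  let ?K' = "{x + y |x y. x \<in> K \<and> y \<in> cball 0 d}"
  have "compact ?K'"
    by (intro compact_sums assms) auto
  moreover have "?K' \<subseteq> U"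
    using d(2) by (force simp: dist_norm)
  moreover have "cball x d \<subseteq> ?K'" if "x \<in> K" for x
  proof
    fix z assume "z \<in> cball x d"
    then have "z = x + (z - x) \<and> x \<in> K \<and> z - x \<in> cball 0 d"
      using that by (simp add: dist_norm norm_minus_commute)
    then show "z \<in> ?K'" by blast
  qed
  ultimately show ?thesis using d(1) that by blast
qed

text \<open>The identity holds for the averages of \<open>h\<close>. On the left their gradients
  converge almost everywhere below the bound \<open>L\<close>; on the right the averages converge
  uniformly. Both limits are taken against functions integrable over one compact set.\<close>

lemma (in lipschitz_C1_off) has_weak_grad_lipschitz_test:
  assumes wg: "has_weak_grad U u g" and U: "open U"
    and K: "compact K" "K \<subseteq> U" and supp: "\<And>x. x \<notin> K \<Longrightarrow> h x = 0"
  shows "(LINT x:U|lebesgue. u x * grad h x $ i) = - (LINT x:U|lebesgue. g x $ i * h x)"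
proof -
  obtain d K' where d: "d > 0" and K': "compact K'" "K' \<subseteq> U" and thick: "\<And>x. x \<in> K \<Longrightarrow> cball x d \<subseteq> K'"
    using compact_thicken[OF K(1) U K(2)] by metis
  have int: "set_integrable lebesgue K' u" "set_integrable lebesgue K' (\<lambda>x. g x $ i)"
    using wg K' locally_integrable_nth[of U g i] by (auto simp: has_weak_grad_def locally_integrable_on_def)
  \<comment> \<open>The averages reach a distance of at most 2 |e n|, so d/2 is the largest side
    that keeps their support in \<open>K'\<close>.\<close>
  define e where "e n = d / 2 / real (Suc n)" for n
  have e: "e \<longlonglongrightarrow> 0" "\<And>n. e n \<noteq> 0" "\<And>n. 2 * \<bar>e n\<bar> \<le> d"
  proof -
    show "e \<longlonglongrightarrow> 0"
      unfolding e_def by (rule real_tendsto_divide_at_top[OF tendsto_const]) 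
        (rule filterlim_compose[OF filterlim_real_sequentially filterlim_Suc])
    show "e n \<noteq> 0" "2 * \<bar>e n\<bar> \<le> d" for n
      using d by (auto simp: e_def divide_simps mult_le_cancel_left1)
  qed
  let ?J = "\<lambda>n. steklov h (e n)"
  have suppJ: "?J n x = 0" if "x \<notin> K'" for n x
    using steklov_support[OF supp, where e="e n" and x=x] thick e(3)[of n] that
    by (meson mem_cball order_trans subsetD)
  have cont_h: "continuous_on UNIV h"
    using lip lipschitz_on_continuous_on by blast
  obtain M where M: "M \<ge> 0" "\<And>x. norm (h x) \<le> M"
    using continuous_compact_support_bounded[OF cont_h K(1) supp] by blast
  have L0: "L \<ge> 0"
    using lip lipschitz_on_nonneg by blast
  have K_K': "K \<subseteq> K'"
    using thick d by force
  have *: "(LINT x:U|lebesgue. u x * grad (?J n) x $ i) = - (LINT x:U|lebesgue. g x $ i * ?J n x)" for n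
    by (rule has_weak_grad_complex_test[OF wg steklov_C1[OF e(2)] K'(1,2) suppJ])
  have "(\<lambda>n. LINT x:U|lebesgue. u x * grad (?J n) x $ i) \<longlonglongrightarrow> (LINT x:U|lebesgue. u x * grad h x $ i)"
  proof (rule compact_support_integral_tendsto[OF int(1) K'(2), where C=L])
    show "(\<lambda>x. grad (?J n) x $ i) \<in> borel_measurable lebesgue" for n
      using steklov_C1[OF e(2)] by (intro continuous_on_lebesgue_measurable) (simp add: C1_function_def)
    show "(\<lambda>x. grad h x $ i) \<in> borel_measurable lebesgue"
      by (rule measurable_continuous_off_negligible[OF cont N(2)])
    show "AE x in lebesgue. (\<lambda>n. grad (?J n) x $ i) \<longlonglongrightarrow> grad h x $ i"
      using N(2) grad_steklov_tendsto[OF e(1,2)] by (intro AE_I'[of N]) (auto simp: negligible_iff_null_sets)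
    show "AE x in lebesgue. norm (grad (?J n) x $ i) \<le> L" for n
      by (simp add: grad_steklov e(2) grad_shift_integrable(2))
    show "grad (?J n) x $ i = 0" if "x \<notin> K'" for n x
      by (rule grad_0_off_support[OF compact_imp_closed[OF K'(1)] suppJ that])
    show "grad h x $ i = 0" if "x \<notin> K'" for x
      using that K_K' by (intro grad_0_off_support[OF compact_imp_closed[OF K(1)] supp]) auto
  qed
  moreover have "(\<lambda>n. LINT x:U|lebesgue. g x $ i * ?J n x) \<longlonglongrightarrow> (LINT x:U|lebesgue. g x $ i * h x)"
  proof (rule compact_support_integral_tendsto[OF int(2) K'(2), where C="M + L * d"])
    show "?J n \<in> borel_measurable lebesgue" for n
      by (intro continuous_on_lebesgue_measurable C1_function_continuous steklov_C1 e)
    show "h \<in> borel_measurable lebesgue"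
      by (intro continuous_on_lebesgue_measurable cont_h)
    show "AE x in lebesgue. (\<lambda>n. ?J n x) \<longlonglongrightarrow> h x"
    proof (rule AE_I2)
      fix x
      have "(\<lambda>n. 2 * L * \<bar>e n\<bar>) \<longlonglongrightarrow> 0"
        using tendsto_mult[OF tendsto_const[of "2*L"] tendsto_rabs[OF e(1)]] by simp
      then have "(\<lambda>n. ?J n x - h x) \<longlonglongrightarrow> 0"
        by (rule Lim_null_comparison[rotated]) (use norm_steklov_diff_le in auto)
      then show "(\<lambda>n. ?J n x) \<longlonglongrightarrow> h x"
        by (rule LIM_zero_cancel)
    qed
    show "AE x in lebesgue. norm (?J n x) \<le> M + L * d" for n
    proof (intro AE_I2)
      fix x
      have "norm (?J n x) \<le> norm (h x) + 2 * L * \<bar>e n\<bar>"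
        using norm_steklov_diff_le[of "e n" x] norm_triangle_sub[of "?J n x" "h x"] by linarith
      also have "\<dots> \<le> M + L * d"
        using M(2)[of x] mult_left_mono[OF e(3)[of n] L0] by (simp add: mult_ac)
      finally show "norm (?J n x) \<le> M + L * d" .
    qed
    show "?J n x = 0" if "x \<notin> K'" for n x
      by (rule suppJ[OF that])
    show "h x = 0" if "x \<notin> K'" for x
      using that K_K' supp by auto
  qed
  then have "(\<lambda>n. LINT x:U|lebesgue. u x * grad (?J n) x $ i) \<longlonglongrightarrow> - (LINT x:U|lebesgue. g x $ i * h x)"
    unfolding * by (rule tendsto_minus)
  ultimately show ?thesis
    by (rule LIMSEQ_unique)
qed

section \<open>Locally Lipschitz functions and the product rule\<close>

text \<open>The ball is not intersected with \<open>U\<close>. The condition at a point is thus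
  independent of \<open>U\<close>, and passing to subsets or gluing over a union is
  immediate.\<close>

definition locally_lipschitz :: "'a::metric_space set \<Rightarrow> ('a \<Rightarrow> 'b::metric_space) \<Rightarrow> bool" where
  "locally_lipschitz U f \<longleftrightarrow> (\<forall>x\<in>U. \<exists>e>0. \<exists>L. L-lipschitz_on (ball x e) f)"

lemma locally_lipschitzE:
  assumes "locally_lipschitz U f" "x \<in> U"
  obtains e L where "e > 0" "L-lipschitz_on (ball x e) f"
  using assms unfolding locally_lipschitz_def by blast

lemma lipschitz_on_smaller_ball:
  "L-lipschitz_on (ball x e) f \<Longrightarrow> d \<le> e \<Longrightarrow> L-lipschitz_on (ball x d) f"
  by (rule lipschitz_on_subset) auto

lemma locally_lipschitz_continuous:
  assumes "locally_lipschitz U f"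
  shows "continuous_on U f"
proof (rule continuous_at_imp_continuous_on, rule ballI)
  fix x assume "x \<in> U"
  then obtain e L where e: "e > 0" "L-lipschitz_on (ball x e) f"
    using locally_lipschitzE[OF assms] by blast
  then have "continuous_on (ball x e) f"
    using lipschitz_on_continuous_on by blast
  then show "isCont f x"
    using e(1) by (subst (asm) continuous_on_eq_continuous_at) auto
qed

lemma locally_lipschitz_subset: "locally_lipschitz U f \<Longrightarrow> V \<subseteq> U \<Longrightarrow> locally_lipschitz V f"
  unfolding locally_lipschitz_def by blast

lemma lipschitz_imp_locally_lipschitz: "L-lipschitz_on UNIV f \<Longrightarrow> locally_lipschitz U f"
  unfolding locally_lipschitz_def using lipschitz_on_subset zero_less_one by blast

text \<open>\<open>local_lipschitz\<close> concerns a family depending on a time parameter; a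
  one-point time set makes its compactness theorem available for a single function.\<close>

lemma locally_lipschitz_compact:
  assumes "locally_lipschitz U f" "compact K" "K \<subseteq> U"
  obtains L where "L-lipschitz_on K f"
proof -
  have "local_lipschitz {0::real} K (\<lambda>_. f)"
  proof (rule local_lipschitzI)
    fix x assume "x \<in> K"
    then obtain e L where e: "e > 0" "L-lipschitz_on (ball x e) f"
      using assms by (auto elim: locally_lipschitzE)
    have "L-lipschitz_on (cball x (e/2) \<inter> K) f"
      by (rule lipschitz_on_subset[OF e(2)]) (use e(1) in auto)
    then show "\<exists>u>0. \<exists>L. \<forall>t\<in>cball t u \<inter> {0::real}. L-lipschitz_on (cball x u \<inter> K) f" for t
      using e(1) by (intro exI[of _ "e/2"]) auto
  qed
  then show ?thesis
    using local_lipschitz_compact_implies_lipschitz[of "{0::real}" K "\<lambda>_. f"] assms(2) that by auto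
qed

lemma locally_lipschitz_cong_open:
  assumes "locally_lipschitz U f" "open U" "\<And>x. x \<in> U \<Longrightarrow> f x = g x"
  shows "locally_lipschitz U g"
  unfolding locally_lipschitz_def
proof
  fix x assume x: "x \<in> U"
  with assms obtain e L where e: "e > 0" "L-lipschitz_on (ball x e) f"
    by (auto elim: locally_lipschitzE)
  obtain d where d: "d > 0" "ball x d \<subseteq> U"
    using assms(2) x openE by blast
  have "L-lipschitz_on (ball x (min d e)) g"
    by (rule lipschitz_on_transform[OF lipschitz_on_smaller_ball[OF e(2), of "min d e"]])
      (use assms(3) d(2) in auto)
  then show "\<exists>e>0. \<exists>L. L-lipschitz_on (ball x e) g"
    using d e by (intro exI[of _ "min d e"]) auto
qed

lemma locally_lipschitz_compose:
  assumes f: "locally_lipschitz U f" and g: "locally_lipschitz V g" and fU: "f ` U \<subseteq> V"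
  shows "locally_lipschitz U (\<lambda>x. g (f x))"
  unfolding locally_lipschitz_def
proof
  fix x assume x: "x \<in> U"
  obtain e L where e: "e > 0" "L-lipschitz_on (ball x e) f"
    using f x by (rule locally_lipschitzE)
  have "f x \<in> V" using x fU by auto
  with g obtain d M where d: "d > 0" "M-lipschitz_on (ball (f x) d) g"
    by (rule locally_lipschitzE)
  have L: "L \<ge> 0" using e lipschitz_on_nonneg by blast
  \<comment> \<open>Dividing by \<open>L + 1\<close> covers the case \<open>L = 0\<close> and leaves
    the image strictly inside the ball of radius \<open>d\<close>.\<close>
  define a where "a = min e (d / (L + 1))"
  have a: "a > 0" using e d L by (simp add: a_def)
  have "f y \<in> ball (f x) d" if "y \<in> ball x a" for y
  proof -
    have "dist (f x) (f y) \<le> L * dist x y"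
      using that e by (intro lipschitz_onD[OF e(2)]) (auto simp: a_def)
    also have "\<dots> \<le> L * (d / (L + 1))"
      using that L by (intro mult_left_mono) (auto simp: a_def)
    also have "\<dots> < d"
      using L d by (simp add: field_simps)
    finally show ?thesis by simp
  qed
  then have im: "f ` ball x a \<subseteq> ball (f x) d" by blast
  have "(M * L)-lipschitz_on (ball x a) (\<lambda>x. g (f x))"
    by (rule lipschitz_on_compose2[OF lipschitz_on_smaller_ball[OF e(2)] lipschitz_on_subset[OF d(2) im]])
      (simp add: a_def)
  then show "\<exists>e>0. \<exists>L. L-lipschitz_on (ball x e) (\<lambda>x. g (f x))"
    using a by blast
qed

lemma locally_lipschitz_mult:
  fixes f g :: "'a::metric_space \<Rightarrow> complex"
  assumes f: "locally_lipschitz U f" and g: "locally_lipschitz U g"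
  shows "locally_lipschitz U (\<lambda>x. f x * g x)"
  unfolding locally_lipschitz_def
proof
  fix x assume x: "x \<in> U"
  obtain e L where e: "e > 0" "L-lipschitz_on (ball x e) f"
    using f x by (rule locally_lipschitzE)
  obtain d M where d: "d > 0" "M-lipschitz_on (ball x d) g"
    using g x by (rule locally_lipschitzE)
  have L: "L \<ge> 0" "M \<ge> 0" using e d lipschitz_on_nonneg by blast+
  define a where "a = min e d"
  define A where "A = norm (f x) + L * a"
  define B where "B = norm (g x) + M * a"
  have a: "a > 0" using e d by (simp add: a_def)
  have bf: "norm (f y) \<le> A" "norm (g y) \<le> B" if "y \<in> ball x a" for y
  proof -
    have "dist (f x) (f y) \<le> L * dist x y" "dist (g x) (g y) \<le> M * dist x y"
      using that e d by (auto intro!: lipschitz_onD[OF e(2)] lipschitz_onD[OF d(2)] simp: a_def)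
    moreover have "L * dist x y \<le> L * a" "M * dist x y \<le> M * a"
      using that L by (auto intro!: mult_left_mono)
    ultimately show "norm (f y) \<le> A" "norm (g y) \<le> B"
      using norm_triangle_sub[of "f y" "f x"] norm_triangle_sub[of "g y" "g x"]
      by (auto simp: A_def B_def dist_norm norm_minus_commute)
  qed
  have AB: "A \<ge> 0" "B \<ge> 0" using L a by (auto simp: A_def B_def)
  have "(A * M + B * L)-lipschitz_on (ball x a) (\<lambda>x. f x * g x)"
  proof (rule lipschitz_onI)
    fix y z assume yz: "y \<in> ball x a" "z \<in> ball x a"
    have "f y * g y - f z * g z = f y * (g y - g z) + g z * (f y - f z)"
      by (simp add: algebra_simps)
    then have "dist (f y * g y) (f z * g z) \<le> norm (f y) * dist (g y) (g z) + norm (g z) * dist (f y) (f z)"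
      unfolding dist_norm by (metis norm_mult norm_triangle_ineq)
    also have "\<dots> \<le> A * (M * dist y z) + B * (L * dist y z)"
      using yz AB L by (intro add_mono mult_mono bf lipschitz_onD[OF e(2)] lipschitz_onD[OF d(2)])
        (auto simp: a_def)
    finally show "dist (f y * g y) (f z * g z) \<le> (A * M + B * L) * dist y z"
      by (simp add: algebra_simps)
  qed (use AB L in auto)
  then show "\<exists>e>0. \<exists>L. L-lipschitz_on (ball x e) (\<lambda>x. f x * g x)"
    using a by blast
qed

lemma locally_lipschitz_bounded_linear:
  assumes "bounded_linear l"
  shows "locally_lipschitz U l"
proof -
  obtain B where "B-lipschitz_on UNIV l"
    using bounded_linear.lipschitz_boundE[OF assms] by metis
  then show ?thesis by (rule lipschitz_imp_locally_lipschitz)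
qed

text \<open>The mean value inequality on a ball, which is convex; the partial derivatives are
  bounded on the closed ball by compactness.\<close>

lemma C1_imp_locally_lipschitz:
  fixes f :: "real^2 \<Rightarrow> 'b::real_normed_vector"
  assumes S: "open S" and d: "\<And>x. x \<in> S \<Longrightarrow> f differentiable (at x)"
    and c: "\<And>i. continuous_on S (\<lambda>x. grad f x $ i)"
  shows "locally_lipschitz S f"
  unfolding locally_lipschitz_def
proof
  fix x assume "x \<in> S"
  then obtain e where e: "e > 0" "cball x e \<subseteq> S"
    using S open_contains_cball by blast
  have "\<exists>C. \<forall>y\<in>cball x e. norm (grad f y $ i) \<le> C" for i
  proof -
    have "bounded ((\<lambda>y. grad f y $ i) ` cball x e)"
      by (intro compact_imp_bounded compact_continuous_image continuous_on_subset[OF c[of i] e(2)] compact_cball)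
    then show ?thesis by (simp add: bounded_iff)
  qed
  then obtain C where C: "\<And>i y. y \<in> cball x e \<Longrightarrow> norm (grad f y $ i) \<le> C i"
    by metis
  define L where "L = sum C UNIV"
  have C0: "C i \<ge> 0" for i
    by (rule order_trans[OF norm_ge_zero C[of x i]]) (use e(1) in simp)
  have "L-lipschitz_on (ball x e) f"
  proof (rule bounded_derivative_imp_lipschitz[where f'="\<lambda>y u. \<Sum>i\<in>UNIV. u $ i *\<^sub>R grad f y $ i"])
    show "(f has_derivative (\<lambda>u. \<Sum>i\<in>UNIV. u $ i *\<^sub>R grad f y $ i)) (at y within ball x e)" if "y \<in> ball x e" for y
      by (rule has_derivative_at_withinI, rule has_derivative_grad[OF d]) (use that e(2) in auto)
    show "onorm (\<lambda>u. \<Sum>i\<in>UNIV. u $ i *\<^sub>R grad f y $ i) \<le> L" if "y \<in> ball x e" for y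
    proof (rule onorm_le)
      fix u :: "real^2"
      have "norm (\<Sum>i\<in>UNIV. u $ i *\<^sub>R grad f y $ i) \<le> (\<Sum>i\<in>UNIV. norm u * C i)"
        using C[of y] that component_le_norm_cart[of u]
        by (intro sum_norm_le) (auto intro!: mult_mono)
      also have "\<dots> = L * norm u"
        by (simp add: L_def sum_distrib_left mult.commute)
      finally show "norm (\<Sum>i\<in>UNIV. u $ i *\<^sub>R grad f y $ i) \<le> L * norm u" .
    qed
    show "0 \<le> L" unfolding L_def by (intro sum_nonneg C0)
  qed auto
  then show "\<exists>e>0. \<exists>L. L-lipschitz_on (ball x e) f"
    using e(1) by blast
qed

text \<open>Two regimes. At distance below 1, either both values vanish or both points lie in a
  fixed compact ball. At distance at least 1, the bound \<open>2 * C\<close> on the difference of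
  values is itself at most \<open>2 * C\<close> times the distance.\<close>

lemma locally_lipschitz_compact_support:
  fixes f :: "real^2 \<Rightarrow> complex"
  assumes f: "locally_lipschitz UNIV f" and K: "compact K" "\<And>x. x \<notin> K \<Longrightarrow> f x = 0"
  obtains L where "L-lipschitz_on UNIV f"
proof -
  obtain R where R: "R > 0" "K \<subseteq> ball 0 R"
    using bounded_subset_ballD[OF compact_imp_bounded[OF K(1)], of 0] by auto
  obtain L where L: "L-lipschitz_on (cball 0 (R + 1)) f"
    using locally_lipschitz_compact[OF f, of "cball 0 (R+1)"] by auto
  obtain C where C: "C \<ge> 0" "\<And>x. norm (f x) \<le> C"
    using continuous_compact_support_bounded[OF locally_lipschitz_continuous[OF f] K] by blast
  have L0: "L \<ge> 0" using L lipschitz_on_nonneg by blast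
  have "(L + 2 * C)-lipschitz_on UNIV f"
  proof (rule lipschitz_onI)
    fix x y :: "real^2"
    have pos: "0 \<le> C * dist x y" "0 \<le> L * dist x y" using C L0 by auto
    show "dist (f x) (f y) \<le> (L + 2 * C) * dist x y"
    proof (cases "dist x y < 1")
      case True
      show ?thesis
      proof (cases "x \<in> K \<or> y \<in> K")
        case t: True
        have "norm x < R + 1 \<and> norm y < R + 1"
          using t R(2) True norm_triangle_sub[of x y] norm_triangle_sub[of y x]
          by (auto simp: dist_norm norm_minus_commute subset_iff)
        then have "dist (f x) (f y) \<le> L * dist x y"
          by (intro lipschitz_onD[OF L]) auto
        then show ?thesis using pos by (simp add: algebra_simps)
      next
        case False
        then show ?thesis using K(2) pos by (simp add: algebra_simps)
      qed
    next
      case False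
      have "dist (f x) (f y) \<le> 2 * C"
        using C(2)[of x] C(2)[of y] norm_triangle_ineq4[of "f x" "f y"] by (simp add: dist_norm)
      also have "\<dots> \<le> 2 * C * dist x y"
        using False C(1) by (simp add: mult_le_cancel_left1)
      finally show ?thesis using pos by (simp add: algebra_simps)
    qed
  qed (use L0 C in auto)
  then show ?thesis by (rule that)
qed

lemma set_borel_measurable_continuous_off_negligible:
  fixes f :: "'a::euclidean_space \<Rightarrow> 'b::euclidean_space"
  assumes c: "continuous_on (S - N) f" and S: "S \<in> sets lebesgue" and N: "negligible N"
  shows "set_borel_measurable lebesgue S f"
proof -
  have N': "N \<in> sets lebesgue"
    using N negligible_imp_sets by blast
  then have "f \<in> borel_measurable (lebesgue_on (S - N))"
    using c S by (intro continuous_imp_measurable_on_sets_lebesgue) auto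
  then have "(\<lambda>x. if x \<in> S - N then f x else 0) \<in> borel_measurable lebesgue"
    using N' S by (intro borel_measurable_if_I) auto
  moreover have "AE x in lebesgue. (if x \<in> S - N then f x else 0) = indicat_real S x *\<^sub>R f x"
    using N by (intro AE_I'[of N]) (auto simp: negligible_iff_null_sets)
  ultimately show ?thesis
    unfolding set_borel_measurable_def by (rule borel_measurable_AE)
qed

lemma set_integrable_mult_bounded:
  fixes v b :: "'a::euclidean_space \<Rightarrow> complex"
  assumes v: "set_integrable lebesgue K v" and b: "set_borel_measurable lebesgue K b"
    and bound: "AE x in lebesgue. x \<in> K \<longrightarrow> norm (b x) \<le> C"
  shows "set_integrable lebesgue K (\<lambda>x. b x * v x)"
proof -
  have eq: "indicat_real K x *\<^sub>R (b x * v x) = (indicat_real K x *\<^sub>R b x) * (indicat_real K x *\<^sub>R v x)" for x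
    by (simp add: indicator_def)
  show ?thesis
    unfolding set_integrable_def eq
  proof (rule Bochner_Integration.integrable_bound)
    show "integrable lebesgue (\<lambda>x. C *\<^sub>R (indicat_real K x *\<^sub>R v x))"
      using v by (intro integrable_scaleR_right) (simp add: set_integrable_def)
    show "(\<lambda>x. (indicat_real K x *\<^sub>R b x) * (indicat_real K x *\<^sub>R v x)) \<in> borel_measurable lebesgue"
      using v b by (intro borel_measurable_times) (simp_all add: set_integrable_def set_borel_measurable_def)
    show "AE x in lebesgue. norm ((indicat_real K x *\<^sub>R b x) * (indicat_real K x *\<^sub>R v x)) \<le> norm (C *\<^sub>R (indicat_real K x *\<^sub>R v x))"
      using bound
    proof eventually_elim
      case (elim x)
      then show ?case
        by (cases "x \<in> K") (auto simp: norm_mult intro!: mult_right_mono)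
    qed
  qed
qed

lemma set_integrable_vec:
  fixes f :: "'a \<Rightarrow> complex^2"
  assumes "\<And>i. set_integrable M K (\<lambda>x. f x $ i)"
  shows "set_integrable M K f"
proof -
  have bl: "bounded_linear (\<lambda>c::complex. axis i c :: complex^2)" for i
    by (intro linear_conv_bounded_linear[THEN iffD1] linearI) (auto simp: axis_def vec_eq_iff)
  have "integrable M (\<lambda>x. \<Sum>i\<in>UNIV. axis i (indicat_real K x *\<^sub>R f x $ i) :: complex^2)"
    using assms by (intro Bochner_Integration.integrable_sum integrable_bounded_linear[OF bl])
      (simp add: set_integrable_def)
  moreover have "(\<Sum>i\<in>UNIV. axis i (indicat_real K x *\<^sub>R f x $ i) :: complex^2) = indicat_real K x *\<^sub>R f x" for x
    by (simp add: vec_eq_iff sum_2 axis_def forall_2)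
  ultimately show ?thesis
    by (simp add: set_integrable_def)
qed

section \<open>Product rule for weak gradients\<close>

lemma grad_mult:
  fixes f :: "real^2 \<Rightarrow> complex" and \<psi> :: "real^2 \<Rightarrow> real"
  assumes "f differentiable (at x)" "\<psi> differentiable (at x)"
  shows "(\<lambda>x. f x * of_real (\<psi> x)) differentiable (at x)"
    "grad (\<lambda>x. f x * of_real (\<psi> x)) x $ i = grad f x $ i * of_real (\<psi> x) + f x * of_real (grad \<psi> x $ i)"
proof -
  have "(f has_derivative frechet_derivative f (at x)) (at x)" "(\<psi> has_derivative frechet_derivative \<psi> (at x)) (at x)"
    using assms by (simp_all add: frechet_derivative_works)
  note * = has_derivative_mult[OF this(1) has_derivative_of_real[OF this(2)]]
  from * show "(\<lambda>x. f x * of_real (\<psi> x)) differentiable (at x)"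
    by (auto simp: differentiable_def)
  show "grad (\<lambda>x. f x * of_real (\<psi> x)) x $ i = grad f x $ i * of_real (\<psi> x) + f x * of_real (grad \<psi> x $ i)"
    by (subst grad_eqI[OF *]) (simp add: grad_def)
qed

text \<open>The factor \<open>w\<close> is moved onto the test function: h = w \<psi> is compactly
  supported, globally Lipschitz and C1 off \<open>N\<close>, hence admissible for \<open>v\<close>.
  Since grad h = \<psi> grad w + w grad \<psi> off \<open>N\<close>, testing \<open>v\<close> with
  \<open>h\<close> and rearranging gives the rule for w v.\<close>

lemma has_weak_grad_mult:
  fixes w v :: "real^2 \<Rightarrow> complex"
  assumes U: "open U" and wg: "has_weak_grad U v g" and w: "locally_lipschitz U w"
    and N: "closed N" "negligible N"
    and diff: "\<And>x. x \<in> U - N \<Longrightarrow> w differentiable (at x)"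
    and cont: "\<And>i. continuous_on (U - N) (\<lambda>x. grad w x $ i)"
  shows "has_weak_grad U (\<lambda>x. w x * v x) (\<lambda>x. w x *s g x + v x *s grad w x)"
proof -
  have cont_w: "continuous_on U w"
    using w by (rule locally_lipschitz_continuous)
  \<comment> \<open>The gradient bound on \<open>K\<close> requires a Lipschitz constant on balls
    around its points, hence on the thickened set \<open>K'\<close>.\<close>
  have bound: "\<exists>C. (\<forall>x\<in>K. norm (w x) \<le> C) \<and> (\<forall>x\<in>K - N. \<forall>i. norm (grad w x $ i) \<le> C)"
    if K: "compact K" "K \<subseteq> U" for K
  proof -
    obtain d K' where K': "d > 0" "compact K'" "K' \<subseteq> U" "\<And>x. x \<in> K \<Longrightarrow> cball x d \<subseteq> K'"
      using compact_thicken[OF K(1) U K(2)] by metis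
    obtain L where L: "L-lipschitz_on K' w"
      using locally_lipschitz_compact[OF w K'(2,3)] .
    have "norm (grad w x $ i) \<le> L" if "x \<in> K - N" for x i
    proof (rule norm_grad_le_lipschitz[OF _ K'(1)])
      show "L-lipschitz_on (ball x d) w"
        by (rule lipschitz_on_subset[OF L]) (use K'(4) that in force)
    qed (use diff that K in auto)
    moreover have "bounded (w ` K)"
      by (intro compact_imp_bounded compact_continuous_image continuous_on_subset[OF cont_w K(2)] K(1))
    then obtain C where "\<And>x. x \<in> K \<Longrightarrow> norm (w x) \<le> C"
      by (auto simp: bounded_iff)
    ultimately show ?thesis
      by (intro exI[of _ "max C L"]) (auto simp: le_max_iff_disj)
  qed
  have meas: "set_borel_measurable lebesgue K w" "set_borel_measurable lebesgue K (\<lambda>x. grad w x $ i)"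
    if K: "compact K" "K \<subseteq> U" for K i
  proof -
    have "K \<in> sets lebesgue"
      using lmeasurable_compact[OF K(1)] by (rule fmeasurableD)
    then show "set_borel_measurable lebesgue K w" "set_borel_measurable lebesgue K (\<lambda>x. grad w x $ i)"
      using continuous_on_subset[OF cont_w, of "K - N"] continuous_on_subset[OF cont[of i], of "K - N"] N(2) K(2)
      by (intro set_borel_measurable_continuous_off_negligible[of K N]; auto)+
  qed
  have intK: "set_integrable lebesgue K (\<lambda>x. w x * v x)"
      "set_integrable lebesgue K (\<lambda>x. w x * g x $ i)"
      "set_integrable lebesgue K (\<lambda>x. grad w x $ i * v x)" if K: "compact K" "K \<subseteq> U" for K i
  proof -
    have v: "set_integrable lebesgue K v" "set_integrable lebesgue K (\<lambda>x. g x $ i)"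
      using wg K locally_integrable_nth[of U g i] by (auto simp: has_weak_grad_def locally_integrable_on_def)
    obtain C where C: "\<And>x. x \<in> K \<Longrightarrow> norm (w x) \<le> C" "\<And>x i. x \<in> K - N \<Longrightarrow> norm (grad w x $ i) \<le> C"
      using bound[OF K] by blast
    show "set_integrable lebesgue K (\<lambda>x. w x * v x)" "set_integrable lebesgue K (\<lambda>x. w x * g x $ i)"
      using C(1) by (auto intro!: set_integrable_mult_bounded v meas K)
    show "set_integrable lebesgue K (\<lambda>x. grad w x $ i * v x)"
    proof (rule set_integrable_mult_bounded[OF v(1) meas(2)[OF K]])
      show "AE x in lebesgue. x \<in> K \<longrightarrow> norm (grad w x $ i) \<le> C"
        using N(2) C(2) by (intro AE_I'[of N]) (auto simp: negligible_iff_null_sets)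
    qed
  qed
  have li: "locally_integrable_on U (\<lambda>x. w x * v x)"
      "locally_integrable_on U (\<lambda>x. w x *s g x + v x *s grad w x)"
    unfolding locally_integrable_on_def using intK
    by (auto intro!: set_integrable_vec set_integral_add simp: mult.commute[of "v _"])
  have "(LINT x:U|lebesgue. w x * v x * of_real (grad \<psi> x $ i)) =
      - (LINT x:U|lebesgue. (w x *s g x + v x *s grad w x) $ i * of_real (\<psi> x))"
    if \<psi>: "test_function_on U \<psi>" for \<psi> i
  proof -
    obtain K where K: "compact K" "K \<subseteq> U" and supp: "\<And>x. x \<notin> K \<Longrightarrow> \<psi> x = 0"
      using \<psi> by (auto simp: test_function_on_def)
    have C1: "C1_function \<psi>"
      using \<psi> by (simp add: test_function_on_def)
    then have d\<psi>: "\<psi> differentiable (at x)" "continuous_on UNIV (\<lambda>x. grad \<psi> x $ i)" "continuous_on UNIV \<psi>" for x i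
      by (auto simp: C1_function_def intro: C1_function_continuous[OF C1])
    have clK: "closed K" using K compact_imp_closed by blast
    have supp': "grad \<psi> x $ i = 0" if "x \<notin> K" for x i
      using grad_0_off_support[OF clK supp that] .
    \<comment> \<open>Both sets are open: on \<open>U\<close> the product structure of
      \<open>h\<close> is available, on \<open>-K\<close> it vanishes. Local properties of
      \<open>h\<close> on the whole plane are checked on each.\<close>
    have cover: "UNIV = U \<union> -K" using K by auto
    define h where "h x = w x * of_real (\<psi> x)" for x
    define c where "c i x = w x * of_real (grad \<psi> x $ i)" for i x
    \<comment> \<open>On \<open>U - N\<close> this is \<psi> times the i-th partial derivative of
      \<open>w\<close>. Written as a difference, it is measurable on the whole plane and vanishes
      off \<open>K\<close>.\<close>
    define b where "b i x = grad h x $ i - c i x" for i x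
    have h0: "h x = 0" "c i x = 0" "grad h x $ i = 0" if "x \<notin> K" for x i
    proof -
      show "h x = 0" "c i x = 0" using that supp supp' by (auto simp: h_def c_def)
      show "grad h x $ i = 0"
        by (rule grad_0_off_support[OF clK _ that]) (simp add: h_def supp)
    qed
    have ll\<psi>: "locally_lipschitz UNIV (\<lambda>x. complex_of_real (\<psi> x))"
      using locally_lipschitz_compose[OF C1_imp_locally_lipschitz[OF open_UNIV d\<psi>(1,2)]
          locally_lipschitz_bounded_linear[OF bounded_linear_of_real, of UNIV]] by simp
    have "locally_lipschitz U h"
      unfolding h_def using locally_lipschitz_subset[OF ll\<psi>] w by (intro locally_lipschitz_mult) auto
    moreover have "locally_lipschitz (-K) h"
      by (rule locally_lipschitz_cong_open[where f="\<lambda>_. 0"])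
        (use h0 clK in \<open>auto intro!: lipschitz_imp_locally_lipschitz lipschitz_on_constant\<close>)
    ultimately have "locally_lipschitz UNIV h"
      unfolding locally_lipschitz_def cover by blast
    then obtain L where L: "L-lipschitz_on UNIV h"
      by (rule locally_lipschitz_compact_support[OF _ K(1)]) (use h0 in auto)
    have gh: "h differentiable (at x)" "grad h x $ i = grad w x $ i * of_real (\<psi> x) + c i x"
      if "x \<in> U - N" for x i
      unfolding h_def c_def using grad_mult[OF diff[OF that] d\<psi>(1)] by auto
    have "lipschitz_C1_off h N L"
    proof
      show "h differentiable (at x)" if "x \<notin> N" for x
      proof (cases "x \<in> U")
        case False
        then have "x \<in> - K" using K by auto
        with clK have "(h has_derivative (\<lambda>_. 0)) (at x)"
          by (intro has_derivative_transform_within_open[OF has_derivative_const[of 0], where s="-K"]) (use h0 in auto)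
        then show ?thesis by (rule differentiableI)
      qed (use gh that in auto)
      show "continuous_on (- N) (\<lambda>x. grad h x $ i)" for i
      proof -
        have "continuous_on (U - N) (\<lambda>x. grad w x $ i * of_real (\<psi> x) + w x * of_real (grad \<psi> x $ i))"
          using cont[of i] continuous_on_subset[OF cont_w] continuous_on_subset[OF d\<psi>(2)] continuous_on_subset[OF d\<psi>(3)]
          by (intro continuous_on_add continuous_on_mult continuous_on_of_real) auto
        then have "continuous_on (U - N) (\<lambda>x. grad h x $ i)"
          by (rule continuous_on_eq) (simp add: gh(2) c_def)
        moreover have "continuous_on (- K - N) (\<lambda>x. grad h x $ i)"
          by (rule continuous_on_eq[OF continuous_on_const[of _ 0]]) (use h0 in auto)
        ultimately have "continuous_on ((U - N) \<union> (- K - N)) (\<lambda>x. grad h x $ i)"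
          using U clK N(1) by (intro continuous_on_open_Un) auto
        then show ?thesis
          by (rule continuous_on_subset) (use K in auto)
      qed
    qed (use L N in auto)
    then interpret lipschitz_C1_off h N L .
    have cont_c: "continuous_on UNIV (c i)"
    proof -
      have "continuous_on U (c i)"
        unfolding c_def using cont_w continuous_on_subset[OF d\<psi>(2)]
        by (intro continuous_on_mult continuous_on_of_real) auto
      moreover have "continuous_on (-K) (c i)"
        by (rule continuous_on_eq[OF continuous_on_const[of _ 0]]) (use h0 in auto)
      ultimately show ?thesis
        unfolding cover using U clK by (intro continuous_on_open_Un) auto
    qed
    obtain C where C: "\<And>x. norm (c i x) \<le> C"
      using continuous_compact_support_bounded[OF cont_c K(1) h0(2)] by blast
    have meas_gh: "(\<lambda>x. grad h x $ i) \<in> borel_measurable lebesgue"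
      by (rule measurable_continuous_off_negligible[OF cont N(2)])
    have meas_b: "b i \<in> borel_measurable lebesgue"
      unfolding b_def using meas_gh continuous_on_lebesgue_measurable[OF cont_c] by simp
    have AEN: "AE x in lebesgue. x \<notin> N"
      using AE_notin_negligible[OF N(2)] .
    have vK: "set_integrable lebesgue K v" "set_integrable lebesgue K (\<lambda>x. g x $ i)"
      using wg K locally_integrable_nth[of U g i] by (auto simp: has_weak_grad_def locally_integrable_on_def)
    have AEgh: "AE x in lebesgue. norm (grad h x $ i) \<le> L"
      using AEN by eventually_elim (rule norm_grad_le)
    have int1: "set_integrable lebesgue U (\<lambda>x. v x * grad h x $ i)"
      by (rule integrable_mult_compact_support[OF vK(1) K(2) meas_gh AEgh h0(3)])
    have int2: "set_integrable lebesgue U (\<lambda>x. v x * b i x)"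
    proof (rule integrable_mult_compact_support[OF vK(1) K(2) meas_b])
      show "AE x in lebesgue. norm (b i x) \<le> L + C"
        using AEgh
      proof eventually_elim
        case (elim x)
        then show ?case
          unfolding b_def using norm_triangle_ineq4[of "grad h x $ i" "c i x"] C[of x] by linarith
      qed
    qed (use h0 in \<open>simp add: b_def\<close>)
    obtain M where M: "\<And>x. norm (h x) \<le> M"
      using continuous_compact_support_bounded[OF lipschitz_on_continuous_on[OF L] K(1) h0(1)] by blast
    have int3: "set_integrable lebesgue U (\<lambda>x. g x $ i * h x)"
      by (rule integrable_mult_compact_support[OF vK(2) K(2) _ _ h0(1), where C=M])
        (use M continuous_on_lebesgue_measurable[OF lipschitz_on_continuous_on[OF L]] in auto)
    have "(LINT x:U|lebesgue. w x * v x * of_real (grad \<psi> x $ i)) =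
        (LINT x:U|lebesgue. v x * grad h x $ i - v x * b i x)"
      by (intro set_lebesgue_integral_cong) (use U in \<open>auto simp: b_def c_def algebra_simps\<close>)
    also have "\<dots> = (LINT x:U|lebesgue. v x * grad h x $ i) - (LINT x:U|lebesgue. v x * b i x)"
      by (rule set_integral_diff(2)[OF int1 int2])
    also have "(LINT x:U|lebesgue. v x * grad h x $ i) = - (LINT x:U|lebesgue. g x $ i * h x)"
      by (rule has_weak_grad_lipschitz_test[OF wg U K h0(1)])
    also have "- (LINT x:U|lebesgue. g x $ i * h x) - (LINT x:U|lebesgue. v x * b i x)
        = - (LINT x:U|lebesgue. g x $ i * h x + v x * b i x)"
      by (subst set_integral_add(2)[OF int3 int2]) simp
    also have "(LINT x:U|lebesgue. g x $ i * h x + v x * b i x)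
        = (LINT x:U|lebesgue. (w x *s g x + v x *s grad w x) $ i * of_real (\<psi> x))"
      unfolding set_lebesgue_integral_def
    proof (rule integral_cong_AE)
      show *: "(\<lambda>x. indicat_real U x *\<^sub>R (g x $ i * h x + v x * b i x)) \<in> borel_measurable lebesgue"
        using set_integral_add(1)[OF int3 int2] by (simp add: set_integrable_def)
      show eq: "AE x in lebesgue. indicat_real U x *\<^sub>R (g x $ i * h x + v x * b i x)
          = indicat_real U x *\<^sub>R ((w x *s g x + v x *s grad w x) $ i * of_real (\<psi> x))"
        using AEN
      proof eventually_elim
        case (elim x)
        then show ?case
          using gh(2)[of x i] by (cases "x \<in> U") (auto simp: b_def h_def algebra_simps)
      qed
      from * eq show "(\<lambda>x. indicat_real U x *\<^sub>R ((w x *s g x + v x *s grad w x) $ i * of_real (\<psi> x))) \<in> borel_measurable lebesgue"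
        by (rule borel_measurable_AE)
    qed
    finally show ?thesis .
  qed
  with li show ?thesis
    unfolding has_weak_grad_def by blast
qed

section \<open>Uniqueness of weak gradients\<close>

text \<open>A rational cutoff: the square of the positive part is C1 at 0, and the quotient
  increases from 0 to the limit 1. Scaling the argument by n sharpens it to the indicator of the
  positive half line.\<close>

definition C1_step :: "real \<Rightarrow> real" where
  "C1_step t = (max 0 t)\<^sup>2 / (1 + (max 0 t)\<^sup>2)"

lemma DERIV_max_power2: "((\<lambda>t::real. (max 0 t)\<^sup>2) has_real_derivative 2 * max 0 t) (at t)"
proof (cases t "0::real" rule: linorder_cases)
  case less
  have "((\<lambda>t::real. 0) has_real_derivative 0) (at t)" by simp
  then have "((\<lambda>t::real. (max 0 t)\<^sup>2) has_real_derivative 0) (at t)"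
    by (rule has_field_derivative_transform_within_open[where S="{..<0}"]) (use less in auto)
  with less show ?thesis by simp
next
  case greater
  have "((\<lambda>t::real. t\<^sup>2) has_real_derivative 2 * t) (at t)"
    by (auto intro!: derivative_eq_intros)
  then have "((\<lambda>t::real. (max 0 t)\<^sup>2) has_real_derivative 2 * t) (at t)"
    by (rule has_field_derivative_transform_within_open[where S="{0<..}"]) (use greater in auto)
  with greater show ?thesis by simp
next
  case equal
  have "((\<lambda>h. ((max 0 h)\<^sup>2 / h :: real)) \<longlongrightarrow> 0) (at 0)"
  proof (rule Lim_null_comparison)
    show "\<forall>\<^sub>F h in at (0::real). norm ((max 0 h)\<^sup>2 / h) \<le> \<bar>h\<bar>"
      by (intro always_eventually allI) (auto simp: max_def power2_eq_square)
    show "((\<lambda>h::real. \<bar>h\<bar>) \<longlongrightarrow> 0) (at 0)"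
      by (intro tendsto_eq_intros) auto
  qed
  then show ?thesis
    by (simp add: DERIV_def equal)
qed

definition C1_step_deriv :: "real \<Rightarrow> real" where
  "C1_step_deriv t = 2 * max 0 t / (1 + (max 0 t)\<^sup>2)\<^sup>2"

lemma one_plus_square_pos: "1 + (x::real)\<^sup>2 > 0"
  using zero_le_power2[of x] by linarith

lemmas one_plus_square_nonzero = one_plus_square_pos[THEN less_imp_neq, symmetric]

lemma DERIV_C1_step: "(C1_step has_real_derivative C1_step_deriv t) (at t)"
proof -
  have "((\<lambda>t. (max 0 t)\<^sup>2 / (1 + (max 0 t)\<^sup>2)) has_real_derivative
      (2 * max 0 t * (1 + (max 0 t)\<^sup>2) - (max 0 t)\<^sup>2 * (0 + 2 * max 0 t)) / ((1 + (max 0 t)\<^sup>2) * (1 + (max 0 t)\<^sup>2))) (at t)"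
    by (intro DERIV_divide DERIV_add DERIV_const DERIV_max_power2 one_plus_square_nonzero)
  then show ?thesis
    unfolding C1_step_def[abs_def] C1_step_deriv_def
    by (rule DERIV_cong) (simp add: power2_eq_square algebra_simps)
qed

lemma C1_step_bounds: "0 \<le> C1_step t" "C1_step t \<le> 1"
  using one_plus_square_pos[of "max 0 t"] by (auto simp: C1_step_def divide_le_eq_1)

lemma C1_step_eq_0: "t \<le> 0 \<Longrightarrow> C1_step t = 0"
  by (simp add: C1_step_def)

lemma C1_step_tendsto:
  assumes "t > 0"
  shows "(\<lambda>n. C1_step (real n * t)) \<longlonglongrightarrow> 1"
proof -
  have eq: "C1_step (real n * t) = 1 - 1 / (1 + (real n * t)\<^sup>2)" for n
    using assms one_plus_square_nonzero[of "real n * t"] by (simp add: C1_step_def max_def field_simps)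
  have "filterlim (\<lambda>n. 1 + (real n * t)\<^sup>2) at_top sequentially"
    by (intro filterlim_tendsto_add_at_top[OF tendsto_const] filterlim_pow_at_top
        filterlim_at_top_mult_tendsto_pos[OF tendsto_const assms] filterlim_real_sequentially) auto
  then have "(\<lambda>n. 1 / (1 + (real n * t)\<^sup>2)) \<longlonglongrightarrow> 0"
    by (rule real_tendsto_divide_at_top[OF tendsto_const])
  then show ?thesis
    unfolding eq using tendsto_diff[OF tendsto_const[of 1], of _ 0 sequentially] by force
qed

text \<open>A rising step at \<open>a\<close> times a falling step at \<open>b\<close>. The
  parameter \<open>n\<close> is the steepness; as it grows the function tends to the indicator of
  the open interval.\<close>

definition C1_plateau :: "real \<Rightarrow> real \<Rightarrow> real \<Rightarrow> real \<Rightarrow> real" where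
  "C1_plateau n a b t = C1_step (n * (t - a)) * C1_step (n * (b - t))"

definition C1_plateau_deriv :: "real \<Rightarrow> real \<Rightarrow> real \<Rightarrow> real \<Rightarrow> real" where
  "C1_plateau_deriv n a b t = n * (C1_step_deriv (n * (t - a)) * C1_step (n * (b - t))
      - C1_step (n * (t - a)) * C1_step_deriv (n * (b - t)))"

lemma DERIV_C1_plateau: "(C1_plateau n a b has_real_derivative C1_plateau_deriv n a b t) (at t)"
proof -
  have "((\<lambda>t. C1_step (n * (t - a))) has_real_derivative C1_step_deriv (n * (t - a)) * n) (at t)"
    by (rule DERIV_chain2[OF DERIV_C1_step]) (auto intro!: derivative_eq_intros)
  moreover have "((\<lambda>t. C1_step (n * (b - t))) has_real_derivative C1_step_deriv (n * (b - t)) * (-n)) (at t)"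
    by (rule DERIV_chain2[OF DERIV_C1_step]) (auto intro!: derivative_eq_intros)
  ultimately show ?thesis
    unfolding C1_plateau_def[abs_def] C1_plateau_deriv_def
    by (rule DERIV_cong[OF DERIV_mult]) (simp add: algebra_simps)
qed

lemma continuous_C1_step_deriv: "continuous_on UNIV C1_step_deriv"
  unfolding C1_step_deriv_def[abs_def]
  by (intro continuous_intros) (simp add: one_plus_square_nonzero)

lemma continuous_C1_step: "continuous_on UNIV C1_step"
  by (intro DERIV_continuous_on) (rule DERIV_subset[OF DERIV_C1_step], simp)

lemma continuous_C1_plateau: "continuous_on UNIV (C1_plateau n a b)"
  "continuous_on UNIV (C1_plateau_deriv n a b)"
  unfolding C1_plateau_def[abs_def] C1_plateau_deriv_def[abs_def]
  by (intro continuous_intros continuous_on_compose2[OF continuous_C1_step]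
      continuous_on_compose2[OF continuous_C1_step_deriv]; simp)+

lemma C1_plateau_bounds: "0 \<le> C1_plateau n a b t" "C1_plateau n a b t \<le> 1"
  using C1_step_bounds by (auto simp: C1_plateau_def intro: mult_le_one)

lemma C1_plateau_eq_0: "n \<ge> 0 \<Longrightarrow> t \<notin> {a<..<b} \<Longrightarrow> C1_plateau n a b t = 0"
  by (auto simp: C1_plateau_def not_less mult_le_0_iff intro!: C1_step_eq_0)

lemma C1_plateau_tendsto: "t \<in> {a<..<b} \<Longrightarrow> (\<lambda>n. C1_plateau (real n) a b t) \<longlonglongrightarrow> 1"
  unfolding C1_plateau_def
  using tendsto_mult[OF C1_step_tendsto[of "t - a"] C1_step_tendsto[of "b - t"]] by simp

definition C1_box_bump :: "real \<Rightarrow> real^2 \<Rightarrow> real^2 \<Rightarrow> real^2 \<Rightarrow> real" where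
  "C1_box_bump n a b x = C1_plateau n (a $ 1) (b $ 1) (x $ 1) * C1_plateau n (a $ 2) (b $ 2) (x $ 2)"

lemma C1_box_bump_test:
  assumes "cbox a b \<subseteq> U" "n \<ge> 0"
  shows "test_function_on U (C1_box_bump n a b)"
proof -
  let ?P = "\<lambda>i. C1_plateau n (a $ i) (b $ i)" and ?Q = "\<lambda>i. C1_plateau_deriv n (a $ i) (b $ i)"
  have d: "((\<lambda>x::real^2. ?P i (x $ i)) has_derivative (\<lambda>u. u $ i * ?Q i (x $ i))) (at x)" for x i
    by (rule DERIV_compose_FDERIV[OF DERIV_C1_plateau]) (rule bounded_linear_imp_has_derivative, rule bounded_linear_vec_nth)
  have D: "(C1_box_bump n a b has_derivative (\<lambda>u. ?P 1 (x $ 1) * (u $ 2 * ?Q 2 (x $ 2)) +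
      u $ 1 * ?Q 1 (x $ 1) * ?P 2 (x $ 2))) (at x)" for x
    unfolding C1_box_bump_def[abs_def] by (rule has_derivative_mult[OF d d])
  have g: "grad (C1_box_bump n a b) x $ i = (if i = 1 then ?Q 1 (x $ 1) * ?P 2 (x $ 2) else ?P 1 (x $ 1) * ?Q 2 (x $ 2))" for x i
    using exhaust_2[of i] by (subst grad_eqI[OF D]) (auto simp: axis_def)
  have "C1_function (C1_box_bump n a b)"
    unfolding C1_function_def g
  proof (intro conjI allI)
    show "C1_box_bump n a b differentiable (at x)" for x
      using D by (rule differentiableI)
    show "continuous_on UNIV (\<lambda>x::real^2. if i = 1 then ?Q 1 (x $ 1) * ?P 2 (x $ 2) else ?P 1 (x $ 1) * ?Q 2 (x $ 2))" for i :: 2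
      by (cases "i = 1") (auto intro!: continuous_intros continuous_on_compose2[OF continuous_C1_plateau(1)]
        continuous_on_compose2[OF continuous_C1_plateau(2)])
  qed
  moreover have "C1_box_bump n a b x = 0" if "x \<notin> cbox a b" for x
    using that C1_plateau_eq_0[OF assms(2)]
    by (auto simp: C1_box_bump_def mem_box_cart forall_2)
  ultimately show ?thesis
    unfolding test_function_on_def using assms(1) by (blast intro: compact_cbox)
qed

lemma C1_box_bump_tendsto:
  "(\<lambda>n. C1_box_bump (real n) a b x) \<longlonglongrightarrow> indicator (box a b) x"
proof (cases "x \<in> box a b")
  case True
  then have "(\<lambda>n. C1_box_bump (real n) a b x) \<longlonglongrightarrow> 1 * 1"
    unfolding C1_box_bump_def by (intro tendsto_mult C1_plateau_tendsto) (auto simp: mem_box_cart)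
  with True show ?thesis by simp
next
  case False
  then have "C1_box_bump (real n) a b x = 0" for n
    using C1_plateau_eq_0[of "real n"] by (auto simp: C1_box_bump_def mem_box_cart forall_2)
  with False show ?thesis by simp
qed

text \<open>The bumps converge boundedly to indicators of boxes, so \<open>f\<close> has integral
  zero over every box in \<open>U\<close>. Lebesgue differentiation along shrinking boxes makes
  \<open>f\<close> vanish almost everywhere on each box, and countably many boxes exhaust
  \<open>U\<close>.\<close>

lemma AE_zero_if_test_integrals_zero:
  fixes f :: "real^2 \<Rightarrow> complex"
  assumes U: "open U" and f: "locally_integrable_on U f"
    and zero: "\<And>\<psi>. test_function_on U \<psi> \<Longrightarrow> (LINT x:U|lebesgue. f x * of_real (\<psi> x)) = 0"
  shows "AE x in lebesgue. x \<in> U \<longrightarrow> f x = 0"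
proof -
  have intg: "set_integrable lebesgue (cbox a b) f" if "cbox a b \<subseteq> U" for a b
    using f that by (simp add: locally_integrable_on_def)
  have int_box: "integral (cbox a b) f = 0" if ab: "cbox a b \<subseteq> U" for a b
  proof -
    have "(\<lambda>n. LINT x:U|lebesgue. f x * of_real (C1_box_bump (real n) a b x))
        \<longlonglongrightarrow> (LINT x:U|lebesgue. f x * of_real (indicator (box a b) x))"
    proof (rule compact_support_integral_tendsto[OF intg[OF ab] ab, where C=1])
      show "(\<lambda>x. complex_of_real (C1_box_bump (real n) a b x)) \<in> borel_measurable lebesgue" for n
        using C1_box_bump_test[OF ab, of "real n"]
        by (intro continuous_on_lebesgue_measurable continuous_on_of_real C1_function_continuous)
          (auto simp: test_function_on_def)
      show "(\<lambda>x. complex_of_real (indicator (box a b) x)) \<in> borel_measurable lebesgue"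
        unfolding of_real_def by (intro borel_measurable_scaleR borel_measurable_indicator borel_measurable_const) auto
      show "AE x in lebesgue. (\<lambda>n. complex_of_real (C1_box_bump (real n) a b x)) \<longlonglongrightarrow> complex_of_real (indicator (box a b) x)"
        by (intro AE_I2 tendsto_of_real C1_box_bump_tendsto)
      show "AE x in lebesgue. norm (complex_of_real (C1_box_bump (real n) a b x)) \<le> 1" for n
        using C1_plateau_bounds
        by (intro AE_I2) (simp add: C1_box_bump_def norm_mult abs_of_nonneg mult_le_one)
      show "complex_of_real (C1_box_bump (real n) a b x) = 0" if "x \<notin> cbox a b" for n x
        using that C1_plateau_eq_0[of "real n"] by (auto simp: C1_box_bump_def mem_box_cart forall_2)
      show "complex_of_real (indicator (box a b) x) = 0" if "x \<notin> cbox a b" for x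
        using that box_subset_cbox by (auto simp: indicator_def)
    qed
    moreover have "(LINT x:U|lebesgue. f x * of_real (C1_box_bump (real n) a b x)) = 0" for n
      by (intro zero C1_box_bump_test ab) simp
    ultimately have "(LINT x:U|lebesgue. f x * of_real (indicator (box a b) x)) = 0"
      using LIMSEQ_unique[OF _ tendsto_const] by simp
    also have "(LINT x:U|lebesgue. f x * of_real (indicator (box a b) x)) = (LINT x:box a b|lebesgue. f x)"
      unfolding set_lebesgue_integral_def
      by (rule Bochner_Integration.integral_cong) (use ab box_subset_cbox in \<open>auto simp: indicator_def\<close>)
    also have "\<dots> = integral (box a b) f"
      by (rule set_lebesgue_integral_eq_integral(2)) (rule set_integrable_subset[OF intg[OF ab]], auto simp: box_subset_cbox)
    also have "\<dots> = integral (cbox a b) f"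
      by (rule integral_open_interval)
    finally show ?thesis .
  qed
  have AE_box: "AE x in lebesgue. x \<in> cbox a b \<longrightarrow> f x = 0" if ab: "cbox a b \<subseteq> U" for a b
  proof -
    \<comment> \<open>The differentiation theorem asks for integrability on every box of the plane.
      Extended by zero, the integral of \<open>F\<close> over any box is that of \<open>f\<close>
      over an intersection of boxes, again a box inside \<open>U\<close>.\<close>
    define F where "F x = (if x \<in> cbox a b then f x else 0)" for x
    have "f integrable_on cbox a b"
      using set_lebesgue_integral_eq_integral(1)[OF intg[OF ab]] .
    then have Fint: "F integrable_on cbox c d" for c d
      unfolding F_def by (intro integrable_on_subcbox[of _ UNIV]) (auto simp: integrable_restrict_UNIV)
    have F0: "integral (cbox c d) F = 0" for c d
    proof -
      obtain e g where eg: "cbox a b \<inter> cbox c d = cbox e g"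
        using Int_interval[of a b c d] by blast
      have "integral (cbox c d) F = integral (cbox c d \<inter> cbox a b) f"
        unfolding F_def by (simp add: integral_restrict_Int Int_commute)
      also have "\<dots> = integral (cbox e g) f"
        using eg by (simp add: Int_commute)
      also have "\<dots> = 0"
        by (rule int_box) (use eg ab in blast)
      finally show ?thesis .
    qed
    obtain N where N: "negligible N" "\<And>x e. \<lbrakk>x \<notin> N; 0 < e\<rbrakk> \<Longrightarrow> \<exists>d>0. \<forall>h. 0 < h \<and> h < d \<longrightarrow>
        norm (integral (cbox x (x + h *\<^sub>R One)) F /\<^sub>R h ^ DIM(real^2) - F x) < e"
      using integrable_ccontinuous_explicit[OF Fint] by blast
    have F_eq_0: "F x = 0" if "x \<notin> N" for x
    proof (rule ccontr)
      assume "F x \<noteq> 0"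
      \<comment> \<open>All box averages of \<open>F\<close> are 0, so accuracy
        \<open>norm (F x)\<close> would mean \<open>norm (F x) < norm (F x)\<close> for each small
        h.\<close>
      with N(2)[OF that, of "norm (F x)"] obtain d :: real where "d > 0" "\<forall>h. 0 < h \<longrightarrow> \<not> h < d"
        by (auto simp: F0)
      then show False
        using dense by blast
    qed
    show ?thesis
      using AE_notin_negligible[OF N(1)]
      by eventually_elim (use F_eq_0 in \<open>metis F_def\<close>)
  qed
  obtain \<D> where D: "countable \<D>" "\<D> \<subseteq> Pow U" "\<And>X. X \<in> \<D> \<Longrightarrow> \<exists>a b. X = cbox a b" "\<Union>\<D> = U"
    using open_countable_Union_open_cbox[OF U] by metis
  have "AE x in lebesgue. \<forall>X\<in>\<D>. x \<in> X \<longrightarrow> f x = 0"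
    unfolding AE_ball_countable[OF D(1)]
  proof
    fix X assume X: "X \<in> \<D>"
    with D(3) obtain a b where "X = cbox a b" by blast
    with X D(2) show "AE x in lebesgue. x \<in> X \<longrightarrow> f x = 0"
      by (auto intro!: AE_box)
  qed
  then show ?thesis
    using D(4) by (auto elim: eventually_mono)
qed

text \<open>Each component of the difference integrates to zero against all test functions. This
  makes statements about the chosen \<open>weak_grad\<close> independent of the choice.\<close>

lemma has_weak_grad_unique:
  assumes U: "open U" and g1: "has_weak_grad U u g1" and g2: "has_weak_grad U u g2"
  shows "AE x in lebesgue. x \<in> U \<longrightarrow> g1 x = g2 x"
proof -
  have "AE x in lebesgue. x \<in> U \<longrightarrow> g1 x $ i - g2 x $ i = 0" for i
  proof (rule AE_zero_if_test_integrals_zero[OF U])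
    have li: "locally_integrable_on U (\<lambda>x. g1 x $ i)" "locally_integrable_on U (\<lambda>x. g2 x $ i)"
      using g1 g2 by (auto simp: has_weak_grad_def intro: locally_integrable_nth)
    then show "locally_integrable_on U (\<lambda>x. g1 x $ i - g2 x $ i)"
      by (auto simp: locally_integrable_on_def)
    fix \<psi> assume \<psi>: "test_function_on U \<psi>"
    then obtain K where K: "compact K" "K \<subseteq> U" "\<And>x. x \<notin> K \<Longrightarrow> \<psi> x = 0" and C1: "C1_function \<psi>"
      by (auto simp: test_function_on_def)
    obtain C where C: "\<And>x. norm (\<psi> x) \<le> C"
      using continuous_compact_support_bounded[OF C1_function_continuous[OF C1] K(1,3)] by blast
    have int: "set_integrable lebesgue U (\<lambda>x. g x * of_real (\<psi> x))" if "locally_integrable_on U g" for g :: "_ \<Rightarrow> complex"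
    proof (rule integrable_mult_compact_support[where K=K and C=C])
      show "(\<lambda>x. complex_of_real (\<psi> x)) \<in> borel_measurable lebesgue"
        by (intro continuous_on_lebesgue_measurable continuous_on_of_real C1_function_continuous C1)
    qed (use that K C in \<open>simp_all add: locally_integrable_on_def\<close>)
    have "(LINT x:U|lebesgue. g1 x $ i * of_real (\<psi> x)) = (LINT x:U|lebesgue. g2 x $ i * of_real (\<psi> x))"
      using g1 g2 \<psi> unfolding has_weak_grad_def by (simp add: minus_equation_iff[symmetric])
    then show "(LINT x:U|lebesgue. (g1 x $ i - g2 x $ i) * of_real (\<psi> x)) = 0"
      using int li by (simp add: left_diff_distrib set_integral_diff(2))
  qed
  then have "AE x in lebesgue. \<forall>i. x \<in> U \<longrightarrow> g1 x $ i - g2 x $ i = 0"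
    by (subst AE_all_countable) blast
  then show ?thesis
    by eventually_elim (auto simp: vec_eq_iff)
qed

section \<open>Coefficients in the absorbing layer\<close>

text \<open>The boundary radius is an independent variable \<open>R\<close> here. The radial
  derivative, the angular derivative and the gradient in the plane then become instances of one
  chain rule with partial derivatives \<open>layer_Tr\<close> and \<open>layer_TR\<close>.\<close>

definition layer_T :: "real \<Rightarrow> real \<Rightarrow> real \<Rightarrow> real" where
  "layer_T \<rho> r R = (\<rho> * R - R) * (r - R) / (\<rho> * R - r)"

definition layer_Tr :: "real \<Rightarrow> real \<Rightarrow> real \<Rightarrow> real" where
  "layer_Tr \<rho> r R = (\<rho> - 1)\<^sup>2 * R\<^sup>2 / (\<rho> * R - r)\<^sup>2"

definition layer_TR :: "real \<Rightarrow> real \<Rightarrow> real \<Rightarrow> real" where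
  "layer_TR \<rho> r R = (1 - \<rho>) * (R * (\<rho> * R - r) + r * (r - R)) / (\<rho> * R - r)\<^sup>2"

definition layer_t :: "real \<Rightarrow> real \<Rightarrow> real \<Rightarrow> real" where
  "layer_t \<sigma>1 R T = R / (R + \<sigma>1 * T)"

definition layer_w :: "real \<Rightarrow> real \<Rightarrow> real \<Rightarrow> real \<Rightarrow> complex" where
  "layer_w k \<sigma>1 R T = of_real (layer_t \<sigma>1 R T powr (3/2)) * exp (\<i> * of_real (k * \<sigma>1 * T))"

text \<open>The differential of ln w at (R, T) in the direction (dR, dT), simplified by 1 / (R (R +
  \<sigma>1 T)) = t / R^2. Every derivative of \<open>w\<close> is \<open>w\<close> times such a
  value, so in the quadratic expressions \<open>w\<close> enters only through |w|^2.\<close>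

definition layer_w_logderiv :: "real \<Rightarrow> real \<Rightarrow> real \<Rightarrow> real \<Rightarrow> real \<Rightarrow> real \<Rightarrow> complex" where
  "layer_w_logderiv k \<sigma>1 R T dR dT =
     of_real (3/2 * \<sigma>1 * layer_t \<sigma>1 R T * (dR * T - R * dT) / R\<^sup>2) + \<i> * of_real (k * \<sigma>1 * dT)"

lemma has_derivative_layer_T:
  assumes r: "(r has_derivative r') (at x within S)" and R: "(R has_derivative R') (at x within S)"
    and nz: "\<rho> * R x - r x \<noteq> 0"
  shows "((\<lambda>x. layer_T \<rho> (r x) (R x)) has_derivative
    (\<lambda>u. layer_Tr \<rho> (r x) (R x) * r' u + layer_TR \<rho> (r x) (R x) * R' u)) (at x within S)"
  unfolding layer_T_def
  by (rule has_derivative_eq_rhs[OF has_derivative_divide'[OF has_derivative_mult[OF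
          has_derivative_diff[OF has_derivative_mult_right[OF R] R] has_derivative_diff[OF r R]]
        has_derivative_diff[OF has_derivative_mult_right[OF R] r] nz]])
    (simp add: fun_eq_iff layer_Tr_def layer_TR_def power2_eq_square nz flip: add_divide_distrib,
      simp add: algebra_simps)

lemma has_derivative_layer_w:
  assumes R: "(R has_derivative R') (at x)" and T: "(T has_derivative T') (at x)"
    and pos: "R x > 0" "R x + \<sigma>1 * T x > 0"
  shows "((\<lambda>x. layer_w k \<sigma>1 (R x) (T x)) has_derivative
    (\<lambda>u. layer_w k \<sigma>1 (R x) (T x) * layer_w_logderiv k \<sigma>1 (R x) (T x) (R' u) (T' u))) (at x)"
proof -
  \<comment> \<open>A logarithm of \<open>layer_w\<close>: it replaces the real power by an
    exponential and makes the derivative linear in the increments of R and T.\<close>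
  let ?f = "\<lambda>x. complex_of_real (3/2 * (ln (R x) - ln (R x + \<sigma>1 * T x))) + \<i> * of_real (k * \<sigma>1 * T x)"
  have exp_f: "exp (?f y) = layer_w k \<sigma>1 (R y) (T y)" if "R y > 0" "R y + \<sigma>1 * T y > 0" for y
    using that by (simp add: exp_add layer_w_def layer_t_def powr_def ln_div flip: exp_of_real)
  let ?l = "\<lambda>u. 3/2 * (R' u * inverse (R x) - (R' u + \<sigma>1 * T' u) * inverse (R x + \<sigma>1 * T x))"
  have "((\<lambda>x. R x + \<sigma>1 * T x) has_derivative (\<lambda>u. R' u + \<sigma>1 * T' u)) (at x)"
    by (rule has_derivative_add[OF R has_derivative_mult_right[OF T]])
  from has_derivative_diff[OF has_derivative_ln[OF pos(1) R] has_derivative_ln[OF pos(2) this]]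
  have "((\<lambda>x. 3/2 * (ln (R x) - ln (R x + \<sigma>1 * T x))) has_derivative ?l) (at x)"
    by (rule has_derivative_mult_right)
  moreover have "((\<lambda>x. k * \<sigma>1 * T x) has_derivative (\<lambda>u. k * \<sigma>1 * T' u)) (at x)"
    by (rule has_derivative_mult_right[OF T])
  ultimately have "(?f has_derivative (\<lambda>u. of_real (?l u) + \<i> * of_real (k * \<sigma>1 * T' u))) (at x)"
    by (intro has_derivative_add[OF has_derivative_of_real has_derivative_mult_right[OF has_derivative_of_real]])
  from has_derivative_compose[OF this DERIV_exp[unfolded has_field_derivative_def]]
  have "((\<lambda>x. exp (?f x)) has_derivative (\<lambda>u. exp (?f x) * (of_real (?l u) + \<i> * of_real (k * \<sigma>1 * T' u)))) (at x)" .
  moreover have "?l u =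
      3/2 * \<sigma>1 * layer_t \<sigma>1 (R x) (T x) * (R' u * T x - R x * T' u) / (R x)\<^sup>2" for u
    using pos by (simp add: layer_t_def inverse_eq_divide divide_simps power2_eq_square) (simp add: algebra_simps)
  ultimately have D: "((\<lambda>x. exp (?f x)) has_derivative
      (\<lambda>u. layer_w k \<sigma>1 (R x) (T x) * layer_w_logderiv k \<sigma>1 (R x) (T x) (R' u) (T' u))) (at x)"
    by (simp only: exp_f[OF pos] layer_w_logderiv_def)
  have "isCont R x" "isCont T x"
    using R T has_derivative_continuous by blast+
  then have "isCont (\<lambda>y. R y) x" "isCont (\<lambda>y. R y + \<sigma>1 * T y) x"
    by (auto intro!: continuous_intros)
  then have "\<forall>\<^sub>F y in at x. R y > 0" "\<forall>\<^sub>F y in at x. R y + \<sigma>1 * T y > 0"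
    using pos by (auto simp: isCont_def intro: order_tendstoD(1))
  then have "\<forall>\<^sub>F y in at x. exp (?f y) = layer_w k \<sigma>1 (R y) (T y)"
    by eventually_elim (rule exp_f)
  then show ?thesis
    by (rule has_derivative_transform_eventually[OF D]) (use exp_f[OF pos] in auto)
qed

lemma cmod_layer_w_power2:
  assumes "R > 0" "R + \<sigma>1 * T > 0"
  shows "(cmod (layer_w k \<sigma>1 R T))\<^sup>2 = layer_t \<sigma>1 R T ^ 3"
proof -
  have t: "layer_t \<sigma>1 R T > 0"
    using assms by (simp add: layer_t_def)
  have "(cmod (layer_w k \<sigma>1 R T))\<^sup>2 = (layer_t \<sigma>1 R T powr (3/2))\<^sup>2"
    by (simp add: layer_w_def norm_mult)
  also have "\<dots> = layer_t \<sigma>1 R T powr (of_nat 3)"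
    by (simp add: power2_eq_square flip: powr_add)
  also have "\<dots> = layer_t \<sigma>1 R T ^ 3"
    using t by (rule powr_realpow)
  finally show ?thesis .
qed

lemma pal_T_layer: "pal_T \<rho> R1 r \<theta> = layer_T \<rho> r (R1 \<theta>)"
  by (simp add: pal_T_def layer_T_def)

lemma pal_t_layer: "pal_t \<sigma>1 \<rho> R1 r \<theta> = layer_t \<sigma>1 (R1 \<theta>) (layer_T \<rho> r (R1 \<theta>))"
  by (simp add: pal_t_def layer_t_def pal_T_layer)

lemma pal_w_layer:
  "R1 \<theta> < r \<Longrightarrow> pal_w k \<sigma>1 \<rho> R1 r \<theta> = layer_w k \<sigma>1 (R1 \<theta>) (layer_T \<rho> r (R1 \<theta>))"
  by (simp add: pal_w_def layer_w_def pal_T_layer pal_t_layer)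

lemma pal_S_layer:
  "R1 \<theta> < r \<Longrightarrow> pal_S \<sigma>0 \<sigma>1 \<rho> R1 r \<theta> =
    of_real (R1 \<theta>) + pal_alpha \<sigma>0 \<sigma>1 * of_real (layer_T \<rho> r (R1 \<theta>))"
  by (simp add: pal_S_def pal_T_layer pal_alpha_def algebra_simps)

lemma vector_derivative_of_has_derivative:
  fixes f g :: "real \<Rightarrow> complex"
  assumes "(f has_derivative f') (at x)" "\<forall>\<^sub>F y in nhds x. g y = f y"
  shows "vector_derivative g (at x) = f' 1" "(g has_vector_derivative f' 1) (at x)"
proof -
  have "(g has_derivative f') (at x)"
    by (rule has_derivative_transform_eventually[OF assms(1)])
      (use assms(2) in \<open>auto simp: eventually_nhds_conv_at eq_commute\<close>)
  moreover have "u *\<^sub>R f' 1 = f' u" for u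
    using linear_cmul[OF has_derivative_linear[OF assms(1)], of u 1] by simp
  ultimately show "(g has_vector_derivative f' 1) (at x)"
    unfolding has_vector_derivative_def by simp
  then show "vector_derivative g (at x) = f' 1"
    by (rule vector_derivative_at)
qed

section \<open>Polar derivatives of \<open>S\<close> and \<open>w\<close> at a point of the
  layer\<close>

locale pal_point =
  fixes k \<sigma>0 \<sigma>1 \<rho> r \<theta> :: real and R1 :: "real \<Rightarrow> real"
  assumes \<sigma>1: "\<sigma>1 > 0" and \<sigma>0: "\<sigma>0 > 0" and \<rho>: "\<rho> > 1" and R_pos: "R1 \<theta> > 0" and in_layer: "in_PAL \<rho> R1 r \<theta>"
    and R1_diff: "R1 differentiable (at \<theta>)"
begin

abbreviation "T \<equiv> layer_T \<rho> r (R1 \<theta>)"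
abbreviation "Tr \<equiv> layer_Tr \<rho> r (R1 \<theta>)"
abbreviation "T\<theta> \<equiv> layer_TR \<rho> r (R1 \<theta>) * deriv R1 \<theta>"
abbreviation "t \<equiv> layer_t \<sigma>1 (R1 \<theta>) T"
abbreviation "\<alpha> \<equiv> pal_alpha \<sigma>0 \<sigma>1"

lemma r: "R1 \<theta> < r" "r < \<rho> * R1 \<theta>"
  using in_layer by (auto simp: in_PAL_def)

lemma T_pos: "T > 0"
  using r \<rho> R_pos by (auto simp: layer_T_def intro!: divide_pos_pos mult_pos_pos)

lemma denom_pos: "R1 \<theta> + \<sigma>1 * T > 0"
  using T_pos R_pos \<sigma>1 by (simp add: add_pos_pos)

lemma t_pos: "t > 0"
  using R_pos denom_pos by (simp add: layer_t_def)

lemma Tr_pos: "Tr > 0"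
  using r \<rho> R_pos by (auto simp: layer_Tr_def)

lemma alpha_nonzero: "\<alpha> \<noteq> 0"
  using \<sigma>1 by (simp add: pal_alpha_def complex_eq_iff)

lemma R1_DERIV: "(R1 has_real_derivative deriv R1 \<theta>) (at \<theta>)"
  using R1_diff DERIV_deriv_iff_real_differentiable by blast

lemma R1_has_derivative: "(R1 has_derivative (\<lambda>u. u * deriv R1 \<theta>)) (at \<theta>)"
  using R1_DERIV unfolding has_field_derivative_def
  by (rule has_derivative_eq_rhs) (simp add: fun_eq_iff mult.commute)

text \<open>Varying the angle moves the interface. By continuity of \<open>R1\<close> nearby angles
  stay on the layer branch of the case distinctions in \<open>pal_S\<close> and
  \<open>pal_w\<close>, so the angular derivatives may be computed on that branch.\<close>

lemma eventually_above_R1: "\<forall>\<^sub>F \<phi> in nhds \<theta>. R1 \<phi> < r"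
proof -
  have "isCont R1 \<theta>"
    using R1_DERIV DERIV_isCont by blast
  then have "(R1 \<longlongrightarrow> R1 \<theta>) (nhds \<theta>)"
    using isCont_def tendsto_at_iff_tendsto_nhds by blast
  then show ?thesis
    using r(1) by (rule order_tendstoD)
qed

lemma pal_T_derivs:
  "((\<lambda>s. layer_T \<rho> s (R1 \<theta>)) has_derivative (\<lambda>u. Tr * u)) (at r)"
  "((\<lambda>\<phi>. layer_T \<rho> r (R1 \<phi>)) has_derivative (\<lambda>u. T\<theta> * u)) (at \<theta>)"
proof -
  have nz: "\<rho> * R1 \<theta> - r \<noteq> 0" using r by simp
  show "((\<lambda>s. layer_T \<rho> s (R1 \<theta>)) has_derivative (\<lambda>u. Tr * u)) (at r)"
    using has_derivative_layer_T[OF has_derivative_ident has_derivative_const[of "R1 \<theta>"] nz] by simp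
  show "((\<lambda>\<phi>. layer_T \<rho> r (R1 \<phi>)) has_derivative (\<lambda>u. T\<theta> * u)) (at \<theta>)"
    using has_derivative_layer_T[OF has_derivative_const[of r] R1_has_derivative nz] by (simp add: mult_ac)
qed

lemma S_derivs:
  "pd_r (pal_S \<sigma>0 \<sigma>1 \<rho> R1) r \<theta> = \<alpha> * of_real Tr"
  "pd_theta (pal_S \<sigma>0 \<sigma>1 \<rho> R1) r \<theta> = of_real (deriv R1 \<theta>) + \<alpha> * of_real T\<theta>"
proof -
  have "((\<lambda>s. of_real (R1 \<theta>) + \<alpha> * of_real (layer_T \<rho> s (R1 \<theta>))) has_derivative
      (\<lambda>u. \<alpha> * of_real (Tr * u))) (at r)"
    by (rule derivative_eq_intros pal_T_derivs refl)+ simp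
  moreover have "\<forall>\<^sub>F s in nhds r. pal_S \<sigma>0 \<sigma>1 \<rho> R1 s \<theta> = of_real (R1 \<theta>) + \<alpha> * of_real (layer_T \<rho> s (R1 \<theta>))"
    using eventually_nhds_in_open[of "{R1 \<theta><..}" r, simplified, OF r(1)]
    by eventually_elim (rule pal_S_layer)
  ultimately show "pd_r (pal_S \<sigma>0 \<sigma>1 \<rho> R1) r \<theta> = \<alpha> * of_real Tr"
    unfolding pd_r_def by (auto dest: vector_derivative_of_has_derivative(1))
  have "((\<lambda>\<phi>. of_real (R1 \<phi>) + \<alpha> * of_real (layer_T \<rho> r (R1 \<phi>))) has_derivative
      (\<lambda>u. of_real (u * deriv R1 \<theta>) + \<alpha> * of_real (T\<theta> * u))) (at \<theta>)"
    by (rule derivative_eq_intros pal_T_derivs R1_has_derivative refl)+ simp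
  moreover have "\<forall>\<^sub>F \<phi> in nhds \<theta>. pal_S \<sigma>0 \<sigma>1 \<rho> R1 r \<phi> = of_real (R1 \<phi>) + \<alpha> * of_real (layer_T \<rho> r (R1 \<phi>))"
    using eventually_above_R1 by eventually_elim (rule pal_S_layer)
  ultimately show "pd_theta (pal_S \<sigma>0 \<sigma>1 \<rho> R1) r \<theta> = of_real (deriv R1 \<theta>) + \<alpha> * of_real T\<theta>"
    unfolding pd_theta_def by (auto dest: vector_derivative_of_has_derivative(1))
qed

abbreviation "w \<equiv> layer_w k \<sigma>1 (R1 \<theta>) T"
abbreviation "ar \<equiv> layer_w_logderiv k \<sigma>1 (R1 \<theta>) T 0 Tr"
abbreviation "a\<theta> \<equiv> layer_w_logderiv k \<sigma>1 (R1 \<theta>) T (deriv R1 \<theta>) T\<theta>"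

lemma w_derivs:
  "((\<lambda>s. pal_w k \<sigma>1 \<rho> R1 s \<theta>) has_vector_derivative w * ar) (at r)"
  "((\<lambda>\<phi>. pal_w k \<sigma>1 \<rho> R1 r \<phi>) has_vector_derivative w * a\<theta>) (at \<theta>)"
proof -
  have "((\<lambda>s. layer_w k \<sigma>1 (R1 \<theta>) (layer_T \<rho> s (R1 \<theta>))) has_derivative
      (\<lambda>u. w * layer_w_logderiv k \<sigma>1 (R1 \<theta>) T 0 (Tr * u))) (at r)"
    by (rule has_derivative_layer_w[OF has_derivative_const pal_T_derivs(1) R_pos denom_pos])
  moreover have "\<forall>\<^sub>F s in nhds r. pal_w k \<sigma>1 \<rho> R1 s \<theta> = layer_w k \<sigma>1 (R1 \<theta>) (layer_T \<rho> s (R1 \<theta>))"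
    using eventually_nhds_in_open[of "{R1 \<theta><..}" r, simplified, OF r(1)]
    by eventually_elim (rule pal_w_layer)
  ultimately show "((\<lambda>s. pal_w k \<sigma>1 \<rho> R1 s \<theta>) has_vector_derivative w * ar) (at r)"
    by (auto dest: vector_derivative_of_has_derivative(2))
  have "((\<lambda>\<phi>. layer_w k \<sigma>1 (R1 \<phi>) (layer_T \<rho> r (R1 \<phi>))) has_derivative
      (\<lambda>u. w * layer_w_logderiv k \<sigma>1 (R1 \<theta>) T (u * deriv R1 \<theta>) (T\<theta> * u))) (at \<theta>)"
    by (rule has_derivative_layer_w[OF R1_has_derivative pal_T_derivs(2) R_pos denom_pos])
  moreover have "\<forall>\<^sub>F \<phi> in nhds \<theta>. pal_w k \<sigma>1 \<rho> R1 r \<phi> = layer_w k \<sigma>1 (R1 \<phi>) (layer_T \<rho> r (R1 \<phi>))"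
    using eventually_above_R1 by eventually_elim (rule pal_w_layer)
  ultimately show "((\<lambda>\<phi>. pal_w k \<sigma>1 \<rho> R1 r \<phi>) has_vector_derivative w * a\<theta>) (at \<theta>)"
    by (auto dest: vector_derivative_of_has_derivative(2))
qed

lemma polar_grad_w:
  "polar_grad (pal_w k \<sigma>1 \<rho> R1) r \<theta> = vector [w * ar, w * a\<theta> / of_real r]"
  "polar_grad (\<lambda>s \<phi>. cnj (pal_w k \<sigma>1 \<rho> R1 s \<phi>)) r \<theta> = vector [cnj (w * ar), cnj (w * a\<theta>) / of_real r]"
  unfolding polar_grad_def pd_r_def pd_theta_def
  by (simp_all only: w_derivs[THEN vector_derivative_at]
      w_derivs[THEN has_vector_derivative_cnj, THEN vector_derivative_at])


end

text \<open>The variable \<open>z\<close> stands for plus or minus i k: with z = i k,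
  \<open>ar (- z)\<close> and \<open>a\<theta> (- z)\<close> are the logarithmic derivatives of
  \<open>w\<close>, and \<open>ar z\<close>, \<open>a\<theta> z\<close> those of its conjugate.
  Eliminating T and R' in favour of S and S\<theta> turns the claims into rational identities with
  nonzero denominators.\<close>

lemma coeff_algebra:
  fixes \<alpha> S S\<theta> Tr T\<theta> R T R' t r s1 z :: complex
  assumes nz: "\<alpha> \<noteq> 0" "S \<noteq> 0" "t \<noteq> 0" "Tr \<noteq> 0" "r \<noteq> 0" "R \<noteq> 0"
    and S: "S = R + \<alpha> * T" and S\<theta>: "S\<theta> = R' + \<alpha> * T\<theta>"
  defines "\<beta> \<equiv> t * S" and "\<gamma>1 \<equiv> t\<^sup>2 * Tr" and "\<gamma>2 \<equiv> t\<^sup>2 * T\<theta>" and "\<tau> \<equiv> t * T"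
    and "B11 \<equiv> S / (r * (\<alpha> * Tr)) * (1 + S\<theta>\<^sup>2 / S\<^sup>2)" and "B12 \<equiv> - (S\<theta> / S)"
    and "B22 \<equiv> r * (\<alpha> * Tr) / S"
    and "ar \<equiv> \<lambda>z. - (s1 * Tr * (3 * t / (2 * R) + z))"
    and "a\<theta> \<equiv> \<lambda>z. 3 / 2 * s1 * t * (R' * T - R * T\<theta>) / R\<^sup>2 - z * s1 * T\<theta>"
  shows "t ^ 3 * B11 = \<beta> * t\<^sup>2 / (\<alpha> * \<gamma>1 * r) * (t\<^sup>2 + (R' * t\<^sup>2 + \<alpha> * \<gamma>2)\<^sup>2 / \<beta>\<^sup>2)"
    "t ^ 3 * B12 = - (R' * t\<^sup>2 + \<alpha> * \<gamma>2) * (t\<^sup>2 / \<beta>)"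
    "t ^ 3 * B22 = \<alpha> * \<gamma>1 * r / \<beta> * t\<^sup>2"
    "t ^ 3 * (B11 * ar z + B12 * (a\<theta> z / r)) = - (\<beta> * s1 / (\<alpha> * r)) * (3 * t / (2 * R) + z) * t\<^sup>2
       - (3 * R' * s1 / (2 * r * R * \<alpha> * \<beta>) * (t + \<alpha> * \<tau> / R)
            + z * s1 * R' / (r * \<alpha> * \<beta>)) * (R' * t\<^sup>2 + \<alpha> * \<gamma>2) * t\<^sup>2"
    "t ^ 3 * (B12 * ar z + B22 * (a\<theta> z / r)) = 3 * R' * \<gamma>1 * s1 / (2 * R * \<beta>) * (t + \<alpha> * \<tau> / R) * t\<^sup>2
                     + z * s1 * (R' * \<gamma>1 / \<beta>) * t\<^sup>2"
    "t ^ 3 * (ar z * (B11 * ar (- z) + B12 * (a\<theta> (- z) / r)) + a\<theta> z / r * (B12 * ar (- z) + B22 * (a\<theta> (- z) / r)))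
        + z\<^sup>2 * t ^ 3 * (S * (\<alpha> * Tr) / r)
      = - z\<^sup>2 * (\<beta> * s1\<^sup>2 / \<alpha> - \<alpha> * \<beta> + s1\<^sup>2 * R'\<^sup>2 * t\<^sup>2 / (\<alpha> * \<beta>)) * (\<gamma>1 / r)
              + 9 * \<gamma>1 * s1\<^sup>2 * t\<^sup>2 / (4 * r * R\<^sup>2)
                * (\<beta> / \<alpha> + R'\<^sup>2 / (\<alpha> * \<beta> * R\<^sup>2) * (R * t + \<alpha> * \<tau>)\<^sup>2)"
proof -
  have T: "T = (S - R) / \<alpha>" and R': "R' = S\<theta> - \<alpha> * T\<theta>"
    using S S\<theta> nz by (auto simp: field_simps)
  have Q: "R' * t\<^sup>2 + \<alpha> * \<gamma>2 = t\<^sup>2 * S\<theta>"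
    by (simp add: R' \<gamma>2_def algebra_simps)
  have P: "t + \<alpha> * \<tau> / R = t * S / R" "R * t + \<alpha> * \<tau> = t * S"
    using nz by (simp_all add: T \<tau>_def field_simps)
  define u where "u = 3 * t / (2 * R)"
  have ar: "ar z = - (s1 * Tr * (u + z))" for z
    by (simp add: ar_def u_def)
  have a\<theta>: "a\<theta> z = s1 * (u * (S\<theta> * (S - R) / (\<alpha> * R) - T\<theta> * S / R) - z * T\<theta>)" for z
  proof -
    have "R' * T - R * T\<theta> = S\<theta> * (S - R) / \<alpha> - T\<theta> * S"
      using nz by (simp add: T R' field_simps)
    then have "a\<theta> z = 3 / 2 * s1 * t * (S\<theta> * (S - R) / \<alpha> - T\<theta> * S) / R\<^sup>2 - z * s1 * T\<theta>"
      by (simp add: a\<theta>_def)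
    also have "\<dots> = s1 * (u * ((S\<theta> * (S - R) / \<alpha> - T\<theta> * S) / R) - z * T\<theta>)"
      using nz by (simp add: u_def power2_eq_square right_diff_distrib diff_divide_distrib mult_ac)
    finally show ?thesis
      using nz by (simp add: diff_divide_distrib)
  qed
  show "t ^ 3 * B11 = \<beta> * t\<^sup>2 / (\<alpha> * \<gamma>1 * r) * (t\<^sup>2 + (R' * t\<^sup>2 + \<alpha> * \<gamma>2)\<^sup>2 / \<beta>\<^sup>2)"
    unfolding Q unfolding B11_def \<beta>_def \<gamma>1_def
    using nz by (simp add: field_simps power2_eq_square power3_eq_cube)
  show "t ^ 3 * B12 = - (R' * t\<^sup>2 + \<alpha> * \<gamma>2) * (t\<^sup>2 / \<beta>)"
    unfolding Q unfolding B12_def \<beta>_def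
    using nz by (simp add: field_simps power2_eq_square power3_eq_cube)
  show "t ^ 3 * B22 = \<alpha> * \<gamma>1 * r / \<beta> * t\<^sup>2"
    unfolding B22_def \<beta>_def \<gamma>1_def
    using nz by (simp add: field_simps power2_eq_square power3_eq_cube)
  \<comment> \<open>Formally the angular derivative of the logarithm with S held fixed. The
    contributions of T\<theta> and Tr, both of order t^(-2), cancel here, and u S stays
    bounded.\<close>
  have b: "a\<theta> z - S\<theta> / (\<alpha> * Tr) * ar z = s1 * R' / \<alpha> * (u * S / R + z)" for z
    unfolding ar a\<theta> R' using nz by (simp add: field_simps)
  have B1: "B11 * ar z + B12 * (a\<theta> z / r) = S / (r * \<alpha> * Tr) * ar z - S\<theta> / (S * r) * (s1 * R' / \<alpha> * (u * S / R + z))" for z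
    unfolding b[symmetric] B11_def B12_def using nz by (simp add: field_simps power2_eq_square)
  have B2: "B12 * ar z + B22 * (a\<theta> z / r) = \<alpha> * Tr / S * (s1 * R' / \<alpha> * (u * S / R + z))" for z
    unfolding b[symmetric] B22_def B12_def using nz by (simp add: field_simps power2_eq_square)
  show "t ^ 3 * (B11 * ar z + B12 * (a\<theta> z / r)) = - (\<beta> * s1 / (\<alpha> * r)) * (3 * t / (2 * R) + z) * t\<^sup>2
       - (3 * R' * s1 / (2 * r * R * \<alpha> * \<beta>) * (t + \<alpha> * \<tau> / R)
            + z * s1 * R' / (r * \<alpha> * \<beta>)) * (R' * t\<^sup>2 + \<alpha> * \<gamma>2) * t\<^sup>2"
    unfolding Q P B1 unfolding ar \<beta>_def unfolding u_def
    using nz by (simp add: divide_simps power2_eq_square power3_eq_cube) (simp add: algebra_simps)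
  show "t ^ 3 * (B12 * ar z + B22 * (a\<theta> z / r)) = 3 * R' * \<gamma>1 * s1 / (2 * R * \<beta>) * (t + \<alpha> * \<tau> / R) * t\<^sup>2
                     + z * s1 * (R' * \<gamma>1 / \<beta>) * t\<^sup>2"
    unfolding P B2 \<gamma>1_def \<beta>_def unfolding u_def
    using nz by (simp add: divide_simps power2_eq_square power3_eq_cube) (simp add: algebra_simps)
  \<comment> \<open>Completing the square in the binary form of \<open>B\<close>: since B11 - B12^2
    / B22 = S / (r \<alpha> Tr), the second square is formed from exactly the combination computed
    in \<open>b\<close>.\<close>
  have "ar z * (B11 * ar (- z) + B12 * (a\<theta> (- z) / r)) + a\<theta> z / r * (B12 * ar (- z) + B22 * (a\<theta> (- z) / r))
      = S / (r * \<alpha> * Tr) * (ar z * ar (-z)) + \<alpha> * Tr / (S * r) * ((s1 * R' / \<alpha> * (u * S / R + z)) * (s1 * R' / \<alpha> * (u * S / R - z)))"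
    (is "?L = _ + _ * (?c * ?d)")
  proof -
    have "?L = S / (r * \<alpha> * Tr) * (ar z * ar (-z)) + \<alpha> * Tr / (S * r) * ((a\<theta> z - S\<theta> / (\<alpha> * Tr) * ar z) * ?d)"
      unfolding B1 B2 using nz by (simp add: field_simps)
    then show ?thesis unfolding b by simp
  qed
  also have "ar z * ar (-z) = s1\<^sup>2 * Tr\<^sup>2 * (u\<^sup>2 - z\<^sup>2)"
    by (simp add: ar power2_eq_square algebra_simps)
  also have "(s1 * R' / \<alpha> * (u * S / R + z)) * (s1 * R' / \<alpha> * (u * S / R - z)) = s1\<^sup>2 * R'\<^sup>2 / \<alpha>\<^sup>2 * (u\<^sup>2 * S\<^sup>2 / R\<^sup>2 - z\<^sup>2)"
    using nz by (simp add: field_simps power2_eq_square)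
  finally have L: "?L = S / (r * \<alpha> * Tr) * (s1\<^sup>2 * Tr\<^sup>2 * (u\<^sup>2 - z\<^sup>2)) + \<alpha> * Tr / (S * r) * (s1\<^sup>2 * R'\<^sup>2 / \<alpha>\<^sup>2 * (u\<^sup>2 * S\<^sup>2 / R\<^sup>2 - z\<^sup>2))" .
  show "t ^ 3 * ?L + z\<^sup>2 * t ^ 3 * (S * (\<alpha> * Tr) / r)
      = - z\<^sup>2 * (\<beta> * s1\<^sup>2 / \<alpha> - \<alpha> * \<beta> + s1\<^sup>2 * R'\<^sup>2 * t\<^sup>2 / (\<alpha> * \<beta>)) * (\<gamma>1 / r)
              + 9 * \<gamma>1 * s1\<^sup>2 * t\<^sup>2 / (4 * r * R\<^sup>2)
                * (\<beta> / \<alpha> + R'\<^sup>2 / (\<alpha> * \<beta> * R\<^sup>2) * (R * t + \<alpha> * \<tau>)\<^sup>2)"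
    unfolding L P \<gamma>1_def \<beta>_def unfolding u_def
    using nz by (simp add: divide_simps power2_eq_square power3_eq_cube) (simp add: algebra_simps)
qed

context pal_point begin

lemma pal_aux_layer:
  "pal_t \<sigma>1 \<rho> R1 r \<theta> = t"
  "pal_tau \<sigma>1 \<rho> R1 r \<theta> = t * T"
  "pal_beta \<sigma>0 \<sigma>1 \<rho> R1 r \<theta> = of_real t * (of_real (R1 \<theta>) + \<alpha> * of_real T)"
  "pal_gamma1 \<sigma>1 \<rho> R1 r \<theta> = t\<^sup>2 * Tr"
  "pal_gamma2 \<sigma>1 \<rho> R1 r \<theta> = t\<^sup>2 * T\<theta>"
proof -
  show t: "pal_t \<sigma>1 \<rho> R1 r \<theta> = t"
    by (rule pal_t_layer)
  show "pal_tau \<sigma>1 \<rho> R1 r \<theta> = t * T"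
    using pal_tau_eq[OF in_layer] t by (simp add: pal_T_layer)
  show "pal_beta \<sigma>0 \<sigma>1 \<rho> R1 r \<theta> = of_real t * (of_real (R1 \<theta>) + \<alpha> * of_real T)"
    using pal_beta_eq[OF \<rho> \<sigma>1 R_pos in_layer, of \<sigma>0] t r by (simp add: pal_S_layer)
  have "((\<lambda>s. layer_T \<rho> s (R1 \<theta>)) has_real_derivative Tr) (at r)"
    "((\<lambda>\<phi>. layer_T \<rho> r (R1 \<phi>)) has_real_derivative T\<theta>) (at \<theta>)"
    using pal_T_derivs by (simp_all add: has_field_derivative_def)
  then show "pal_gamma1 \<sigma>1 \<rho> R1 r \<theta> = t\<^sup>2 * Tr" "pal_gamma2 \<sigma>1 \<rho> R1 r \<theta> = t\<^sup>2 * T\<theta>"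
    using pal_gamma1_eq[OF in_layer] pal_gamma2_eq[OF in_layer R1_diff] t
    by (simp_all add: pal_T_layer DERIV_imp_deriv)
qed

lemma S_nonzero: "of_real (R1 \<theta>) + \<alpha> * of_real T \<noteq> 0"
proof -
  have "Re (of_real (R1 \<theta>) + \<alpha> * of_real T) = R1 \<theta> + \<sigma>1 * T"
    by (simp add: pal_alpha_def)
  then show ?thesis
    using denom_pos by (metis less_irrefl zero_complex.simps(1))
qed

lemma layer_coefficients:
  "let rc = complex_of_real r;
             R = complex_of_real (R1 \<theta>);
             R' = complex_of_real (deriv R1 \<theta>);
             s1 = complex_of_real \<sigma>1;
             \<kappa> = complex_of_real k;
             \<alpha> = pal_alpha \<sigma>0 \<sigma>1;
             \<beta> = pal_beta \<sigma>0 \<sigma>1 \<rho> R1 r \<theta>;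
             t = complex_of_real (pal_t \<sigma>1 \<rho> R1 r \<theta>);
             \<tau> = complex_of_real (pal_tau \<sigma>1 \<rho> R1 r \<theta>);
             \<gamma>1 = complex_of_real (pal_gamma1 \<sigma>1 \<rho> R1 r \<theta>);
             \<gamma>2 = complex_of_real (pal_gamma2 \<sigma>1 \<rho> R1 r \<theta>);
             Bb = Bbreve k \<sigma>0 \<sigma>1 \<rho> R1 r \<theta>;
             f1 = (\<lambda>z. - (\<beta> * s1 / (\<alpha> * rc)) * (3 * t / (2 * R) + z) * t\<^sup>2
                     - (3 * R' * s1 / (2 * rc * R * \<alpha> * \<beta>) * (t + \<alpha> * \<tau> / R)
                        + z * s1 * R' / (rc * \<alpha> * \<beta>)) * (R' * t\<^sup>2 + \<alpha> * \<gamma>2) * t\<^sup>2);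
             f2 = (\<lambda>z. 3 * R' * \<gamma>1 * s1 / (2 * R * \<beta>) * (t + \<alpha> * \<tau> / R) * t\<^sup>2
                     + z * s1 * (R' * \<gamma>1 / \<beta>) * t\<^sup>2)
         in nbreve k \<sigma>0 \<sigma>1 \<rho> R1 r \<theta> =
              \<kappa>\<^sup>2 * (\<beta> * s1\<^sup>2 / \<alpha> - \<alpha> * \<beta> + s1\<^sup>2 * R'\<^sup>2 * t\<^sup>2 / (\<alpha> * \<beta>)) * (\<gamma>1 / rc)
              + 9 * \<gamma>1 * s1\<^sup>2 * t\<^sup>2 / (4 * rc * R\<^sup>2)
                * (\<beta> / \<alpha> + R'\<^sup>2 / (\<alpha> * \<beta> * R\<^sup>2) * (R * t + \<alpha> * \<tau>)\<^sup>2)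
          \<and> Bb $ 1 $ 1 = \<beta> * t\<^sup>2 / (\<alpha> * \<gamma>1 * rc) * (t\<^sup>2 + (R' * t\<^sup>2 + \<alpha> * \<gamma>2)\<^sup>2 / \<beta>\<^sup>2)
          \<and> Bb $ 1 $ 2 = - (R' * t\<^sup>2 + \<alpha> * \<gamma>2) * (t\<^sup>2 / \<beta>)
          \<and> Bb $ 2 $ 1 = Bb $ 1 $ 2
          \<and> Bb $ 2 $ 2 = \<alpha> * \<gamma>1 * rc / \<beta> * t\<^sup>2
          \<and> pvec k \<sigma>0 \<sigma>1 \<rho> R1 r \<theta> = vector [f1 (\<i> * \<kappa>), f2 (\<i> * \<kappa>)]
          \<and> qvec k \<sigma>0 \<sigma>1 \<rho> R1 r \<theta> = vector [f1 (- \<i> * \<kappa>), f2 (- \<i> * \<kappa>)]"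
proof -
  define S where "S = of_real (R1 \<theta>) + \<alpha> * of_real T"
  define S\<theta> where "S\<theta> = of_real (deriv R1 \<theta>) + \<alpha> * of_real T\<theta>"
  define tc where "tc = complex_of_real t"
  define Trc where "Trc = complex_of_real Tr"
  define rc where "rc = complex_of_real r"
  define Rc where "Rc = complex_of_real (R1 \<theta>)"
  define B11 where "B11 = S / (rc * (\<alpha> * Trc)) * (1 + S\<theta>\<^sup>2 / S\<^sup>2)"
  define B12 where "B12 = - (S\<theta> / S)"
  define B22 where "B22 = rc * (\<alpha> * Trc) / S"
  define a where "a z = - (of_real \<sigma>1 * Trc * (3 * tc / (2 * Rc) + z))" for z
  define b where "b z = 3 / 2 * of_real \<sigma>1 * tc * (of_real (deriv R1 \<theta>) * of_real T - Rc * of_real T\<theta>) / Rc\<^sup>2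
      - z * of_real \<sigma>1 * of_real T\<theta>" for z
  let ?z = "\<i> * of_real k"
  have nz: "\<alpha> \<noteq> 0" "S \<noteq> 0" "tc \<noteq> 0" "Trc \<noteq> 0" "rc \<noteq> 0" "Rc \<noteq> 0"
    using alpha_nonzero S_nonzero t_pos Tr_pos R_pos r by (auto simp: S_def tc_def Trc_def rc_def Rc_def)
  note alg =
    coeff_algebra(1-3)[OF nz S_def[folded Rc_def] S\<theta>_def, folded B11_def B12_def B22_def]
    coeff_algebra(4-6)[OF nz S_def[folded Rc_def] S\<theta>_def, of "of_real \<sigma>1", folded B11_def B12_def B22_def a_def b_def]
  \<comment> \<open>Conjugation only flips the sign of i k, because R, T, t and their derivatives
    are real.\<close>
  have a: "a (- ?z) = ar" "a ?z = cnj ar" and b: "b (- ?z) = a\<theta>" "b ?z = cnj a\<theta>"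
    using R_pos by (simp_all add: a_def b_def layer_w_logderiv_def Trc_def tc_def Rc_def field_simps power2_eq_square)
  have B: "pal_B \<sigma>0 \<sigma>1 \<rho> R1 r \<theta> = vector [vector [B11, B12], vector [B12, B22]]"
    using r(1) by (simp add: pal_B_def Let_def S_derivs pal_S_layer S_def S\<theta>_def B11_def B12_def B22_def rc_def Trc_def)
  have w: "pal_w k \<sigma>1 \<rho> R1 r \<theta> = w"
    using r(1) by (rule pal_w_layer)
  \<comment> \<open>The phase has modulus one, so the exponent 3/2 doubles to 3. Beyond its
    logarithmic derivatives, \<open>w\<close> enters the coefficients only through this
    factor.\<close>
  have w2: "complex_of_real ((cmod w)\<^sup>2) = tc ^ 3"
    by (simp add: cmod_layer_w_power2[OF R_pos denom_pos] tc_def)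
  have ww: "w * cnj w = tc ^ 3"
    using w2 complex_norm_square by simp
  have n: "pal_n \<sigma>0 \<sigma>1 \<rho> R1 r \<theta> = S * (\<alpha> * Trc) / rc"
    using r(1) by (simp add: pal_n_def S_derivs pal_S_layer S_def rc_def Trc_def)
  have Bb: "Bbreve k \<sigma>0 \<sigma>1 \<rho> R1 r \<theta> = vector [vector [tc ^ 3 * B11, tc ^ 3 * B12], vector [tc ^ 3 * B12, tc ^ 3 * B22]]"
    unfolding Bbreve_def w w2 B by (simp add: smult_mat_def vec_eq_iff forall_2)
  have p: "pvec k \<sigma>0 \<sigma>1 \<rho> R1 r \<theta> = vector [tc ^ 3 * (B11 * a ?z + B12 * (b ?z / rc)), tc ^ 3 * (B12 * a ?z + B22 * (b ?z / rc))]"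
    unfolding ww[symmetric] a b
    by (simp add: pvec_def w polar_grad_w B vec_eq_iff forall_2 matrix_vector_mult_def sum_2 rc_def algebra_simps)
  have q: "qvec k \<sigma>0 \<sigma>1 \<rho> R1 r \<theta> = vector [tc ^ 3 * (B11 * a (-?z) + B12 * (b (-?z) / rc)), tc ^ 3 * (B12 * a (-?z) + B22 * (b (-?z) / rc))]"
    unfolding ww[symmetric] a b
    by (simp add: qvec_def w polar_grad_w B vec_eq_iff forall_2 matrix_vector_mult_def sum_2 rc_def algebra_simps)
  have nb: "nbreve k \<sigma>0 \<sigma>1 \<rho> R1 r \<theta> = 
      tc ^ 3 * (a ?z * (B11 * a (- ?z) + B12 * (b (- ?z) / rc)) + b ?z / rc * (B12 * a (- ?z) + B22 * (b (- ?z) / rc)))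
        + ?z\<^sup>2 * tc ^ 3 * (S * (\<alpha> * Trc) / rc)"
  proof -
    have "of_real (k\<^sup>2 * (cmod w)\<^sup>2) = - (?z\<^sup>2 * tc ^ 3)"
      by (simp only: of_real_mult w2) (simp add: power_mult_distrib)
    then have "nbreve k \<sigma>0 \<sigma>1 \<rho> R1 r \<theta> = bdot (polar_grad (\<lambda>s \<phi>. cnj (pal_w k \<sigma>1 \<rho> R1 s \<phi>)) r \<theta>)
          (pal_B \<sigma>0 \<sigma>1 \<rho> R1 r \<theta> *v polar_grad (pal_w k \<sigma>1 \<rho> R1) r \<theta>) + ?z\<^sup>2 * tc ^ 3 * (S * (\<alpha> * Trc) / rc)"
      by (simp add: nbreve_def w n)
    also have "bdot (polar_grad (\<lambda>s \<phi>. cnj (pal_w k \<sigma>1 \<rho> R1 s \<phi>)) r \<theta>)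
          (pal_B \<sigma>0 \<sigma>1 \<rho> R1 r \<theta> *v polar_grad (pal_w k \<sigma>1 \<rho> R1) r \<theta>) = 
      tc ^ 3 * (a ?z * (B11 * a (- ?z) + B12 * (b (- ?z) / rc)) + b ?z / rc * (B12 * a (- ?z) + B22 * (b (- ?z) / rc)))"
      unfolding ww[symmetric] a b
      by (simp add: polar_grad_w B bdot_def matrix_vector_mult_def sum_2 rc_def algebra_simps)
    finally show ?thesis .
  qed
  have z2: "- ?z\<^sup>2 = (complex_of_real k)\<^sup>2"
    by (simp add: power_mult_distrib)
  have aux': "complex_of_real (pal_t \<sigma>1 \<rho> R1 r \<theta>) = tc"
    "complex_of_real (pal_tau \<sigma>1 \<rho> R1 r \<theta>) = tc * of_real T"
    "pal_beta \<sigma>0 \<sigma>1 \<rho> R1 r \<theta> = tc * S"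
    "complex_of_real (pal_gamma1 \<sigma>1 \<rho> R1 r \<theta>) = tc\<^sup>2 * Trc"
    "complex_of_real (pal_gamma2 \<sigma>1 \<rho> R1 r \<theta>) = tc\<^sup>2 * of_real T\<theta>"
    by (simp_all add: pal_aux_layer tc_def Trc_def S_def)
  show ?thesis
    unfolding Let_def aux' rc_def[symmetric] 
  proof (intro conjI)
    show "nbreve k \<sigma>0 \<sigma>1 \<rho> R1 r \<theta> =
      (complex_of_real k)\<^sup>2 * (tc * S * (complex_of_real \<sigma>1)\<^sup>2 / \<alpha> - \<alpha> * (tc * S) +
        (complex_of_real \<sigma>1)\<^sup>2 * (complex_of_real (deriv R1 \<theta>))\<^sup>2 * tc\<^sup>2 / (\<alpha> * (tc * S))) * (tc\<^sup>2 * Trc / rc) +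
      9 * (tc\<^sup>2 * Trc) * (complex_of_real \<sigma>1)\<^sup>2 * tc\<^sup>2 / (4 * rc * (complex_of_real (R1 \<theta>))\<^sup>2) *
      (tc * S / \<alpha> + (complex_of_real (deriv R1 \<theta>))\<^sup>2 / (\<alpha> * (tc * S) * (complex_of_real (R1 \<theta>))\<^sup>2) *
       (complex_of_real (R1 \<theta>) * tc + \<alpha> * (tc * complex_of_real T))\<^sup>2)"
      unfolding nb z2[symmetric] by (rule alg(6)[unfolded Rc_def])
  qed (simp_all only: Bb p q vector_2 alg Rc_def minus_mult_left[symmetric])
qed

end

text \<open>Near such a point, in each polar variable separately, S = r and w = 1. Continuity of
  \<open>R1\<close> at the angle keeps neighbouring angles inside, and r > 0 permits the divisions
  by r.\<close>

lemma inner_coefficients: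
  assumes r: "0 < r" "r < R1 \<theta>" and c: "isCont R1 \<theta>"
  shows "Bbreve k \<sigma>0 \<sigma>1 \<rho> R1 r \<theta> = mat 1" "pvec k \<sigma>0 \<sigma>1 \<rho> R1 r \<theta> = 0"
    "qvec k \<sigma>0 \<sigma>1 \<rho> R1 r \<theta> = 0" "nbreve k \<sigma>0 \<sigma>1 \<rho> R1 r \<theta> = - of_real (k\<^sup>2)"
    "pal_n \<sigma>0 \<sigma>1 \<rho> R1 r \<theta> = 1" "pal_B \<sigma>0 \<sigma>1 \<rho> R1 r \<theta> = mat 1"
    "polar_grad (pal_w k \<sigma>1 \<rho> R1) r \<theta> = 0"
    "polar_grad (\<lambda>s \<phi>. cnj (pal_w k \<sigma>1 \<rho> R1 s \<phi>)) r \<theta> = 0"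
proof -
  have ev_r: "\<forall>\<^sub>F s in nhds r. s < R1 \<theta>"
    using eventually_nhds_in_open[of "{..<R1 \<theta>}" r] r by simp
  have ev_\<theta>: "\<forall>\<^sub>F \<phi> in nhds \<theta>. r < R1 \<phi>"
  proof -
    have "(R1 \<longlongrightarrow> R1 \<theta>) (nhds \<theta>)"
      using c isCont_def tendsto_at_iff_tendsto_nhds by blast
    then show ?thesis
      using r(2) by (rule order_tendstoD)
  qed
  have deriv_cong: "vector_derivative f (at x) = g'"
    if "(g has_vector_derivative g') (at x)" "\<forall>\<^sub>F y in nhds x. f y = g y" for f g :: "real \<Rightarrow> complex" and x g'
  proof -
    have "(f has_vector_derivative g') (at x)"
      unfolding has_vector_derivative_def
      by (rule has_derivative_transform_eventually[OF that(1)[unfolded has_vector_derivative_def]])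
        (use that(2) in \<open>auto simp: eventually_nhds_conv_at eq_commute\<close>)
    then show ?thesis by (rule vector_derivative_at)
  qed
  have S: "pd_r (pal_S \<sigma>0 \<sigma>1 \<rho> R1) r \<theta> = 1" "pd_theta (pal_S \<sigma>0 \<sigma>1 \<rho> R1) r \<theta> = 0"
    "pal_S \<sigma>0 \<sigma>1 \<rho> R1 r \<theta> = of_real r"
  proof -
    show "pd_r (pal_S \<sigma>0 \<sigma>1 \<rho> R1) r \<theta> = 1"
      unfolding pd_r_def
    proof (rule deriv_cong)
      show "(complex_of_real has_vector_derivative 1) (at r)"
        using has_vector_derivative_of_real[OF DERIV_ident] by simp
      show "\<forall>\<^sub>F s in nhds r. pal_S \<sigma>0 \<sigma>1 \<rho> R1 s \<theta> = complex_of_real s"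
        using ev_r by eventually_elim (simp add: pal_S_def)
    qed
    show "pd_theta (pal_S \<sigma>0 \<sigma>1 \<rho> R1) r \<theta> = 0"
      unfolding pd_theta_def
    proof (rule deriv_cong)
      show "((\<lambda>_. complex_of_real r) has_vector_derivative 0) (at \<theta>)"
        by (rule has_vector_derivative_const)
      show "\<forall>\<^sub>F \<phi> in nhds \<theta>. pal_S \<sigma>0 \<sigma>1 \<rho> R1 r \<phi> = complex_of_real r"
        using ev_\<theta> by eventually_elim (simp add: pal_S_def)
    qed
    show "pal_S \<sigma>0 \<sigma>1 \<rho> R1 r \<theta> = of_real r"
      using r by (simp add: pal_S_def)
  qed
  have w: "pal_w k \<sigma>1 \<rho> R1 r \<theta> = 1"
    using r by (simp add: pal_w_def)
  have wr: "\<forall>\<^sub>F s in nhds r. pal_w k \<sigma>1 \<rho> R1 s \<theta> = 1" "\<forall>\<^sub>F \<phi> in nhds \<theta>. pal_w k \<sigma>1 \<rho> R1 r \<phi> = 1"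
    using ev_r ev_\<theta> by (auto elim!: eventually_mono simp: pal_w_def)
  have g0: "vector [pd_r f r \<theta>, pd_theta f r \<theta> / of_real r] = (0 :: complex^2)"
    if "\<forall>\<^sub>F s in nhds r. f s \<theta> = 1" "\<forall>\<^sub>F \<phi> in nhds \<theta>. f r \<phi> = 1" for f :: "real \<Rightarrow> real \<Rightarrow> complex"
    using deriv_cong[OF has_vector_derivative_const that(1)] deriv_cong[OF has_vector_derivative_const that(2)]
    by (simp add: pd_r_def pd_theta_def vec_eq_iff forall_2)
  have g: "polar_grad (pal_w k \<sigma>1 \<rho> R1) r \<theta> = 0" "polar_grad (\<lambda>s \<phi>. cnj (pal_w k \<sigma>1 \<rho> R1 s \<phi>)) r \<theta> = 0"
    unfolding polar_grad_def
    by (rule g0; use wr in \<open>auto elim!: eventually_mono\<close>)+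
  show B: "pal_B \<sigma>0 \<sigma>1 \<rho> R1 r \<theta> = mat 1"
    using r by (simp add: pal_B_def Let_def S mat_def vec_eq_iff forall_2)
  show n: "pal_n \<sigma>0 \<sigma>1 \<rho> R1 r \<theta> = 1"
    using r by (simp add: pal_n_def S)
  show "Bbreve k \<sigma>0 \<sigma>1 \<rho> R1 r \<theta> = mat 1" "pvec k \<sigma>0 \<sigma>1 \<rho> R1 r \<theta> = 0"
    "qvec k \<sigma>0 \<sigma>1 \<rho> R1 r \<theta> = 0" "nbreve k \<sigma>0 \<sigma>1 \<rho> R1 r \<theta> = - of_real (k\<^sup>2)"
    "polar_grad (pal_w k \<sigma>1 \<rho> R1) r \<theta> = 0"
    "polar_grad (\<lambda>s \<phi>. cnj (pal_w k \<sigma>1 \<rho> R1 s \<phi>)) r \<theta> = 0"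
    by (simp_all add: Bbreve_def pvec_def qvec_def nbreve_def w B g n smult_mat_def bdot_def vec_eq_iff
        matrix_vector_mult_def)
qed

section \<open>The boundary curve and polar coordinates\<close>

lemma periodic_int:
  fixes f :: "real \<Rightarrow> 'a"
  assumes "\<And>x. f (x + p) = f x"
  shows "f (x + of_int n * p) = f x"
proof -
  have nat: "f (x + real m * p) = f x" for m x
  proof (induction m)
    case (Suc m)
    have "f (x + real (Suc m) * p) = f ((x + real m * p) + p)" by (simp add: algebra_simps)
    with Suc assms show ?case by simp
  qed simp
  show ?thesis
  proof (cases "n \<ge> 0")
    case True
    with nat[of x "nat n"] show ?thesis by simp
  next
    case False
    with nat[of "x + of_int n * p" "nat (-n)"] show ?thesis by simp
  qed
qed

lemma period_cell:
  "of_int \<lfloor>x / (2*pi)\<rfloor> * (2 * pi) \<le> x" "x \<le> of_int (\<lfloor>x / (2*pi)\<rfloor> + 1) * (2 * pi)"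
proof -
  have "of_int \<lfloor>x / (2*pi)\<rfloor> \<le> x / (2*pi)" "x / (2*pi) \<le> of_int (\<lfloor>x / (2*pi)\<rfloor> + 1)"
    by linarith+
  then show "of_int \<lfloor>x / (2*pi)\<rfloor> * (2 * pi) \<le> x" "x \<le> of_int (\<lfloor>x / (2*pi)\<rfloor> + 1) * (2 * pi)"
    by (simp_all only: pos_le_divide_eq pos_divide_le_eq mult_pos_pos zero_less_numeral pi_gt_zero)
qed

section \<open>Lipschitz regularity of the boundary curve\<close>

locale periodic_boundary =
  fixes R1 :: "real \<Rightarrow> real"
  assumes star: "star_boundary R1"
begin

lemma R1_pos: "R1 \<theta> > 0" and R1_periodic: "R1 (\<theta> + 2 * pi) = R1 \<theta>"
  using star by (auto simp: star_boundary_def)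

text \<open>Comparing angles through \<open>cis\<close> allows any branch of the argument to replace
  the polar angle inside \<open>R1\<close>.\<close>

lemma R1_cong:
  assumes "cis a = cis b"
  shows "R1 a = R1 b"
proof -
  have "sin a = sin b \<and> cos a = cos b"
    using assms by (simp add: complex_eq_iff)
  then obtain n :: int where "a = b + of_int n * (2 * pi)"
    by (auto simp: sin_cos_eq_iff mult_ac)
  then show ?thesis
    using periodic_int[where f=R1, OF R1_periodic] by simp
qed

text \<open>The derivatives on the finitely many closed pieces are bounded by compactness and agree
  with \<open>deriv R1\<close> in the interiors. This yields one bound and a finite exceptional
  set.\<close>

lemma piecewise:
  obtains P M where "finite P" "0 \<in> P" "2 * pi \<in> P" "P \<subseteq> {0..2 * pi}" "M \<ge> 0"
    "continuous_on {0..2*pi} R1"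
    "\<And>x. x \<in> {0..2*pi} - P \<Longrightarrow> R1 differentiable (at x) \<and> \<bar>deriv R1 x\<bar> \<le> M \<and> isCont (deriv R1) x"
proof -
  obtain P where P: "finite P" "0 \<in> P" "2 * pi \<in> P" "P \<subseteq> {0..2 * pi}"
    and pieces: "\<forall>c\<in>P. \<forall>d\<in>P. c < d \<and> P \<inter> {c<..<d} = {} \<longrightarrow>
           (\<exists>f'. continuous_on {c..d} f' \<and>
              (\<forall>x\<in>{c..d}. (R1 has_real_derivative f' x) (at x within {c..d})))"
    using star unfolding star_boundary_def piecewise_smooth_on_def by (elim conjE exE) (rule that)
  define I where "I = {(c, d). c \<in> P \<and> d \<in> P \<and> c < d \<and> P \<inter> {c<..<d} = {}}"
  have finI: "finite I"
    by (rule finite_subset[of _ "P \<times> P"]) (auto simp: I_def P)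
  obtain f' where f': "\<And>c d. (c, d) \<in> I \<Longrightarrow> continuous_on {c..d} (f' c d)"
    "\<And>c d x. (c, d) \<in> I \<Longrightarrow> x \<in> {c..d} \<Longrightarrow> (R1 has_real_derivative f' c d x) (at x within {c..d})"
  proof -
    have "\<forall>c d. \<exists>f'. (c, d) \<in> I \<longrightarrow> continuous_on {c..d} f' \<and>
        (\<forall>x\<in>{c..d}. (R1 has_real_derivative f' x) (at x within {c..d}))"
      using pieces by (simp add: I_def)
    then obtain f' where "\<And>c d. (c, d) \<in> I \<longrightarrow> continuous_on {c..d} (f' c d) \<and>
        (\<forall>x\<in>{c..d}. (R1 has_real_derivative f' c d x) (at x within {c..d}))"
      by metis
    then show ?thesis using that by blast
  qed
  have cover: "\<exists>c d. (c, d) \<in> I \<and> x \<in> {c..d} \<and> (x \<notin> P \<longrightarrow> c < x \<and> x < d)" if x: "x \<in> {0..2*pi}" for x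
  proof -
    \<comment> \<open>\<open>Max Y\<close> is the last break point at or before x, with 2 pi left
      out so that a later one exists even for x = 2 pi; \<open>Min Z\<close> is that next break
      point.\<close>
    define Y where "Y = {p \<in> P. p \<le> x \<and> p < 2 * pi}"
    define Z where "Z = {p \<in> P. p > Max Y}"
    have Y: "finite Y" "0 \<in> Y"
      using P x pi_gt_zero by (auto simp: Y_def)
    have c: "Max Y \<in> Y" "\<And>p. p \<in> Y \<Longrightarrow> p \<le> Max Y"
      using Max_in[OF Y(1)] Max_ge[OF Y(1)] Y(2) by blast+
    have Z: "finite Z" "2 * pi \<in> Z"
      using P c(1) by (auto simp: Z_def Y_def)
    have d: "Min Z \<in> Z" "\<And>p. p \<in> Z \<Longrightarrow> Min Z \<le> p"
      using Min_in[OF Z(1)] Min_le[OF Z(1)] Z(2) by blast+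
    have "P \<inter> {Max Y<..<Min Z} = {}"
      using d(2) by (force simp: Z_def)
    then have I: "(Max Y, Min Z) \<in> I"
      using c(1) d(1) by (auto simp: I_def Y_def Z_def)
    have "x \<le> Min Z"
    proof (rule ccontr)
      assume "\<not> x \<le> Min Z"
      then have "Min Z \<in> Y"
        using d(1) x by (auto simp: Z_def Y_def)
      then have "Min Z \<le> Max Y" by (rule c(2))
      moreover have "Max Y < Min Z" using d(1) by (simp add: Z_def)
      ultimately show False by simp
    qed
    moreover have "Max Y \<le> x" "Max Y \<in> P" "Min Z \<in> P"
      using c(1) d(1) by (auto simp: Y_def Z_def)
    ultimately have "x \<in> {Max Y..Min Z} \<and> (x \<notin> P \<longrightarrow> Max Y < x \<and> x < Min Z)"
      by (metis atLeastAtMost_iff order_le_less)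
    with I show ?thesis by blast
  qed
  have "\<exists>B. \<forall>x\<in>{c..d}. \<bar>f' c d x\<bar> \<le> B" if "(c, d) \<in> I" for c d
  proof -
    have "bounded (f' c d ` {c..d})"
      by (intro compact_imp_bounded compact_continuous_image f' that compact_Icc)
    then show ?thesis by (auto simp: bounded_iff)
  qed
  then have "\<forall>i. \<exists>B. i \<in> I \<longrightarrow> (\<forall>x\<in>{fst i..snd i}. \<bar>f' (fst i) (snd i) x\<bar> \<le> B)"
    by auto
  then obtain B where B: "\<And>i x. i \<in> I \<Longrightarrow> x \<in> {fst i..snd i} \<Longrightarrow> \<bar>f' (fst i) (snd i) x\<bar> \<le> B i"
    by metis
  define M where "M = (\<Sum>i\<in>I. \<bar>B i\<bar>)"
  have M: "\<bar>f' c d x\<bar> \<le> M" if "(c, d) \<in> I" "x \<in> {c..d}" for c d x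
  proof -
    have "\<bar>f' c d x\<bar> \<le> \<bar>B (c, d)\<bar>"
      using B[of "(c, d)" x] that by simp
    also have "\<dots> \<le> M"
      unfolding M_def by (rule member_le_sum) (use that finI in auto)
    finally show ?thesis .
  qed
  have "continuous_on (\<Union>i\<in>I. {fst i..snd i}) R1"
  proof (rule continuous_on_closed_Union[OF finI])
    show "continuous_on {fst i..snd i} R1" if "i \<in> I" for i
      by (rule DERIV_continuous_on[where D="f' (fst i) (snd i)"]) (use f'(2)[of "fst i" "snd i"] that in auto)
  qed auto
  then have cont: "continuous_on {0..2*pi} R1"
    by (rule continuous_on_subset) (use cover in force)
  have reg: "R1 differentiable (at x) \<and> \<bar>deriv R1 x\<bar> \<le> M \<and> isCont (deriv R1) x" if x: "x \<in> {0..2*pi} - P" for x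
  proof -
    obtain c d where cd: "(c, d) \<in> I" "c < x" "x < d"
      using cover[of x] x by auto
    have D: "(R1 has_real_derivative f' c d y) (at y)" if "y \<in> {c<..<d}" for y
      using f'(2)[OF cd(1), of y] that by (simp add: at_within_Icc_at)
    then have eq: "deriv R1 y = f' c d y" if "y \<in> {c<..<d}" for y
      using that DERIV_imp_deriv by blast
    have "continuous_on {c<..<d} (f' c d)"
      by (rule continuous_on_subset[OF f'(1)[OF cd(1)]]) auto
    then have "continuous_on {c<..<d} (deriv R1)"
      by (rule continuous_on_eq) (simp add: eq)
    then have "isCont (deriv R1) x"
      using cd by (subst (asm) continuous_on_eq_continuous_at) auto
    moreover have "R1 differentiable (at x)"
      using D[of x] cd by (auto simp: real_differentiable_def)
    moreover have "\<bar>deriv R1 x\<bar> \<le> M"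
      using M[OF cd(1), of x] eq[of x] cd by auto
    ultimately show ?thesis by blast
  qed
  show ?thesis
    by (rule that[OF P _ cont reg]) (auto simp: M_def intro: sum_nonneg)
qed

text \<open>On one period the bound follows by integrating the derivative between continuous end
  values, with finitely many exceptional points. Periodicity carries it to every cell, and points of
  different cells are compared through the cell ends lying between them.\<close>

lemma lipschitz:
  obtains P M where "finite P" "0 \<in> P" "P \<subseteq> {0..2 * pi}" "M-lipschitz_on UNIV R1"
    "\<And>x. x \<in> {0..2*pi} - P \<Longrightarrow> R1 differentiable (at x) \<and> \<bar>deriv R1 x\<bar> \<le> M \<and> isCont (deriv R1) x"
proof -
  obtain P M where P: "finite P" "0 \<in> P" "2 * pi \<in> P" "P \<subseteq> {0..2 * pi}" "M \<ge> 0"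
    and cont: "continuous_on {0..2*pi} R1"
    and reg: "\<And>x. x \<in> {0..2*pi} - P \<Longrightarrow> R1 differentiable (at x) \<and> \<bar>deriv R1 x\<bar> \<le> M \<and> isCont (deriv R1) x"
    using piecewise by metis
  have base: "\<bar>R1 b - R1 a\<bar> \<le> M * (b - a)" if ab: "0 \<le> a" "a \<le> b" "b \<le> 2 * pi" for a b
  proof -
    \<comment> \<open>\<open>deriv\<close> is unspecified at a point of non-differentiability; the
      value 0 at the break points keeps |g| below \<open>M\<close>.\<close>
    define g where "g x = (if x \<in> P then 0 else deriv R1 x)" for x
    have "(g has_integral (R1 b - R1 a)) {a..b}"
    proof (rule fundamental_theorem_of_calculus_interior_strong[OF P(1) ab(2)])
      show "(R1 has_vector_derivative g x) (at x)" if "x \<in> {a<..<b} - P" for x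
      proof -
        have "(R1 has_real_derivative deriv R1 x) (at x)"
          using reg[of x] that ab by (simp add: DERIV_deriv_iff_real_differentiable)
        then show ?thesis
          using that by (simp add: g_def has_real_derivative_iff_has_vector_derivative)
      qed
      show "continuous_on {a..b} R1"
        by (rule continuous_on_subset[OF cont]) (use ab in auto)
    qed
    then have "norm (R1 b - R1 a) \<le> M * measure lborel {a..b}"
      by (rule has_integral_bound_real[OF P(5) finite.emptyI]) (use reg ab P(5) in \<open>auto simp: g_def\<close>)
    then show ?thesis using ab by simp
  qed
  have cell: "\<bar>R1 b - R1 a\<bar> \<le> M * (b - a)" if "of_int n * (2 * pi) \<le> a" "a \<le> b" "b \<le> of_int (n + 1) * (2 * pi)" for a b n
  proof -
    have "R1 (x - of_int n * (2 * pi)) = R1 x" for x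
      using periodic_int[where f=R1, OF R1_periodic, of x "- n"] by simp
    then show ?thesis
      using base[of "a - of_int n * (2*pi)" "b - of_int n * (2*pi)"] that by (simp add: algebra_simps)
  qed
  have all: "\<bar>R1 b - R1 a\<bar> \<le> M * (b - a)" if "a \<le> b" for a b
  proof -
    define m where "m = \<lfloor>a / (2*pi)\<rfloor>"
    define n where "n = \<lfloor>b / (2*pi)\<rfloor>"
    have m: "of_int m * (2 * pi) \<le> a" "a \<le> of_int (m + 1) * (2 * pi)"
      unfolding m_def by (rule period_cell)+
    have n: "of_int n * (2 * pi) \<le> b" "b \<le> of_int (n + 1) * (2 * pi)"
      unfolding n_def by (rule period_cell)+
    have "m \<le> n"
      unfolding m_def n_def using that by (intro floor_mono divide_right_mono) auto
    show ?thesis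
    proof (cases "m = n")
      case True
      then show ?thesis using m n that cell by blast
    next
      case False
      with \<open>m \<le> n\<close> have "m + 1 \<le> n" by simp
      then have le: "of_int (m + 1) * (2 * pi) \<le> of_int n * (2 * pi)"
        by (intro mult_right_mono) (auto simp del: of_int_add)
      \<comment> \<open>Whole periods between the two cells contribute nothing, so only the two end
        stretches have to be estimated.\<close>
      have "R1 (of_int (m + 1) * (2 * pi)) = R1 (of_int n * (2 * pi))"
        using periodic_int[where f=R1, OF R1_periodic, of 0] by (simp del: of_int_add)
      moreover have "\<bar>R1 (of_int (m + 1) * (2 * pi)) - R1 a\<bar> \<le> M * (of_int (m + 1) * (2 * pi) - a)"
        using m by (intro cell) auto
      moreover have "\<bar>R1 b - R1 (of_int n * (2 * pi))\<bar> \<le> M * (b - of_int n * (2 * pi))"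
        using n by (intro cell) auto
      ultimately have "\<bar>R1 b - R1 a\<bar> \<le> M * (of_int (m + 1) * (2 * pi) - a) + M * (b - of_int n * (2 * pi))"
        by linarith
      also have "\<dots> \<le> M * (b - a)"
        using mult_left_mono[OF le P(5)] by (simp add: algebra_simps)
      finally show ?thesis .
    qed
  qed
  have "M-lipschitz_on UNIV R1"
  proof (rule lipschitz_onI)
    show "dist (R1 x) (R1 y) \<le> M * dist x y" for x y
      using all[of x y] all[of y x] by (cases "x \<le> y") (auto simp: dist_real_def abs_minus_commute)
  qed (rule P)
  then show ?thesis
    using that P reg by blast
qed

lemma R1_isCont: "isCont R1 \<theta>"
proof -
  obtain M where "M-lipschitz_on UNIV R1"
    using lipschitz by metis
  then have "continuous_on UNIV R1"
    by (rule lipschitz_on_continuous_on)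
  then show ?thesis
    by (simp add: continuous_on_eq_continuous_at)
qed

lemma R1_bounds:
  obtains m M where "m > 0" "\<And>\<theta>. m \<le> R1 \<theta>" "\<And>\<theta>. R1 \<theta> \<le> M"
proof -
  have c: "continuous_on {0..2*pi} R1"
    using R1_isCont by (simp add: continuous_at_imp_continuous_on)
  have "\<exists>a\<in>{0..2*pi}. \<forall>y\<in>{0..2*pi}. R1 a \<le> R1 y"
    by (rule continuous_attains_inf[OF compact_Icc _ c]) simp
  then obtain a where a: "\<And>x. x \<in> {0..2*pi} \<Longrightarrow> R1 a \<le> R1 x"
    by blast
  have "\<exists>b\<in>{0..2*pi}. \<forall>y\<in>{0..2*pi}. R1 y \<le> R1 b"
    by (rule continuous_attains_sup[OF compact_Icc _ c]) simp
  then obtain b where b: "\<And>x. x \<in> {0..2*pi} \<Longrightarrow> R1 x \<le> R1 b"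
    by blast
  have red: "\<exists>y\<in>{0..2*pi}. R1 x = R1 y" for x
  proof
    show "R1 x = R1 (x + of_int (- \<lfloor>x / (2*pi)\<rfloor>) * (2 * pi))"
      by (rule periodic_int[where f=R1, OF R1_periodic, symmetric])
    show "x + of_int (- \<lfloor>x / (2*pi)\<rfloor>) * (2 * pi) \<in> {0..2*pi}"
      using period_cell[of x] by (simp add: algebra_simps)
  qed
  show ?thesis
    by (rule that[of "R1 a" "R1 b"]) (use R1_pos a b red in \<open>metis\<close>)+
qed

end

section \<open>Cartesian and polar coordinates\<close>

definition to_complex :: "real^2 \<Rightarrow> complex" where
  "to_complex x = Complex (x $ 1) (x $ 2)"

lemma to_complex_simps [simp]: "Re (to_complex x) = x $ 1" "Im (to_complex x) = x $ 2"
  by (simp_all add: to_complex_def)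

lemma to_complex_eq_0 [simp]: "to_complex x = 0 \<longleftrightarrow> x = 0"
  by (simp add: complex_eq_iff vec_eq_iff forall_2)

lemma norm_to_complex [simp]: "cmod (to_complex x) = norm x"
  by (simp add: cmod_def norm_vec_def L2_set_def sum_2)

lemma bounded_linear_to_complex: "bounded_linear to_complex"
  by (intro linear_conv_bounded_linear[THEN iffD1] linearI) (auto simp: complex_eq_iff)

lemma continuous_to_complex: "continuous_on S to_complex"
  using bounded_linear_to_complex by (rule linear_continuous_on)

lemma polar_angle_bounds: "0 \<le> polar_angle x" "polar_angle x < 2 * pi"
  using Arg2pi by (auto simp: polar_angle_def)

lemma polar_angle_eq: "to_complex x = of_real (norm x) * cis (polar_angle x)"
  using Arg2pi_eq[of "to_complex x"] by (simp add: polar_angle_def to_complex_def[symmetric] cis_conv_exp)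

lemma polar_coords: "x $ 1 = norm x * cos (polar_angle x)" "x $ 2 = norm x * sin (polar_angle x)"
  using arg_cong[OF polar_angle_eq[of x], of Re] arg_cong[OF polar_angle_eq[of x], of Im] by simp_all

lemma cis_polar_angle:
  assumes "x \<noteq> 0"
  shows "cis (polar_angle x) = sgn (to_complex x)"
proof -
  have "sgn (to_complex x) = to_complex x / of_real (norm x)"
    by (simp add: sgn_eq)
  also have "\<dots> = cis (polar_angle x)"
    by (subst polar_angle_eq) (use assms in simp)
  finally show ?thesis ..
qed

text \<open>Two branches of the argument, smooth off the negative and off the positive real axis.\<close>

definition branch1 :: "real^2 \<Rightarrow> real" where "branch1 x = Im (Ln (to_complex x))"
definition branch2 :: "real^2 \<Rightarrow> real" where "branch2 x = Im (Ln (- to_complex x)) + pi"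

definition slit1 :: "(real^2) set" where "slit1 = {x. to_complex x \<notin> \<real>\<^sub>\<le>\<^sub>0}"
definition slit2 :: "(real^2) set" where "slit2 = {x. - to_complex x \<notin> \<real>\<^sub>\<le>\<^sub>0}"

lemma open_slit: "open slit1" "open slit2"
proof -
  have "slit1 = to_complex -` (- \<real>\<^sub>\<le>\<^sub>0)" "slit2 = (\<lambda>x. - to_complex x) -` (- \<real>\<^sub>\<le>\<^sub>0)"
    by (auto simp: slit1_def slit2_def)
  moreover have "open (to_complex -` (- \<real>\<^sub>\<le>\<^sub>0))" "open ((\<lambda>x. - to_complex x) -` (- \<real>\<^sub>\<le>\<^sub>0))"
    by (intro open_vimage continuous_intros continuous_to_complex; auto)+
  ultimately show "open slit1" "open slit2"
    by simp_all
qed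

lemma slit_cover: "slit1 \<union> slit2 = - {0}"
  by (auto simp: slit1_def slit2_def complex_nonpos_Reals_iff vec_eq_iff forall_2)

lemma cis_branch:
  assumes "x \<noteq> 0"
  shows "cis (branch1 x) = cis (polar_angle x)" "cis (branch2 x) = cis (polar_angle x)"
proof -
  have "cis (Im (Ln z)) = sgn z" if "z \<noteq> 0" for z
    using that cis_Arg[of z] by (simp add: Arg_eq_Im_Ln)
  from this[of "to_complex x"] this[of "- to_complex x"] assms
  show "cis (branch1 x) = cis (polar_angle x)" "cis (branch2 x) = cis (polar_angle x)"
    by (simp_all add: branch1_def branch2_def cis_polar_angle sgn_minus flip: cis_mult)
qed

text \<open>The differential of the argument is the imaginary part of dz / z, a single expression
  for both branches and continuous away from the origin.\<close>

lemma has_derivative_branch: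
  "x \<in> slit1 \<Longrightarrow> (branch1 has_derivative (\<lambda>u. Im (to_complex u / to_complex x))) (at x)"
  "x \<in> slit2 \<Longrightarrow> (branch2 has_derivative (\<lambda>u. Im (to_complex u / to_complex x))) (at x)"
proof -
  have tc: "(to_complex has_derivative to_complex) (at x)"
    using bounded_linear_to_complex by (rule bounded_linear_imp_has_derivative)
  have Ln: "((\<lambda>x. Im (Ln (f x))) has_derivative (\<lambda>u. Im (inverse (f x) * f' u))) (at x)"
    if "(f has_derivative f') (at x)" "f x \<notin> \<real>\<^sub>\<le>\<^sub>0" for f f'
  proof -
    have "(Ln has_derivative (*) (inverse (f x))) (at (f x))"
      using has_field_derivative_Ln[OF that(2)] by (simp add: has_field_derivative_def)
    from bounded_linear.has_derivative[OF bounded_linear_Im has_derivative_compose[OF that(1) this]]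
    show ?thesis by simp
  qed
  show "(branch1 has_derivative (\<lambda>u. Im (to_complex u / to_complex x))) (at x)" if "x \<in> slit1"
    using Ln[OF tc] that unfolding branch1_def[abs_def] slit1_def
    by (simp add: divide_inverse mult.commute)
  show "(branch2 has_derivative (\<lambda>u. Im (to_complex u / to_complex x))) (at x)" if "x \<in> slit2"
    using has_derivative_add[OF Ln[OF has_derivative_minus[OF tc]] has_derivative_const[of pi]] that
    unfolding branch2_def[abs_def] slit2_def
    by (simp add: divide_inverse mult.commute)
qed

lemma continuous_angle_derivative:
  "continuous_on (- {0}) (\<lambda>x. Im (to_complex u / to_complex x))"
  by (intro continuous_intros continuous_to_complex) auto

text \<open>Whole lines with normal (-sin p, cos p) instead of rays: a finite union of hyperplanes
  through the origin is at once closed and negligible, and contains every ray of angle p.\<close>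

definition angle_lines :: "real set \<Rightarrow> (real^2) set" where
  "angle_lines P = (\<Union>p\<in>P. {x. x \<bullet> vector [- sin p, cos p] = 0})"

lemma angle_lines:
  assumes "finite P"
  shows "closed (angle_lines P)" "negligible (angle_lines P)"
proof -
  show "closed (angle_lines P)"
    unfolding angle_lines_def using assms
    by (intro closed_UN ballI) (auto simp: inner_commute[of _ "vector _"] closed_hyperplane)
  have nz: "vector [- sin p, cos p] \<noteq> (0 :: real^2)" for p
    using sin_cos_squared_add[of p] by (auto simp: vec_eq_iff forall_2 simp del: sin_cos_squared_add)
  then show "negligible (angle_lines P)"
    unfolding angle_lines_def using assms nz
    by (intro negligible_Union) (auto intro!: negligible_hyperplane simp: inner_commute[of _ "vector _"])
qed

text \<open>The angle 0 in \<open>P\<close> removes the entire real axis, hence the origin and the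
  half line across which \<open>polar_angle\<close> jumps.\<close>

lemma not_in_angle_lines:
  assumes "x \<notin> angle_lines P" "0 \<in> P"
  shows "x \<noteq> 0" "polar_angle x \<notin> P" "x \<in> slit2"
proof -
  have *: "x $ 2 * cos p \<noteq> x $ 1 * sin p" if "p \<in> P" for p
    using assms(1) that by (auto simp: angle_lines_def inner_vec_def sum_2)
  from *[OF assms(2)] have "x $ 2 \<noteq> 0" by simp
  then show "x \<noteq> 0" "x \<in> slit2"
    by (auto simp: slit2_def complex_nonpos_Reals_iff)
  show "polar_angle x \<notin> P"
    using *[of "polar_angle x"] polar_coords[of x] by (auto simp: mult_ac)
qed

lemma polar_angle_branch2: "x \<in> slit2 \<Longrightarrow> polar_angle x = branch2 x"
proof -
  assume x: "x \<in> slit2"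
  have "Arg2pi (to_complex x) \<noteq> 0"
  proof
    assume "Arg2pi (to_complex x) = 0"
    then have "to_complex x = of_real (cmod (to_complex x))"
      using Arg2pi_eq[of "to_complex x"] by simp
    then have "- to_complex x = of_real (- cmod (to_complex x))"
      by simp
    then have "- to_complex x \<in> \<real>\<^sub>\<le>\<^sub>0"
      by (metis neg_le_0_iff_le nonpos_Reals_of_real_iff norm_ge_zero)
    with x show False by (simp add: slit2_def)
  qed
  then have "0 < Arg2pi (to_complex x)"
    using Arg2pi_ge_0[of "to_complex x"] by linarith
  from Arg2pi_Ln[OF this] show ?thesis
    by (simp add: polar_angle_def branch2_def to_complex_def)
qed

lemma has_derivative_polar_angle:
  assumes "x \<in> slit2"
  shows "(polar_angle has_derivative (\<lambda>u. Im (to_complex u / to_complex x))) (at x)"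
  by (rule has_derivative_transform_within_open[OF has_derivative_branch(2)[OF assms] open_slit(2) assms])
    (simp add: polar_angle_branch2)

lemma isCont_polar_angle: "x \<in> slit2 \<Longrightarrow> isCont polar_angle x"
  using has_derivative_polar_angle has_derivative_continuous by blast

section \<open>The substitution factor on the computational domain\<close>

lemma layer_w_logderiv_linear:
  "layer_w_logderiv k \<sigma>1 R T (a * dR + b * dR') (a * dT + b * dT') =
    of_real a * layer_w_logderiv k \<sigma>1 R T dR dT + of_real b * layer_w_logderiv k \<sigma>1 R T dR' dT'"
proof -
  have "3/2 * \<sigma>1 * layer_t \<sigma>1 R T * ((a * dR + b * dR') * T - R * (a * dT + b * dT')) / R\<^sup>2 =
     a * (3/2 * \<sigma>1 * layer_t \<sigma>1 R T * (dR * T - R * dT) / R\<^sup>2) + b * (3/2 * \<sigma>1 * layer_t \<sigma>1 R T * (dR' * T - R * dT') / R\<^sup>2)"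
    by (simp add: algebra_simps diff_divide_distrib add_divide_distrib)
  then show ?thesis
    unfolding layer_w_logderiv_def by (simp add: algebra_simps)
qed

text \<open>The third inequality is R + \<sigma>1 T > 0 cleared of its denominator. It also holds at
  r = R when \<rho> > 1, so this open set contains a neighbourhood of the interface values and the
  layer formula extends smoothly a little beyond it.\<close>

definition layer_region :: "real \<Rightarrow> real \<Rightarrow> (real^2) set" where
  "layer_region \<sigma>1 \<rho> = {y. 0 < y $ 2 \<and> y $ 1 < \<rho> * y $ 2 \<and>
     0 < y $ 2 * (\<rho> * y $ 2 - y $ 1) + \<sigma>1 * ((\<rho> * y $ 2 - y $ 2) * (y $ 1 - y $ 2))}"

lemma open_layer_region: "open (layer_region \<sigma>1 \<rho>)"
  unfolding layer_region_def
  by (intro open_Collect_conj open_Collect_less continuous_intros)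

lemma layer_region_pos:
  assumes "y \<in> layer_region \<sigma>1 \<rho>"
  shows "0 < y $ 2" "\<rho> * y $ 2 - y $ 1 > 0" "y $ 2 + \<sigma>1 * layer_T \<rho> (y $ 1) (y $ 2) > 0"
proof -
  show *: "0 < y $ 2" "\<rho> * y $ 2 - y $ 1 > 0"
    using assms by (auto simp: layer_region_def)
  have "y $ 2 + \<sigma>1 * layer_T \<rho> (y $ 1) (y $ 2) =
      (y $ 2 * (\<rho> * y $ 2 - y $ 1) + \<sigma>1 * ((\<rho> * y $ 2 - y $ 2) * (y $ 1 - y $ 2))) / (\<rho> * y $ 2 - y $ 1)"
    using *(2) by (simp add: layer_T_def add_divide_distrib)
  also have "\<dots> > 0"
    using assms *(2) by (intro divide_pos_pos) (auto simp: layer_region_def)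
  finally show "y $ 2 + \<sigma>1 * layer_T \<rho> (y $ 1) (y $ 2) > 0" .
qed

lemma continuous_on_layer:
  fixes r R dR dT :: "'a::topological_space \<Rightarrow> real"
  assumes c: "continuous_on S r" "continuous_on S R"
    and nz: "\<And>x. x \<in> S \<Longrightarrow> \<rho> * R x - r x \<noteq> 0"
  shows "continuous_on S (\<lambda>x. layer_T \<rho> (r x) (R x))"
    "continuous_on S (\<lambda>x. layer_Tr \<rho> (r x) (R x))"
    "continuous_on S (\<lambda>x. layer_TR \<rho> (r x) (R x))"
  unfolding layer_T_def layer_Tr_def layer_TR_def
  using nz by (intro continuous_intros c; simp)+

lemma continuous_on_layer_w:
  fixes T R dR dT :: "'a::topological_space \<Rightarrow> real"
  assumes c: "continuous_on S R" "continuous_on S T" "continuous_on S dR" "continuous_on S dT"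
    and pos: "\<And>x. x \<in> S \<Longrightarrow> R x > 0" "\<And>x. x \<in> S \<Longrightarrow> R x + \<sigma>1 * T x > 0"
  shows "continuous_on S (\<lambda>x. layer_w k \<sigma>1 (R x) (T x) * layer_w_logderiv k \<sigma>1 (R x) (T x) (dR x) (dT x))"
proof -
  have nz: "R x \<noteq> 0" "R x + \<sigma>1 * T x \<noteq> 0" if "x \<in> S" for x
    using pos[OF that] by auto
  have t: "continuous_on S (\<lambda>x. layer_t \<sigma>1 (R x) (T x))"
    unfolding layer_t_def using nz by (intro continuous_intros c) auto
  have t0: "layer_t \<sigma>1 (R x) (T x) \<noteq> 0" if "x \<in> S" for x
    using nz[OF that] by (simp add: layer_t_def)
  show ?thesis
    unfolding layer_w_def layer_w_logderiv_def
    using nz t0 by (intro continuous_intros continuous_on_powr c t) auto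
qed

lemma locally_lipschitz_layer_w:
  "locally_lipschitz (layer_region \<sigma>1 \<rho>) (\<lambda>y. layer_w k \<sigma>1 (y $ 2) (layer_T \<rho> (y $ 1) (y $ 2)))"
proof -
  let ?Y = "layer_region \<sigma>1 \<rho>"
  let ?f = "\<lambda>y::real^2. layer_w k \<sigma>1 (y $ 2) (layer_T \<rho> (y $ 1) (y $ 2))"
  have D: "(?f has_derivative (\<lambda>u. ?f y * layer_w_logderiv k \<sigma>1 (y $ 2) (layer_T \<rho> (y $ 1) (y $ 2)) (u $ 2)
      (layer_Tr \<rho> (y $ 1) (y $ 2) * u $ 1 + layer_TR \<rho> (y $ 1) (y $ 2) * u $ 2))) (at y)" if y: "y \<in> ?Y" for y
  proof -
    have nth: "((\<lambda>y::real^2. y $ i) has_derivative (\<lambda>u. u $ i)) (at y)" for i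
      by (rule bounded_linear_imp_has_derivative[OF bounded_linear_vec_nth])
    note pos = layer_region_pos[OF y]
    from pos(2) have "\<rho> * y $ 2 - y $ 1 \<noteq> 0" by simp
    note T = has_derivative_layer_T[OF nth[of 1] nth[of 2] this]
    show ?thesis
      by (rule has_derivative_layer_w[OF nth[of 2] T pos(1,3)])
  qed
  show ?thesis
  proof (rule C1_imp_locally_lipschitz[OF open_layer_region])
    show "?f differentiable (at y)" if "y \<in> ?Y" for y
      using D[OF that] by (rule differentiableI)
    fix i :: 2
    have "continuous_on ?Y (\<lambda>y. ?f y * layer_w_logderiv k \<sigma>1 (y $ 2) (layer_T \<rho> (y $ 1) (y $ 2)) (axis i 1 $ 2)
      (layer_Tr \<rho> (y $ 1) (y $ 2) * axis i 1 $ 1 + layer_TR \<rho> (y $ 1) (y $ 2) * axis i 1 $ 2))"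
      using layer_region_pos[of _ \<sigma>1 \<rho>]
      by (intro continuous_on_layer_w continuous_on_layer continuous_intros; force)
    then show "continuous_on ?Y (\<lambda>y. grad ?f y $ i)"
      by (rule continuous_on_eq) (simp add: grad_eqI[OF D])
  qed
qed

section \<open>The boundary radius as a function on the plane, and its exceptional set\<close>

locale boundary_pieces = periodic_boundary R1 for R1 :: "real \<Rightarrow> real" +
  fixes P :: "real set" and M :: real
  assumes P: "finite P" "0 \<in> P" "P \<subseteq> {0..2 * pi}"
    and R1_lipschitz: "M-lipschitz_on UNIV R1"
    and R1_regular: "\<And>x. x \<in> {0..2*pi} - P \<Longrightarrow> R1 differentiable (at x) \<and> \<bar>deriv R1 x\<bar> \<le> M \<and> isCont (deriv R1) x"
begin

definition Rt :: "real^2 \<Rightarrow> real" where "Rt x = R1 (polar_angle x)"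

lemma Rt_pos: "Rt x > 0"
  unfolding Rt_def by (rule R1_pos)

lemma Rt_branch: "x \<noteq> 0 \<Longrightarrow> Rt x = R1 (branch1 x)" "x \<noteq> 0 \<Longrightarrow> Rt x = R1 (branch2 x)"
  unfolding Rt_def by (rule R1_cong, simp add: cis_branch)+

text \<open>\<open>polar_angle\<close> jumps across the positive real axis, but by periodicity
  \<open>Rt\<close> equals \<open>R1\<close> composed with either branch of the argument. Each
  branch is C1 on its own slit plane, and the two slit planes cover everything but the
  origin.\<close>

lemma locally_lipschitz_Rt: "locally_lipschitz (- {0}) Rt"
proof -
  have R1: "locally_lipschitz UNIV R1"
    by (rule lipschitz_imp_locally_lipschitz[OF R1_lipschitz])
  have C: "continuous_on S (\<lambda>x. Im (to_complex u / to_complex x))" if "S \<subseteq> - {0}" for S u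
    by (rule continuous_on_subset[OF continuous_angle_derivative that])
  have sub: "slit1 \<subseteq> - {0}" "slit2 \<subseteq> - {0}"
    using slit_cover by auto
  have "locally_lipschitz slit1 branch1"
  proof (rule C1_imp_locally_lipschitz[OF open_slit(1)])
    show "branch1 differentiable (at x)" if "x \<in> slit1" for x
      using has_derivative_branch(1)[OF that] by (rule differentiableI)
    show "continuous_on slit1 (\<lambda>x. grad branch1 x $ i)" for i
      by (rule continuous_on_eq[OF C[OF sub(1)]]) (rule grad_eqI[OF has_derivative_branch(1), symmetric])
  qed
  from locally_lipschitz_compose[OF this R1] have "locally_lipschitz slit1 (\<lambda>x. R1 (branch1 x))" by simp
  then have 1: "locally_lipschitz slit1 Rt"
    by (rule locally_lipschitz_cong_open[OF _ open_slit(1)]) (use sub in \<open>auto intro!: Rt_branch(1)[symmetric]\<close>)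
  have "locally_lipschitz slit2 branch2"
  proof (rule C1_imp_locally_lipschitz[OF open_slit(2)])
    show "branch2 differentiable (at x)" if "x \<in> slit2" for x
      using has_derivative_branch(2)[OF that] by (rule differentiableI)
    show "continuous_on slit2 (\<lambda>x. grad branch2 x $ i)" for i
      by (rule continuous_on_eq[OF C[OF sub(2)]]) (rule grad_eqI[OF has_derivative_branch(2), symmetric])
  qed
  from locally_lipschitz_compose[OF this R1] have "locally_lipschitz slit2 (\<lambda>x. R1 (branch2 x))" by simp
  then have 2: "locally_lipschitz slit2 Rt"
    by (rule locally_lipschitz_cong_open[OF _ open_slit(2)]) (use sub in \<open>auto intro!: Rt_branch(2)[symmetric]\<close>)
  show ?thesis
    using 1 2 unfolding slit_cover[symmetric] locally_lipschitz_def by blast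
qed

lemma open_outside:
  assumes "c > 0"
  shows "open {x. c * Rt x < norm x}"
proof -
  have "continuous_on (- {0}) (\<lambda>x. norm x - c * Rt x)"
    using locally_lipschitz_continuous[OF locally_lipschitz_Rt] by (intro continuous_intros)
  then have "open (- {0} \<inter> (\<lambda>x. norm x - c * Rt x) -` {0<..})"
    by (rule continuous_open_preimage) auto
  also have "- {0} \<inter> (\<lambda>x. norm x - c * Rt x) -` {0<..} = {x. c * Rt x < norm x}"
    using mult_pos_pos[OF assms Rt_pos[of 0]] by auto
  finally show ?thesis .
qed

lemma open_inside:
  assumes "c > 0"
  shows "open {x. norm x < c * Rt x}"
proof -
  obtain m where m: "m > 0" "\<And>\<theta>. m \<le> R1 \<theta>"
    using R1_bounds by metis
  have "continuous_on (- {0}) (\<lambda>x. norm x - c * Rt x)"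
    using locally_lipschitz_continuous[OF locally_lipschitz_Rt] by (intro continuous_intros)
  then have "open (- {0} \<inter> (\<lambda>x. norm x - c * Rt x) -` {..<0})"
    by (rule continuous_open_preimage) auto
  \<comment> \<open>\<open>Rt\<close> need not be continuous at the origin; the positive lower bound
    of \<open>R1\<close> supplies a ball there by hand.\<close>
  then have "open (ball 0 (c * m) \<union> (- {0} \<inter> (\<lambda>x. norm x - c * Rt x) -` {..<0}))"
    by auto
  also have "ball 0 (c * m) \<union> (- {0} \<inter> (\<lambda>x. norm x - c * Rt x) -` {..<0}) = {x. norm x < c * Rt x}"
  proof -
    have "c * m \<le> c * Rt x" for x
      using assms m(2) by (simp add: Rt_def)
    then have "norm x < c * Rt x" if "norm x < c * m" for x
      using that by (rule less_le_trans[rotated])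
    moreover have "c * m > 0" using assms m by simp
    ultimately show ?thesis by auto
  qed
  finally show ?thesis .
qed

definition interface :: "(real^2) set" where "interface = {x. norm x = Rt x}"

lemma Rt_scale:
  assumes "c > 0"
  shows "Rt (c *\<^sub>R x) = Rt x"
proof (cases "x = 0")
  case False
  have "to_complex (c *\<^sub>R x) = of_real c * to_complex x"
    by (simp add: complex_eq_iff)
  then have "cis (polar_angle (c *\<^sub>R x)) = cis (polar_angle x)"
    using assms False by (simp add: cis_polar_angle sgn_mult sgn_of_real)
  then show ?thesis
    unfolding Rt_def by (rule R1_cong)
qed simp

text \<open>\<open>Rt\<close> is constant along rays and positive, so each ray from the origin meets
  the interface at most once. A closed set with this property is negligible.\<close>

lemma interface: "closed interface" "negligible interface"
proof -
  have "- interface = {x. norm x < 1 * Rt x} \<union> {x. 1 * Rt x < norm x}"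
    by (auto simp: interface_def)
  then have "open (- interface)"
    using open_inside[of 1] open_outside[of 1] by auto
  then show cl: "closed interface"
    by (simp add: closed_def)
  show "negligible interface"
  proof (rule starlike_negligible[OF cl, of 0])
    fix c x assume *: "0 + c *\<^sub>R x \<in> interface" "0 \<le> c" "0 + x \<in> interface"
    then have "c \<noteq> 0"
      using Rt_pos[of 0] by (auto simp: interface_def)
    with *(2) have c: "c > 0" by simp
    have "c * norm x = norm x"
      using * Rt_scale[OF c, of x] by (simp add: interface_def)
    moreover have "norm x > 0"
      using *(3) Rt_pos[of x] by (simp add: interface_def)
    ultimately show "c = 1" by simp
  qed
qed

definition sing :: "(real^2) set" where "sing = angle_lines P \<union> interface"

lemma sing: "closed sing" "negligible sing"
  unfolding sing_def using interface angle_lines[OF P(1)] by (auto intro: negligible_Un)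

lemma not_sing:
  assumes "x \<notin> sing"
  shows "x \<noteq> 0" "x \<in> slit2" "norm x \<noteq> Rt x" "R1 differentiable (at (polar_angle x))"
    "\<bar>deriv R1 (polar_angle x)\<bar> \<le> M" "isCont (deriv R1) (polar_angle x)"
proof -
  have x: "x \<notin> angle_lines P" "norm x \<noteq> Rt x"
    using assms by (auto simp: sing_def interface_def)
  show "x \<noteq> 0" "x \<in> slit2" "norm x \<noteq> Rt x"
    using not_in_angle_lines[OF x(1) P(2)] x(2) by auto
  have "polar_angle x \<in> {0..2*pi} - P"
    using not_in_angle_lines[OF x(1) P(2)] polar_angle_bounds[of x] by auto
  then show "R1 differentiable (at (polar_angle x))"
    "\<bar>deriv R1 (polar_angle x)\<bar> \<le> M" "isCont (deriv R1) (polar_angle x)"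
    using R1_regular by blast+
qed

lemma has_derivative_Rt:
  assumes "x \<notin> sing"
  shows "(Rt has_derivative (\<lambda>u. Im (to_complex u / to_complex x) * deriv R1 (polar_angle x))) (at x)"
proof -
  have "(R1 has_derivative (\<lambda>u. u * deriv R1 (polar_angle x))) (at (polar_angle x))"
    using not_sing(4)[OF assms] unfolding DERIV_deriv_iff_real_differentiable[symmetric] has_field_derivative_def
    by (rule has_derivative_eq_rhs) (simp add: fun_eq_iff mult.commute)
  from has_derivative_compose[OF has_derivative_polar_angle[OF not_sing(2)[OF assms]] this]
  show ?thesis by (simp add: Rt_def[abs_def])
qed

lemma continuous_deriv_R1: "continuous_on (- sing) (\<lambda>x. deriv R1 (polar_angle x))"
proof (intro continuous_at_imp_continuous_on ballI)
  fix x assume "x \<in> - sing"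
  then have x: "x \<notin> sing" by simp
  show "isCont (\<lambda>x. deriv R1 (polar_angle x)) x"
    by (rule isCont_o2[OF isCont_polar_angle[OF not_sing(2)[OF x]] not_sing(6)[OF x]])
qed

lemma continuous_Rt: "continuous_on (- sing) Rt"
  by (rule continuous_on_subset[OF locally_lipschitz_continuous[OF locally_lipschitz_Rt]])
    (use not_sing in auto)

end

section \<open>Gluing the substitution factor across the interface\<close>

locale pal_domain = boundary_pieces R1 P M for R1 P M +
  fixes k \<sigma>0 \<sigma>1 \<rho> :: real and D :: "(real^2) set"
  assumes \<sigma>0: "\<sigma>0 > 0" and \<sigma>1: "\<sigma>1 > 0" and \<rho>: "\<rho> > 1" and D: "scatterer R1 D"
begin

abbreviation "U \<equiv> Omega_c \<rho> R1 D"
abbreviation "w \<equiv> at_polar (pal_w k \<sigma>1 \<rho> R1)"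
abbreviation "inner_region \<equiv> {x. norm x < 1 * Rt x}"
abbreviation "outer_region \<equiv> {x. 1 * Rt x < norm x}"

text \<open>Interior part, interface and layer combine to one star-shaped set minus the closed
  scatterer, which makes openness of the computational domain visible.\<close>

lemma U_eq: "U = {x. norm x < \<rho> * Rt x} - closure D"
proof -
  have lt: "Rt x < \<rho> * Rt x" for x
    using Rt_pos[of x] \<rho> by simp
  have "norm x < Rt x" if "x \<in> closure D" for x
    using D that by (auto simp: scatterer_def star_domain_def Rt_def)
  then show ?thesis
    using lt less_trans[OF _ lt]
    by (auto simp: Omega_c_def Omega_def star_domain_def at_polar_def in_PAL_def Rt_def[symmetric] not_less)
      (metis less_irrefl less_trans linorder_neqE_linordered_idom)+
qed

lemma open_U: "open U"
  unfolding U_eq using \<rho> by (intro open_Diff open_inside) auto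

lemma U_split:
  assumes "x \<in> U" "x \<notin> sing"
  shows "x \<in> Omega R1 D \<and> x \<in> inner_region \<or> x \<in> outer_region \<and> at_polar (in_PAL \<rho> R1) x"
  using assms not_sing(3)[OF assms(2)]
  by (auto simp: Omega_c_def Omega_def star_domain_def at_polar_def in_PAL_def Rt_def[symmetric])

lemma w_inner: "norm x \<le> Rt x \<Longrightarrow> w x = 1"
  by (simp add: at_polar_def pal_w_def Rt_def)

lemma w_outer: "Rt x < norm x \<Longrightarrow> w x = layer_w k \<sigma>1 (Rt x) (layer_T \<rho> (norm x) (Rt x))"
  by (simp add: at_polar_def pal_w_layer Rt_def)

lemma layer_region_mem:
  assumes "0 < R" "R \<le> r" "r < \<rho> * R"
  shows "vector [r, R] \<in> layer_region \<sigma>1 \<rho>"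
proof -
  have "0 < R * (\<rho> * R - r)"
    using assms by (intro mult_pos_pos) auto
  moreover have "0 \<le> \<sigma>1 * ((\<rho> * R - R) * (r - R))"
    using assms \<rho> \<sigma>1 by (intro mult_nonneg_nonneg) auto
  ultimately have "0 < R * (\<rho> * R - r) + \<sigma>1 * ((\<rho> * R - R) * (r - R))"
    by (rule add_pos_nonneg)
  then show ?thesis
    using assms by (simp add: layer_region_def)
qed

text \<open>Off the origin, \<open>w\<close> is the smooth layer factor evaluated at r = max (norm
  x) (Rt x) and R = Rt x. The maximum glues both definitions, because T = 0 and t = 1 at r = R give
  the value 1. As maxima of Lipschitz functions are Lipschitz, no separate estimate at the interface
  arises. Near the origin \<open>w\<close> is 1.\<close>

lemma locally_lipschitz_w: "locally_lipschitz U w"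
proof -
  let ?f = "\<lambda>y::real^2. layer_w k \<sigma>1 (y $ 2) (layer_T \<rho> (y $ 1) (y $ 2))"
  let ?V = "{x. norm x < \<rho> * Rt x} - {0}"
  let ?g = "\<lambda>x. vector [max (norm x) (Rt x), Rt x] :: real^2"
  have oV: "open ?V"
    using \<rho> by (intro open_Diff open_inside) auto
  have "locally_lipschitz (- {0}) ?g"
    unfolding locally_lipschitz_def
  proof
    fix x :: "real^2" assume "x \<in> - {0}"
    with locally_lipschitz_Rt obtain e L where e: "e > 0" "L-lipschitz_on (ball x e) Rt"
      by (rule locally_lipschitzE)
    have L: "L \<ge> 0" using e lipschitz_on_nonneg by blast
    have "(1 + L + L)-lipschitz_on (ball x e) ?g"
    proof (rule lipschitz_onI)
      fix y z assume yz: "y \<in> ball x e" "z \<in> ball x e"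
      have 1: "\<bar>Rt y - Rt z\<bar> \<le> L * dist y z"
        using lipschitz_onD[OF e(2) yz] by (simp add: dist_real_def)
      have 2: "\<bar>norm y - norm z\<bar> \<le> dist y z"
        by (simp add: dist_norm norm_triangle_ineq3)
      have "dist (?g y) (?g z) \<le> \<bar>max (norm y) (Rt y) - max (norm z) (Rt z)\<bar> + \<bar>Rt y - Rt z\<bar>"
        using norm_le_l1_cart[of "?g y - ?g z"] by (simp add: dist_norm sum_2)
      also have "\<bar>max (norm y) (Rt y) - max (norm z) (Rt z)\<bar> \<le> \<bar>norm y - norm z\<bar> + \<bar>Rt y - Rt z\<bar>"
        by linarith
      also have "\<bar>norm y - norm z\<bar> + \<bar>Rt y - Rt z\<bar> + \<bar>Rt y - Rt z\<bar> \<le> dist y z + L * dist y z + L * dist y z"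
        using 1 2 by linarith
      finally show "dist (?g y) (?g z) \<le> (1 + L + L) * dist y z"
        by (simp add: algebra_simps)
    qed (use L in auto)
    then show "\<exists>e>0. \<exists>L. L-lipschitz_on (ball x e) ?g"
      using e(1) by blast
  qed
  then have "locally_lipschitz ?V ?g"
    by (rule locally_lipschitz_subset) auto
  moreover have "?g ` ?V \<subseteq> layer_region \<sigma>1 \<rho>"
  proof
    fix y assume "y \<in> ?g ` ?V"
    then obtain x where x: "x \<in> ?V" "y = ?g x" by blast
    show "y \<in> layer_region \<sigma>1 \<rho>"
      unfolding x(2) using x(1) Rt_pos[of x] \<rho> by (intro layer_region_mem) auto
  qed
  ultimately have "locally_lipschitz ?V (\<lambda>x. ?f (?g x))"
    using locally_lipschitz_compose[OF _ locally_lipschitz_layer_w] by blast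
  then have V: "locally_lipschitz ?V w"
  proof (rule locally_lipschitz_cong_open[OF _ oV])
    fix x assume "x \<in> ?V"
    show "?f (?g x) = w x"
    proof (cases "norm x \<le> Rt x")
      case True
      then show ?thesis
        using Rt_pos[of x] by (simp add: w_inner max_def layer_T_def layer_w_def layer_t_def)
    next
      case False
      then show ?thesis
        by (simp add: w_outer max_def)
    qed
  qed
  have "locally_lipschitz inner_region w"
    by (rule locally_lipschitz_cong_open[where f="\<lambda>_. 1"])
      (use open_inside[of 1] in \<open>auto simp: w_inner intro!: lipschitz_imp_locally_lipschitz lipschitz_on_constant\<close>)
  then have "\<exists>e>0. \<exists>L. L-lipschitz_on (ball 0 e) w"
    using Rt_pos[of 0] unfolding locally_lipschitz_def by auto
  with V have "locally_lipschitz (insert 0 ?V) w"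
    unfolding locally_lipschitz_def by blast
  then show ?thesis
    by (rule locally_lipschitz_subset) (auto simp: U_eq)
qed

text \<open>The Cartesian gradient obtained by rotating the polar one. In this form its rotation
  cancels against the rotations inside \<open>pal_C\<close>.\<close>

definition w_grad :: "real^2 \<Rightarrow> complex^2" where
  "w_grad x = rot (polar_angle x) *v at_polar (polar_grad (pal_w k \<sigma>1 \<rho> R1)) x"

lemma pal_point_at:
  assumes "x \<notin> sing" "at_polar (in_PAL \<rho> R1) x"
  shows "pal_point \<sigma>0 \<sigma>1 \<rho> (norm x) (polar_angle x) R1"
  using assms not_sing(4)[OF assms(1)] \<sigma>0 \<sigma>1 \<rho> R1_pos
  by unfold_locales (auto simp: at_polar_def)

definition w_deriv :: "real^2 \<Rightarrow> real^2 \<Rightarrow> complex" where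
  "w_deriv x = (\<lambda>u. w x * layer_w_logderiv k \<sigma>1 (Rt x) (layer_T \<rho> (norm x) (Rt x))
      (Im (to_complex u / to_complex x) * deriv R1 (polar_angle x))
      (layer_Tr \<rho> (norm x) (Rt x) * (sgn x \<bullet> u) + layer_TR \<rho> (norm x) (Rt x) * (Im (to_complex u / to_complex x) * deriv R1 (polar_angle x))))"

text \<open>A Cartesian increment is split into its radial component and its angular component
  divided by the radius. Linearity of \<open>layer_w_logderiv\<close> then reassembles the two polar
  partial derivatives.\<close>

lemma w_C1_outer:
  assumes x: "x \<notin> sing" "at_polar (in_PAL \<rho> R1) x"
  shows "(w has_derivative w_deriv x) (at x)"
    "grad w x = w_grad x"
proof -
  interpret pt: pal_point k \<sigma>0 \<sigma>1 \<rho> "norm x" "polar_angle x" R1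
    by (rule pal_point_at[OF x])
  have x0: "x \<noteq> 0" using not_sing(1)[OF x(1)] .
  have lt: "Rt x < norm x" "norm x < \<rho> * Rt x"
    using pt.r by (auto simp: Rt_def)
  have R: "(Rt has_derivative (\<lambda>u. Im (to_complex u / to_complex x) * deriv R1 (polar_angle x))) (at x)"
    by (rule has_derivative_Rt[OF x(1)])
  have n: "(norm has_derivative (\<lambda>u. sgn x \<bullet> u)) (at x)"
    by (rule has_derivative_eq_rhs[OF has_derivative_norm[OF x0]]) (simp add: fun_eq_iff inner_commute)
  from lt have nz: "\<rho> * Rt x - norm x \<noteq> 0" by simp
  note T = has_derivative_layer_T[OF n R nz]
  have pos: "Rt x > 0" "Rt x + \<sigma>1 * layer_T \<rho> (norm x) (Rt x) > 0"
    using Rt_pos pt.denom_pos by (auto simp: Rt_def)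
  have "((\<lambda>y. layer_w k \<sigma>1 (Rt y) (layer_T \<rho> (norm y) (Rt y))) has_derivative w_deriv x) (at x)"
    using has_derivative_layer_w[OF R T pos, of k] by (simp add: w_outer[OF lt(1)] w_deriv_def)
  then show D: "(w has_derivative w_deriv x) (at x)"
    by (rule has_derivative_transform_within_open[OF _ open_outside[of 1]]) (use lt w_outer in auto)
  let ?\<theta> = "polar_angle x"
  have comp: "layer_w_logderiv k \<sigma>1 (Rt x) (layer_T \<rho> (norm x) (Rt x)) (b / norm x * deriv R1 ?\<theta>)
      (layer_Tr \<rho> (norm x) (Rt x) * a + layer_TR \<rho> (norm x) (Rt x) * (b / norm x * deriv R1 ?\<theta>))
      = of_real a * pt.ar + of_real b * pt.a\<theta> / of_real (norm x)" for a b
    using layer_w_logderiv_linear[of k \<sigma>1 "Rt x" "layer_T \<rho> (norm x) (Rt x)" a 0 "b / norm x" "deriv R1 ?\<theta>"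
        "layer_Tr \<rho> (norm x) (Rt x)" "layer_TR \<rho> (norm x) (Rt x) * deriv R1 ?\<theta>"]
    by (simp add: Rt_def mult_ac)
  \<comment> \<open>Dividing by x rotates the increment by minus the polar angle; the imaginary part
    is its component orthogonal to x over the radius.\<close>
  have inv: "Im (to_complex u / to_complex x) = (- sin ?\<theta> * u $ 1 + cos ?\<theta> * u $ 2) / norm x" for u
  proof -
    have "to_complex u / to_complex x = to_complex u * cis (- ?\<theta>) / of_real (norm x)"
      by (subst (2) polar_angle_eq) (simp add: divide_inverse cis_inverse mult_ac)
    then show ?thesis by (simp add: algebra_simps)
  qed
  have sg: "sgn x \<bullet> u = cos ?\<theta> * u $ 1 + sin ?\<theta> * u $ 2" for u
    using polar_coords[of x] x0
    by (simp add: sgn_div_norm inner_vec_def sum_2 field_simps)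
  have w: "w x = pt.w"
    by (simp add: w_outer[OF lt(1)] Rt_def)
  have pg: "at_polar (polar_grad (pal_w k \<sigma>1 \<rho> R1)) x = vector [w x * pt.ar, w x * pt.a\<theta> / of_real (norm x)]"
    unfolding w by (simp add: at_polar_def pt.polar_grad_w)
  have val: "grad w x $ i = w x * (of_real (cos ?\<theta> * axis i 1 $ 1 + sin ?\<theta> * axis i 1 $ 2) * pt.ar
      + of_real (- sin ?\<theta> * axis i 1 $ 1 + cos ?\<theta> * axis i 1 $ 2) * pt.a\<theta> / of_real (norm x))" for i
    by (simp only: grad_eqI[OF D] w_deriv_def inv sg comp)
  have "grad w x $ i = w_grad x $ i" for i
    using exhaust_2[of i] unfolding val
    by (auto simp: w_grad_def pg rot_def matrix_vector_mult_def sum_2 axis_def algebra_simps)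
  then show "grad w x = w_grad x"
    by (simp add: vec_eq_iff)
qed

lemma w_C1_inner:
  assumes "norm x < Rt x"
  shows "(w has_derivative (\<lambda>_. 0)) (at x)" "grad w x $ i = 0"
proof -
  show D: "(w has_derivative (\<lambda>_. 0)) (at x)"
    by (rule has_derivative_transform_within_open[OF has_derivative_const[of 1] open_inside[of 1]])
      (use assms w_inner in auto)
  show "grad w x $ i = 0"
    by (simp add: grad_eqI[OF D])
qed

lemma w_differentiable:
  assumes "x \<in> U - sing"
  shows "w differentiable (at x)"
  using U_split[of x] w_C1_inner(1)[of x] w_C1_outer(1)[of x] assms
  by (auto intro: differentiableI)

text \<open>Off \<open>sing\<close> the inner and outer parts are disjoint open pieces. The gradient
  is 0 on one, and a continuous expression in the radius, \<open>Rt\<close> and R1' of the angle on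
  the other.\<close>

lemma continuous_grad_w: "continuous_on (U - sing) (\<lambda>x. grad w x $ i)"
proof -
  have "continuous_on (inner_region - sing) (\<lambda>x. grad w x $ i)"
    by (rule continuous_on_eq[OF continuous_on_const[of _ 0]]) (simp add: w_C1_inner)
  moreover have "continuous_on ((U \<inter> outer_region) - sing) (\<lambda>x. grad w x $ i)"
  proof -
    let ?S = "(U \<inter> outer_region) - sing"
    have PAL: "at_polar (in_PAL \<rho> R1) x" "x \<notin> sing" "x \<noteq> 0" if "x \<in> ?S" for x
      using U_split[of x] that not_sing(1) by auto
    note pt = pal_point_at[OF PAL(2,1)]
    have cR: "continuous_on ?S Rt" "continuous_on ?S (\<lambda>x. deriv R1 (polar_angle x))"
      by (rule continuous_on_subset[OF continuous_Rt] continuous_on_subset[OF continuous_deriv_R1]; auto)+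
    have cA: "continuous_on ?S (\<lambda>x. Im (to_complex u / to_complex x))" for u
      by (rule continuous_on_subset[OF continuous_angle_derivative]) (use PAL(3) in blast)
    have "continuous_on ?S (\<lambda>x. layer_w k \<sigma>1 (Rt x) (layer_T \<rho> (norm x) (Rt x)) * layer_w_logderiv k \<sigma>1 (Rt x) (layer_T \<rho> (norm x) (Rt x))
      (Im (to_complex (axis i 1) / to_complex x) * deriv R1 (polar_angle x))
      (layer_Tr \<rho> (norm x) (Rt x) * (sgn x \<bullet> axis i 1) + layer_TR \<rho> (norm x) (Rt x) * (Im (to_complex (axis i 1) / to_complex x) * deriv R1 (polar_angle x))))"
    proof (intro continuous_on_layer_w continuous_on_layer continuous_on_add continuous_on_mult cR cA
        continuous_on_inner continuous_on_sgn continuous_on_norm continuous_on_const continuous_on_id)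
      show "\<rho> * Rt x - norm x \<noteq> 0" if "x \<in> ?S" for x
        using pal_point.r(2)[OF pt[OF that that]] by (simp add: Rt_def)
      then show "\<rho> * Rt x - norm x \<noteq> 0" "\<rho> * Rt x - norm x \<noteq> 0" if "x \<in> ?S" for x
        using that by blast+
      show "0 < Rt x + \<sigma>1 * layer_T \<rho> (norm x) (Rt x)" if "x \<in> ?S" for x
        using pal_point.denom_pos[OF pt[OF that that]] by (simp add: Rt_def)
    qed (use Rt_pos PAL in auto)
    then show ?thesis
      by (rule continuous_on_eq) (use PAL in \<open>simp add: grad_eqI[OF w_C1_outer(1)] w_deriv_def w_outer\<close>)
  qed
  ultimately have "continuous_on ((inner_region - sing) \<union> ((U \<inter> outer_region) - sing)) (\<lambda>x. grad w x $ i)"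
    using open_U sing(1) open_inside[of 1] open_outside[of 1] by (intro continuous_on_open_Un open_Diff open_Int) auto
  then show ?thesis
    by (rule continuous_on_subset) (use not_sing(3) in \<open>fastforce\<close>)
qed

end

section \<open>Bounded coefficients and the sesquilinear form\<close>

lemma bdot_matrix: "bdot (A *v a) b = bdot a (transpose A *v b)"
  by (simp add: bdot_def matrix_vector_mult_def transpose_def sum_2 algebra_simps)

lemma transpose_rot_mult: "transpose (rot \<theta>) *v (rot \<theta> *v a) = a"
proof -
  have "(of_real (cos \<theta>))\<^sup>2 + (of_real (sin \<theta>))\<^sup>2 = (1::complex)"
    by (metis of_real_1 of_real_add of_real_power sin_cos_squared_add2)
  then have *: "of_real (cos \<theta>) * (of_real (cos \<theta>) * z) + of_real (sin \<theta>) * (of_real (sin \<theta>) * z) = z" for z :: complex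
    by (metis distrib_right mult.assoc mult_1 power2_eq_square)
  show ?thesis
    using *[of "a $ 1"] *[of "a $ 2"]
    by (simp add: matrix_vector_mult_def transpose_def rot_def sum_2 vec_eq_iff forall_2 algebra_simps)
qed

lemma cnj_vec_rot: "cnj_vec (rot \<theta> *v a) = rot \<theta> *v cnj_vec a"
  by (simp add: cnj_vec_def matrix_vector_mult_def rot_def sum_2 vec_eq_iff forall_2)

lemma smult_mat_mult_vec: "smult_mat c A *v a = c *s (A *v a)"
  by (simp add: smult_mat_def matrix_vector_mult_def vec_eq_iff sum_distrib_left mult.assoc)

text \<open>The mixed terms become the \<open>p\<close> and \<open>q\<close> terms by the symmetry of \<open>B\<close>.\<close>

lemma product_form_expand:
  fixes B :: "complex^2^2" and g h b :: "complex^2"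
  assumes sym: "B $ 2 $ 1 = B $ 1 $ 2"
  shows "bdot ((rot \<theta> ** B ** transpose (rot \<theta>)) *v (w *s g + v *s (rot \<theta> *v b)))
      (cnj_vec (w *s h + \<phi> *s (rot \<theta> *v b))) =
    bdot ((rot \<theta> ** smult_mat (of_real ((cmod w)\<^sup>2)) B ** transpose (rot \<theta>)) *v g) (cnj_vec h)
    + bdot (rot \<theta> *v (w *s (B *v cnj_vec b))) g * cnj \<phi>
    + v * cnj (bdot (rot \<theta> *v cnj_vec (cnj w *s (B *v b))) h)
    + bdot (cnj_vec b) (B *v b) * v * cnj \<phi>"
proof -
  let ?R = "rot \<theta>" and ?c = "cnj_vec b"
  define u where "u = transpose ?R *v g"
  define y where "y = transpose ?R *v cnj_vec h"
  have RBR: "bdot ((?R ** A ** transpose ?R) *v a) a' = bdot (A *v (transpose ?R *v a)) (transpose ?R *v a')" for A a a'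
    by (simp add: bdot_matrix flip: matrix_vector_mul_assoc)
  have a: "transpose ?R *v (w *s g + v *s (?R *v b)) = w *s u + v *s b"
    by (simp only: matrix_vector_right_distrib vector_scalar_commute transpose_rot_mult u_def)
  have "cnj_vec (w *s h + \<phi> *s (?R *v b)) = cnj w *s cnj_vec h + cnj \<phi> *s (?R *v ?c)"
    unfolding cnj_vec_rot[symmetric] by (simp add: cnj_vec_def vec_eq_iff)
  then have a': "transpose ?R *v cnj_vec (w *s h + \<phi> *s (?R *v b)) = cnj w *s y + cnj \<phi> *s ?c"
    by (simp only: matrix_vector_right_distrib vector_scalar_commute transpose_rot_mult y_def)
  have F2: "bdot (?R *v (w *s (B *v ?c))) g = w * bdot (B *v ?c) u"
    by (simp only: bdot_matrix[of ?R] u_def[symmetric]) (simp add: bdot_def sum_2 algebra_simps)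
  have "cnj (bdot (?R *v cnj_vec (cnj w *s (B *v b))) h) = bdot (?R *v (cnj w *s (B *v b))) (cnj_vec h)"
    unfolding cnj_vec_rot[symmetric] by (simp add: bdot_def cnj_vec_def sum_2)
  also have "\<dots> = cnj w * bdot (B *v b) y"
    by (simp only: bdot_matrix[of ?R] y_def[symmetric]) (simp add: bdot_def sum_2 algebra_simps)
  finally have F3: "cnj (bdot (?R *v cnj_vec (cnj w *s (B *v b))) h) = cnj w * bdot (B *v b) y" .
  have F1: "bdot ((?R ** smult_mat (of_real ((cmod w)\<^sup>2)) B ** transpose ?R) *v g) (cnj_vec h) = w * cnj w * bdot (B *v u) y"
    by (simp only: RBR smult_mat_mult_vec u_def[symmetric] y_def[symmetric])
      (simp add: bdot_def sum_2 algebra_simps complex_norm_square[symmetric])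
  show ?thesis
    unfolding F1 F2 F3 unfolding RBR a a'
    by (simp add: bdot_def matrix_vector_mult_def sum_2 sym algebra_simps)
qed

text \<open>Membership in L-infinity of \<open>U\<close>, in a form closed under sums and
  products.\<close>

definition bounded_coeff_on :: "(real^2) set \<Rightarrow> (real^2 \<Rightarrow> complex) \<Rightarrow> bool" where
  "bounded_coeff_on U c \<longleftrightarrow> set_borel_measurable lebesgue U c \<and>
     (\<exists>C. AE x in lebesgue. x \<in> U \<longrightarrow> norm (c x) \<le> C)"

lemma bounded_coeff_mult:
  assumes "bounded_coeff_on U a" "bounded_coeff_on U b"
  shows "bounded_coeff_on U (\<lambda>x. a x * b x)"
proof -
  obtain A B where AB: "AE x in lebesgue. x \<in> U \<longrightarrow> norm (a x) \<le> A" "AE x in lebesgue. x \<in> U \<longrightarrow> norm (b x) \<le> B"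
    using assms by (auto simp: bounded_coeff_on_def)
  have "AE x in lebesgue. x \<in> U \<longrightarrow> norm (a x * b x) \<le> A * B"
    using AB by eventually_elim (auto simp: norm_mult intro!: mult_mono order_trans[OF norm_ge_zero])
  moreover have "set_borel_measurable lebesgue U (\<lambda>x. a x * b x)"
  proof -
    have "(\<lambda>x. (indicat_real U x *\<^sub>R a x) * (indicat_real U x *\<^sub>R b x)) \<in> borel_measurable lebesgue"
      using assms by (intro borel_measurable_times) (simp_all add: bounded_coeff_on_def set_borel_measurable_def)
    also have "(\<lambda>x. (indicat_real U x *\<^sub>R a x) * (indicat_real U x *\<^sub>R b x)) = (\<lambda>x. indicat_real U x *\<^sub>R (a x * b x))"
      by (auto simp: indicator_def)
    finally show ?thesis by (simp add: set_borel_measurable_def)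
  qed
  ultimately show ?thesis unfolding bounded_coeff_on_def by blast
qed

lemma bounded_coeff_add:
  assumes "bounded_coeff_on U a" "bounded_coeff_on U b"
  shows "bounded_coeff_on U (\<lambda>x. a x + b x)"
proof -
  obtain A B where AB: "AE x in lebesgue. x \<in> U \<longrightarrow> norm (a x) \<le> A" "AE x in lebesgue. x \<in> U \<longrightarrow> norm (b x) \<le> B"
    using assms by (auto simp: bounded_coeff_on_def)
  have "AE x in lebesgue. x \<in> U \<longrightarrow> norm (a x + b x) \<le> A + B"
    using AB by eventually_elim (auto intro!: norm_triangle_le add_mono)
  moreover have "set_borel_measurable lebesgue U (\<lambda>x. a x + b x)"
    using assms unfolding bounded_coeff_on_def set_borel_measurable_def scaleR_add_right
    by (intro borel_measurable_add) auto
  ultimately show ?thesis unfolding bounded_coeff_on_def by blast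
qed

lemma bounded_coeff_continuous:
  assumes U: "open U" and N: "negligible N" and c: "continuous_on (U - N) c"
    and b: "\<And>x. x \<in> U - N \<Longrightarrow> norm (c x) \<le> C"
  shows "bounded_coeff_on U c"
  unfolding bounded_coeff_on_def
proof (intro conjI exI)
  show "set_borel_measurable lebesgue U c"
    by (rule set_borel_measurable_continuous_off_negligible[OF c _ N]) (use U in auto)
  show "AE x in lebesgue. x \<in> U \<longrightarrow> norm (c x) \<le> C"
    using AE_notin_negligible[OF N] by eventually_elim (use b in auto)
qed

lemma bounded_coeff_minus: "bounded_coeff_on U a \<Longrightarrow> bounded_coeff_on U (\<lambda>x. - a x)"
  by (auto simp: bounded_coeff_on_def set_borel_measurable_def)

text \<open>The product of the moduli is at most the sum of their squares, which gives integrability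
  directly; the essentially bounded factor only scales the majorant.\<close>

lemma square_integrable_product:
  fixes f g :: "real^2 \<Rightarrow> complex"
  assumes c: "bounded_coeff_on U c" and f: "square_integrable_on U f" and g: "square_integrable_on U g"
  shows "set_integrable lebesgue U (\<lambda>x. c x * (f x * cnj (g x)))"
proof -
  obtain C where C: "AE x in lebesgue. x \<in> U \<longrightarrow> norm (c x) \<le> C" and cm: "set_borel_measurable lebesgue U c"
    using c by (auto simp: bounded_coeff_on_def)
  have fg: "set_integrable lebesgue U (\<lambda>x. f x * cnj (g x))"
  proof (rule set_integrable_bound)
    show "set_integrable lebesgue U (\<lambda>x. (norm (f x))\<^sup>2 + (norm (g x))\<^sup>2)"
      using f g by (intro set_integral_add) (simp_all add: square_integrable_on_def)
    have "(\<lambda>x. (indicat_real U x *\<^sub>R f x) * cnj (indicat_real U x *\<^sub>R g x)) \<in> borel_measurable lebesgue"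
      using f g
      by (intro borel_measurable_times measurable_compose[OF _ borel_measurable_continuous_onI[of cnj]]
          continuous_intros) (simp_all add: square_integrable_on_def set_borel_measurable_def)
    also have "(\<lambda>x. (indicat_real U x *\<^sub>R f x) * cnj (indicat_real U x *\<^sub>R g x)) = (\<lambda>x. indicat_real U x *\<^sub>R (f x * cnj (g x)))"
      by (auto simp: indicator_def)
    finally show "set_borel_measurable lebesgue U (\<lambda>x. f x * cnj (g x))"
      by (simp add: set_borel_measurable_def)
    have "norm a * norm b \<le> (norm a)\<^sup>2 + (norm b)\<^sup>2" for a b :: complex
      using sum_squares_bound[of "norm a" "norm b"] zero_le_power2[of "norm a"] zero_le_power2[of "norm b"]
        mult_nonneg_nonneg[OF norm_ge_zero[of a] norm_ge_zero[of b]] by linarith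
    then show "AE x in lebesgue. x \<in> U \<longrightarrow> norm (f x * cnj (g x)) \<le> norm ((norm (f x))\<^sup>2 + (norm (g x))\<^sup>2)"
      by (intro AE_I2) (simp add: norm_mult)
  qed
  show ?thesis
    by (rule set_integrable_mult_bounded[OF fg cm C])
qed

lemma square_integrable_nth:
  fixes g :: "real^2 \<Rightarrow> complex^2"
  assumes "square_integrable_on U g"
  shows "square_integrable_on U (\<lambda>x. g x $ i)"
proof -
  have m: "(\<lambda>x. indicat_real U x *\<^sub>R g x) \<in> borel_measurable lebesgue"
    using assms by (simp add: square_integrable_on_def set_borel_measurable_def)
  have "(\<lambda>x. (indicat_real U x *\<^sub>R g x) $ i) \<in> borel_measurable lebesgue"
    by (rule measurable_compose[OF m borel_measurable_continuous_onI]) (intro continuous_intros)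
  then have m: "set_borel_measurable lebesgue U (\<lambda>x. g x $ i)"
    by (simp add: set_borel_measurable_def)
  moreover have "set_integrable lebesgue U (\<lambda>x. (norm (g x $ i))\<^sup>2)"
  proof (rule set_integrable_bound)
    show "set_integrable lebesgue U (\<lambda>x. (norm (g x))\<^sup>2)"
      using assms by (simp add: square_integrable_on_def)
    have "(\<lambda>x. (norm (indicat_real U x *\<^sub>R g x $ i))\<^sup>2) \<in> borel_measurable lebesgue"
      by (rule borel_measurable_power[OF measurable_compose[OF m[unfolded set_borel_measurable_def] borel_measurable_norm]])
    also have "(\<lambda>x. (norm (indicat_real U x *\<^sub>R g x $ i))\<^sup>2) = (\<lambda>x. indicat_real U x *\<^sub>R (norm (g x $ i))\<^sup>2)"
      by (auto simp: indicator_def)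
    finally show "set_borel_measurable lebesgue U (\<lambda>x. (norm (g x $ i))\<^sup>2)"
      by (simp add: set_borel_measurable_def)
    show "AE x in lebesgue. x \<in> U \<longrightarrow> norm ((norm (g x $ i))\<^sup>2) \<le> norm ((norm (g x))\<^sup>2)"
      by (intro AE_I2) (simp add: Finite_Cartesian_Product.norm_nth_le power_mono)
  qed
  ultimately show ?thesis
    by (simp add: square_integrable_on_def)
qed

lemma square_integrable_AE_cong:
  fixes f g :: "real^2 \<Rightarrow> 'b::euclidean_space"
  assumes f: "square_integrable_on U f" and eq: "AE x in lebesgue. x \<in> U \<longrightarrow> f x = g x"
  shows "square_integrable_on U g"
proof -
  have "AE x in lebesgue. indicat_real U x *\<^sub>R f x = indicat_real U x *\<^sub>R g x"
    "AE x in lebesgue. indicat_real U x *\<^sub>R (norm (f x))\<^sup>2 = indicat_real U x *\<^sub>R (norm (g x))\<^sup>2"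
    using eq by (eventually_elim, auto simp: indicator_def)+
  note AE = this
  have f': "(\<lambda>x. indicat_real U x *\<^sub>R f x) \<in> borel_measurable lebesgue"
    "integrable lebesgue (\<lambda>x. indicat_real U x *\<^sub>R (norm (f x))\<^sup>2)"
    using f by (auto simp: square_integrable_on_def set_borel_measurable_def set_integrable_def)
  show ?thesis
    unfolding square_integrable_on_def set_borel_measurable_def set_integrable_def
  proof
    show "(\<lambda>x. indicat_real U x *\<^sub>R g x) \<in> borel_measurable lebesgue"
      by (rule borel_measurable_AE[OF f'(1) AE(1)])
    show "integrable lebesgue (\<lambda>x. indicat_real U x *\<^sub>R (norm (g x))\<^sup>2)"
      by (rule integrable_cong_AE_imp[OF f'(2) borel_measurable_AE[OF borel_measurable_integrable[OF f'(2)] AE(2)]])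
        (use AE(2) in \<open>eventually_elim, simp\<close>)
  qed
qed

lemma set_integral_AE_eq:
  fixes f g :: "real^2 \<Rightarrow> complex"
  assumes f: "set_integrable lebesgue U f" and eq: "AE x in lebesgue. x \<in> U \<longrightarrow> f x = g x"
  shows "(LINT x:U|lebesgue. g x) = (LINT x:U|lebesgue. f x)"
  unfolding set_lebesgue_integral_def
proof (rule integral_cong_AE[symmetric])
  have AE: "AE x in lebesgue. indicat_real U x *\<^sub>R f x = indicat_real U x *\<^sub>R g x"
    using eq by eventually_elim (auto simp: indicator_def)
  show m: "(\<lambda>x. indicat_real U x *\<^sub>R f x) \<in> borel_measurable lebesgue"
    using f by (simp add: set_integrable_def)
  from m AE show "(\<lambda>x. indicat_real U x *\<^sub>R g x) \<in> borel_measurable lebesgue"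
    by (rule borel_measurable_AE)
qed (use eq in \<open>eventually_elim, auto simp: indicator_def\<close>)

text \<open>\<open>H1\<close> provides some square integrable weak gradient, while
  \<open>weak_grad\<close> picks an arbitrary one. Uniqueness makes the two equal almost everywhere
  and transfers square integrability to the chosen one.\<close>

lemma H1_weak_grad:
  assumes U: "open U" and v: "v \<in> H1 U"
  shows "has_weak_grad U v (weak_grad U v)" "square_integrable_on U v" "square_integrable_on U (weak_grad U v)"
proof -
  obtain g where g: "has_weak_grad U v g" "square_integrable_on U g"
    using v by (auto simp: H1_def)
  show w: "has_weak_grad U v (weak_grad U v)"
    using someI[of "has_weak_grad U v", OF g(1)] by (simp add: weak_grad_def)
  show "square_integrable_on U v"
    using v by (simp add: H1_def)
  show "square_integrable_on U (weak_grad U v)"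
    by (rule square_integrable_AE_cong[OF g(2) has_weak_grad_unique[OF U g(1) w]])
qed

text \<open>Parameters \<open>(r, R1(\<theta>), R1'(\<theta>))\<close>: the coefficients of the layer are continuous functions of
  these up to and including the outer boundary \<open>r = \<rho> R1(\<theta>)\<close>.\<close>

definition layer_params :: "real \<Rightarrow> (real \<times> real \<times> real) set" where
  "layer_params \<rho> = {(r, R, d). 0 < R \<and> R \<le> r \<and> r \<le> \<rho> * R}"

definition param_E :: "real \<Rightarrow> real \<Rightarrow> real \<times> real \<times> real \<Rightarrow> real" where
  "param_E \<sigma>1 \<rho> = (\<lambda>(r, R, d). R * (\<rho> * R - r) + \<sigma>1 * (\<rho> - 1) * R * (r - R))"

definition param_t :: "real \<Rightarrow> real \<Rightarrow> real \<times> real \<times> real \<Rightarrow> complex" where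
  "param_t \<sigma>1 \<rho> = (\<lambda>(r, R, d). of_real (R * (\<rho> * R - r) / param_E \<sigma>1 \<rho> (r, R, d)))"

definition param_tau :: "real \<Rightarrow> real \<Rightarrow> real \<times> real \<times> real \<Rightarrow> complex" where
  "param_tau \<sigma>1 \<rho> = (\<lambda>(r, R, d). of_real ((\<rho> - 1) * R\<^sup>2 * (r - R) / param_E \<sigma>1 \<rho> (r, R, d)))"

definition param_beta :: "real \<Rightarrow> real \<Rightarrow> real \<Rightarrow> real \<times> real \<times> real \<Rightarrow> complex" where
  "param_beta \<sigma>0 \<sigma>1 \<rho> = (\<lambda>(r, R, d). of_real R + (pal_alpha \<sigma>0 \<sigma>1 - of_real \<sigma>1) * param_tau \<sigma>1 \<rho> (r, R, d))"

definition param_gamma1 :: "real \<Rightarrow> real \<Rightarrow> real \<times> real \<times> real \<Rightarrow> complex" where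
  "param_gamma1 \<sigma>1 \<rho> = (\<lambda>(r, R, d). of_real ((\<rho> - 1)\<^sup>2 * R ^ 4 / (param_E \<sigma>1 \<rho> (r, R, d))\<^sup>2))"

definition param_gamma2 :: "real \<Rightarrow> real \<Rightarrow> real \<times> real \<times> real \<Rightarrow> complex" where
  "param_gamma2 \<sigma>1 \<rho> = (\<lambda>(r, R, d). of_real ((1 - \<rho>) * R\<^sup>2 * d * ((R * (\<rho> * R - r) + r * (r - R)) / (param_E \<sigma>1 \<rho> (r, R, d))\<^sup>2)))"

text \<open>Both summands are nonnegative. The first vanishes only at r = \<rho> R and the second
  only at r = R, so they never vanish together. Hence the denominators stay positive at the outer
  boundary, where T itself is singular.\<close>

lemma param_E_pos:
  assumes "p \<in> layer_params \<rho>" "\<rho> > 1" "\<sigma>1 > 0"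
  shows "param_E \<sigma>1 \<rho> p > 0"
proof -
  obtain r R d where p: "p = (r, R, d)" by (cases p)
  have R: "0 < R" "R \<le> r" "r \<le> \<rho> * R"
    using assms(1) by (auto simp: p layer_params_def)
  have nonneg: "0 \<le> R * (\<rho> * R - r)" "0 \<le> \<sigma>1 * (\<rho> - 1) * R * (r - R)"
    using R assms by (auto intro!: mult_nonneg_nonneg)
  show ?thesis
  proof (cases "r = R")
    case True
    have "0 < R * (\<rho> * R - r)"
      using R assms(2) True by simp
    with nonneg show ?thesis by (simp add: param_E_def p)
  next
    case False
    then have "0 < \<sigma>1 * (\<rho> - 1) * R * (r - R)"
      using R assms by simp
    with nonneg show ?thesis by (simp add: param_E_def p)
  qed
qed

lemma continuous_param:
  assumes "\<rho> > 1" "\<sigma>1 > 0"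
  shows "continuous_on (layer_params \<rho>) (param_t \<sigma>1 \<rho>)"
    "continuous_on (layer_params \<rho>) (param_tau \<sigma>1 \<rho>)"
    "continuous_on (layer_params \<rho>) (param_beta \<sigma>0 \<sigma>1 \<rho>)"
    "continuous_on (layer_params \<rho>) (param_gamma1 \<sigma>1 \<rho>)"
    "continuous_on (layer_params \<rho>) (param_gamma2 \<sigma>1 \<rho>)"
proof -
  have E: "continuous_on (layer_params \<rho>) (param_E \<sigma>1 \<rho>)"
    unfolding param_E_def split_def by (intro continuous_intros)
  have nz: "param_E \<sigma>1 \<rho> p \<noteq> 0" if "p \<in> layer_params \<rho>" for p
    using param_E_pos[OF that assms] by simp
  show "continuous_on (layer_params \<rho>) (param_t \<sigma>1 \<rho>)"
    unfolding param_t_def split_def prod.collapse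
    using nz by (intro continuous_intros E) auto
  show tau: "continuous_on (layer_params \<rho>) (param_tau \<sigma>1 \<rho>)"
    unfolding param_tau_def split_def prod.collapse
    using nz by (intro continuous_intros E) auto
  show "continuous_on (layer_params \<rho>) (param_beta \<sigma>0 \<sigma>1 \<rho>)"
    unfolding param_beta_def split_def prod.collapse
    by (intro continuous_intros tau)
  show "continuous_on (layer_params \<rho>) (param_gamma1 \<sigma>1 \<rho>)"
    unfolding param_gamma1_def split_def prod.collapse
    using nz by (intro continuous_intros E) auto
  show "continuous_on (layer_params \<rho>) (param_gamma2 \<sigma>1 \<rho>)"
    unfolding param_gamma2_def split_def prod.collapse
    using nz by (intro continuous_intros E) auto
qed

text \<open>Since \<alpha> - \<sigma>1 is purely imaginary and \<tau> is real, the real part of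
  \<beta> is R. The function \<gamma>1 is a quotient of positive reals.\<close>

lemma param_nonzero:
  assumes "p \<in> layer_params \<rho>" "\<rho> > 1" "\<sigma>1 > 0"
  shows "param_beta \<sigma>0 \<sigma>1 \<rho> p \<noteq> 0" "param_gamma1 \<sigma>1 \<rho> p \<noteq> 0" "fst p \<noteq> 0" "fst (snd p) \<noteq> 0"
proof -
  obtain r R d where p: "p = (r, R, d)" by (cases p)
  have R: "0 < R" "R \<le> r" using assms(1) by (auto simp: p layer_params_def)
  have "Re (param_beta \<sigma>0 \<sigma>1 \<rho> p) = R"
    by (simp add: param_beta_def p pal_alpha_def param_tau_def)
  with R show "param_beta \<sigma>0 \<sigma>1 \<rho> p \<noteq> 0" by auto
  show "param_gamma1 \<sigma>1 \<rho> p \<noteq> 0"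
    using R assms(2) param_E_pos[OF assms] by (simp add: param_gamma1_def p)
  show "fst p \<noteq> 0" "fst (snd p) \<noteq> 0" using R by (auto simp: p)
qed

section \<open>Essential boundedness of the transformed coefficients\<close>

context pal_domain begin

text \<open>The parameters of all layer points off \<open>sing\<close> lie in one compact subset of
  \<open>layer_params\<close>, on which the continuous \<open>G\<close> is bounded. Together with
  the constant inner value this bounds the coefficient on \<open>U\<close> off a null set.\<close>

lemma bounded_coeff_layer:
  fixes c :: "real^2 \<Rightarrow> complex" and G :: "real \<times> real \<times> real \<Rightarrow> complex"
  assumes G: "continuous_on (layer_params \<rho>) G"
    and inner: "\<And>x. \<lbrakk>x \<notin> sing; norm x < Rt x\<rbrakk> \<Longrightarrow> c x = ci"
    and outer: "\<And>x. \<lbrakk>x \<notin> sing; at_polar (in_PAL \<rho> R1) x\<rbrakk> \<Longrightarrow> c x = G (norm x, Rt x, deriv R1 (polar_angle x))"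
  shows "bounded_coeff_on U c"
proof -
  obtain m M' where m: "m > 0" "\<And>\<theta>. m \<le> R1 \<theta>" "\<And>\<theta>. R1 \<theta> \<le> M'"
    using R1_bounds by metis
  let ?p = "\<lambda>x. (norm x, Rt x, deriv R1 (polar_angle x))"
  \<comment> \<open>The closed constraints include r = R and r = \<rho> R; the third coordinate is
    confined by the uniform bound \<open>M\<close> on the derivative of \<open>R1\<close>.\<close>
  define Q where "Q = {p::real \<times> real \<times> real. m \<le> fst (snd p) \<and> fst (snd p) \<le> M' \<and> fst (snd p) \<le> fst p \<and>
      fst p \<le> \<rho> * fst (snd p) \<and> - M \<le> snd (snd p) \<and> snd (snd p) \<le> M}"
  have "Q \<subseteq> {0..\<rho> * M'} \<times> {m..M'} \<times> {- M..M}"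
  proof
    fix p assume p: "p \<in> Q"
    have "\<rho> * fst (snd p) \<le> \<rho> * M'"
      using p \<rho> by (simp add: Q_def)
    with p m(1) show "p \<in> {0..\<rho> * M'} \<times> {m..M'} \<times> {- M..M}"
      by (cases p) (auto simp: Q_def)
  qed
  then have "bounded Q"
    by (rule bounded_subset[rotated]) (intro bounded_Times bounded_closed_interval)
  moreover have "closed Q"
    unfolding Q_def by (intro closed_Collect_conj closed_Collect_le continuous_intros)
  ultimately have "compact Q"
    by (simp add: compact_eq_bounded_closed)
  moreover have Q: "Q \<subseteq> layer_params \<rho>"
    using m(1) by (auto simp: Q_def layer_params_def)
  ultimately have "bounded (G ` Q)"
    by (intro compact_imp_bounded compact_continuous_image continuous_on_subset[OF G])
  then obtain B where B: "\<And>p. p \<in> Q \<Longrightarrow> norm (G p) \<le> B"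
    by (auto simp: bounded_iff)
  let ?S = "(U \<inter> outer_region) - sing"
  have PAL: "at_polar (in_PAL \<rho> R1) x" "x \<notin> sing" if "x \<in> ?S" for x
    using U_split[of x] that by auto
  have inQ: "?p x \<in> Q" if "x \<notin> sing" "at_polar (in_PAL \<rho> R1) x" for x
    using that m not_sing(5)[OF that(1)] by (auto simp: Q_def Rt_def at_polar_def in_PAL_def)
  have cp: "continuous_on ?S ?p"
    by (intro continuous_on_Pair continuous_on_norm continuous_on_id
        continuous_on_subset[OF continuous_Rt] continuous_on_subset[OF continuous_deriv_R1]) auto
  have "continuous_on ?S (\<lambda>x. G (?p x))"
    by (rule continuous_on_compose2[OF G cp]) (use inQ PAL Q in blast)
  then have "continuous_on ?S c"
    by (rule continuous_on_eq) (use outer PAL in auto)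
  moreover have "continuous_on (inner_region - sing) c"
    by (rule continuous_on_eq[OF continuous_on_const[of _ ci]]) (use inner in auto)
  ultimately have "continuous_on ((inner_region - sing) \<union> ?S) c"
    using open_U sing(1) open_inside[of 1] open_outside[of 1] by (intro continuous_on_open_Un open_Diff open_Int) auto
  then have "continuous_on (U - sing) c"
    by (rule continuous_on_subset) (use not_sing(3) in \<open>fastforce\<close>)
  moreover have "norm (c x) \<le> max (norm ci) B" if "x \<in> U - sing" for x
    using U_split[of x] that inner[of x] outer[of x] B[OF inQ, of x] by (auto simp: le_max_iff_disj)
  ultimately show ?thesis
    by (intro bounded_coeff_continuous[OF open_U sing(2)])
qed

lemma bounded_coeff_angle:
  "bounded_coeff_on U (\<lambda>x. of_real (cos (polar_angle x)))"
  "bounded_coeff_on U (\<lambda>x. of_real (sin (polar_angle x)))"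
proof -
  have c: "continuous_on (U - sing) polar_angle"
    by (rule continuous_at_imp_continuous_on) (use not_sing(2) isCont_polar_angle in auto)
  show "bounded_coeff_on U (\<lambda>x. of_real (cos (polar_angle x)))"
    "bounded_coeff_on U (\<lambda>x. of_real (sin (polar_angle x)))"
    by (rule bounded_coeff_continuous[OF open_U sing(2), where C=1]; auto intro!: continuous_intros c)+
qed

lemma inner_at:
  assumes "x \<notin> sing" "norm x < Rt x"
  shows "at_polar (Bbreve k \<sigma>0 \<sigma>1 \<rho> R1) x = mat 1" "at_polar (pvec k \<sigma>0 \<sigma>1 \<rho> R1) x = 0"
    "at_polar (qvec k \<sigma>0 \<sigma>1 \<rho> R1) x = 0" "at_polar (nbreve k \<sigma>0 \<sigma>1 \<rho> R1) x = - of_real (k\<^sup>2)"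
    "at_polar (pal_n \<sigma>0 \<sigma>1 \<rho> R1) x = 1" "w_grad x = 0"
proof -
  have "0 < norm x" "norm x < R1 (polar_angle x)"
    using assms not_sing(1) by (auto simp: Rt_def)
  note inner = inner_coefficients[OF this R1_isCont]
  show "at_polar (Bbreve k \<sigma>0 \<sigma>1 \<rho> R1) x = mat 1" "at_polar (pvec k \<sigma>0 \<sigma>1 \<rho> R1) x = 0"
    "at_polar (qvec k \<sigma>0 \<sigma>1 \<rho> R1) x = 0" "at_polar (nbreve k \<sigma>0 \<sigma>1 \<rho> R1) x = - of_real (k\<^sup>2)"
    "at_polar (pal_n \<sigma>0 \<sigma>1 \<rho> R1) x = 1" "w_grad x = 0"
    by (simp_all add: at_polar_def w_grad_def inner)
qed

lemma outer_at:
  assumes x: "x \<notin> sing" "at_polar (in_PAL \<rho> R1) x"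
  defines "y \<equiv> (norm x, Rt x, deriv R1 (polar_angle x))"
  shows "complex_of_real (pal_t \<sigma>1 \<rho> R1 (norm x) (polar_angle x)) = param_t \<sigma>1 \<rho> y"
    "complex_of_real (pal_tau \<sigma>1 \<rho> R1 (norm x) (polar_angle x)) = param_tau \<sigma>1 \<rho> y"
    "pal_beta \<sigma>0 \<sigma>1 \<rho> R1 (norm x) (polar_angle x) = param_beta \<sigma>0 \<sigma>1 \<rho> y"
    "complex_of_real (pal_gamma1 \<sigma>1 \<rho> R1 (norm x) (polar_angle x)) = param_gamma1 \<sigma>1 \<rho> y"
    "complex_of_real (pal_gamma2 \<sigma>1 \<rho> R1 (norm x) (polar_angle x)) = param_gamma2 \<sigma>1 \<rho> y"
proof -
  have P: "in_PAL \<rho> R1 (norm x) (polar_angle x)" using x by (simp add: at_polar_def)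
  show "complex_of_real (pal_t \<sigma>1 \<rho> R1 (norm x) (polar_angle x)) = param_t \<sigma>1 \<rho> y"
    "complex_of_real (pal_tau \<sigma>1 \<rho> R1 (norm x) (polar_angle x)) = param_tau \<sigma>1 \<rho> y"
    "pal_beta \<sigma>0 \<sigma>1 \<rho> R1 (norm x) (polar_angle x) = param_beta \<sigma>0 \<sigma>1 \<rho> y"
    "complex_of_real (pal_gamma1 \<sigma>1 \<rho> R1 (norm x) (polar_angle x)) = param_gamma1 \<sigma>1 \<rho> y"
    "complex_of_real (pal_gamma2 \<sigma>1 \<rho> R1 (norm x) (polar_angle x)) = param_gamma2 \<sigma>1 \<rho> y"
    by (simp_all add: y_def Rt_def pal_t_eq[OF P] param_t_def param_tau_def param_beta_def param_gamma1_def param_gamma2_def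
        pal_E_def param_E_def pal_tau_def pal_beta_def pal_gamma1_def pal_gamma2_def)
qed

lemma alpha_nonzero: "pal_alpha \<sigma>0 \<sigma>1 \<noteq> 0"
  using \<sigma>1 by (simp add: pal_alpha_def complex_eq_iff)

text \<open>In the closed forms only \<alpha>, \<beta>, \<gamma>1, r and R occur in denominators,
  and none of them vanishes on \<open>layer_params\<close>.\<close>

lemma bounded_coefficients:
  "bounded_coeff_on U (\<lambda>x. at_polar (Bbreve k \<sigma>0 \<sigma>1 \<rho> R1) x $ i $ j)"
  "bounded_coeff_on U (\<lambda>x. at_polar (pvec k \<sigma>0 \<sigma>1 \<rho> R1) x $ i)"
  "bounded_coeff_on U (\<lambda>x. at_polar (qvec k \<sigma>0 \<sigma>1 \<rho> R1) x $ i)"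
  "bounded_coeff_on U (\<lambda>x. at_polar (nbreve k \<sigma>0 \<sigma>1 \<rho> R1) x)"
proof -
  let ?\<alpha> = "pal_alpha \<sigma>0 \<sigma>1" and ?\<beta> = "param_beta \<sigma>0 \<sigma>1 \<rho>" and ?t = "param_t \<sigma>1 \<rho>" and ?\<tau> = "param_tau \<sigma>1 \<rho>"
    and ?g1 = "param_gamma1 \<sigma>1 \<rho>" and ?g2 = "param_gamma2 \<sigma>1 \<rho>"
    and ?r = "\<lambda>p. complex_of_real (fst p)" and ?R = "\<lambda>p. complex_of_real (fst (snd p))"
    and ?R' = "\<lambda>p. complex_of_real (snd (snd p))" and ?s = "complex_of_real \<sigma>1"
  note nz = param_nonzero[OF _ \<rho> \<sigma>1] alpha_nonzero
  note cont = continuous_param[OF \<rho> \<sigma>1]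
  {
    fix x assume x: "x \<notin> sing" "at_polar (in_PAL \<rho> R1) x"
    note pal_point.layer_coefficients[OF pal_point_at[OF x], of k, unfolded Let_def outer_at[OF x]]
  }
  note outer = this
  have B: "bounded_coeff_on U (\<lambda>x. at_polar (Bbreve k \<sigma>0 \<sigma>1 \<rho> R1) x $ 1 $ 1)"
    "bounded_coeff_on U (\<lambda>x. at_polar (Bbreve k \<sigma>0 \<sigma>1 \<rho> R1) x $ 1 $ 2)"
    "bounded_coeff_on U (\<lambda>x. at_polar (Bbreve k \<sigma>0 \<sigma>1 \<rho> R1) x $ 2 $ 1)"
    "bounded_coeff_on U (\<lambda>x. at_polar (Bbreve k \<sigma>0 \<sigma>1 \<rho> R1) x $ 2 $ 2)"
  proof -
    show "bounded_coeff_on U (\<lambda>x. at_polar (Bbreve k \<sigma>0 \<sigma>1 \<rho> R1) x $ 1 $ 1)"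
      by (rule bounded_coeff_layer[where ci=1 and G="\<lambda>p. ?\<beta> p * (?t p)\<^sup>2 / (?\<alpha> * ?g1 p * ?r p) * ((?t p)\<^sup>2 + (?R' p * (?t p)\<^sup>2 + ?\<alpha> * ?g2 p)\<^sup>2 / (?\<beta> p)\<^sup>2)"])
       (use nz in \<open>auto intro!: continuous_intros cont simp: inner_at mat_def, auto simp: at_polar_def outer Rt_def\<close>)
    have 12: "bounded_coeff_on U (\<lambda>x. at_polar (Bbreve k \<sigma>0 \<sigma>1 \<rho> R1) x $ i $ j)"
      if "(i, j) = (1, 2) \<or> (i, j) = (2, 1)" for i j :: 2
      by (rule bounded_coeff_layer[where ci=0 and G="\<lambda>p. - (?R' p * (?t p)\<^sup>2 + ?\<alpha> * ?g2 p) * ((?t p)\<^sup>2 / ?\<beta> p)"])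
       (use nz that in \<open>auto intro!: continuous_intros cont simp: inner_at mat_def, auto simp: at_polar_def outer Rt_def\<close>)
    show "bounded_coeff_on U (\<lambda>x. at_polar (Bbreve k \<sigma>0 \<sigma>1 \<rho> R1) x $ 1 $ 2)"
      "bounded_coeff_on U (\<lambda>x. at_polar (Bbreve k \<sigma>0 \<sigma>1 \<rho> R1) x $ 2 $ 1)"
      by (rule 12, simp)+
    show "bounded_coeff_on U (\<lambda>x. at_polar (Bbreve k \<sigma>0 \<sigma>1 \<rho> R1) x $ 2 $ 2)"
      by (rule bounded_coeff_layer[where ci=1 and G="\<lambda>p. ?\<alpha> * ?g1 p * ?r p / ?\<beta> p * (?t p)\<^sup>2"])
       (use nz in \<open>auto intro!: continuous_intros cont simp: inner_at mat_def, auto simp: at_polar_def outer Rt_def\<close>)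
  qed
  then show "bounded_coeff_on U (\<lambda>x. at_polar (Bbreve k \<sigma>0 \<sigma>1 \<rho> R1) x $ i $ j)"
    using exhaust_2[of i] exhaust_2[of j] by auto
  let ?f1 = "\<lambda>z p. - (?\<beta> p * ?s / (?\<alpha> * ?r p)) * (3 * ?t p / (2 * ?R p) + z) * (?t p)\<^sup>2
                     - (3 * ?R' p * ?s / (2 * ?r p * ?R p * ?\<alpha> * ?\<beta> p) * (?t p + ?\<alpha> * ?\<tau> p / ?R p)
                        + z * ?s * ?R' p / (?r p * ?\<alpha> * ?\<beta> p)) * (?R' p * (?t p)\<^sup>2 + ?\<alpha> * ?g2 p) * (?t p)\<^sup>2"
  let ?f2 = "\<lambda>z p. 3 * ?R' p * ?g1 p * ?s / (2 * ?R p * ?\<beta> p) * (?t p + ?\<alpha> * ?\<tau> p / ?R p) * (?t p)\<^sup>2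
                     + z * ?s * (?R' p * ?g1 p / ?\<beta> p) * (?t p)\<^sup>2"
  have f: "continuous_on (layer_params \<rho>) (?f1 z)" "continuous_on (layer_params \<rho>) (?f2 z)" for z
    using nz by (auto intro!: continuous_intros cont)
  have p: "bounded_coeff_on U (\<lambda>x. at_polar (pvec k \<sigma>0 \<sigma>1 \<rho> R1) x $ 1)"
    "bounded_coeff_on U (\<lambda>x. at_polar (pvec k \<sigma>0 \<sigma>1 \<rho> R1) x $ 2)"
    by (rule bounded_coeff_layer[OF f(1)[of "\<i> * of_real k"], where ci=0],
        simp add: inner_at, simp add: at_polar_def outer Rt_def)
      (rule bounded_coeff_layer[OF f(2)[of "\<i> * of_real k"], where ci=0],
        simp add: inner_at, simp add: at_polar_def outer Rt_def)
  then show "bounded_coeff_on U (\<lambda>x. at_polar (pvec k \<sigma>0 \<sigma>1 \<rho> R1) x $ i)"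
    using exhaust_2[of i] by auto
  have q: "bounded_coeff_on U (\<lambda>x. at_polar (qvec k \<sigma>0 \<sigma>1 \<rho> R1) x $ 1)"
    "bounded_coeff_on U (\<lambda>x. at_polar (qvec k \<sigma>0 \<sigma>1 \<rho> R1) x $ 2)"
    by (rule bounded_coeff_layer[OF f(1)[of "- \<i> * of_real k"], where ci=0],
        simp add: inner_at, simp add: at_polar_def outer Rt_def)
      (rule bounded_coeff_layer[OF f(2)[of "- \<i> * of_real k"], where ci=0],
        simp add: inner_at, simp add: at_polar_def outer Rt_def)
  then show "bounded_coeff_on U (\<lambda>x. at_polar (qvec k \<sigma>0 \<sigma>1 \<rho> R1) x $ i)"
    using exhaust_2[of i] by auto
  let ?K = "complex_of_real k"
  let ?f3 = "\<lambda>p. ?K\<^sup>2 * (?\<beta> p * ?s\<^sup>2 / ?\<alpha> - ?\<alpha> * ?\<beta> p + ?s\<^sup>2 * (?R' p)\<^sup>2 * (?t p)\<^sup>2 / (?\<alpha> * ?\<beta> p)) * (?g1 p / ?r p)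
              + 9 * ?g1 p * ?s\<^sup>2 * (?t p)\<^sup>2 / (4 * ?r p * (?R p)\<^sup>2)
                * (?\<beta> p / ?\<alpha> + (?R' p)\<^sup>2 / (?\<alpha> * ?\<beta> p * (?R p)\<^sup>2) * (?R p * ?t p + ?\<alpha> * ?\<tau> p)\<^sup>2)"
  have "continuous_on (layer_params \<rho>) ?f3"
    using nz by (auto intro!: continuous_intros cont)
  then show "bounded_coeff_on U (\<lambda>x. at_polar (nbreve k \<sigma>0 \<sigma>1 \<rho> R1) x)"
    by (rule bounded_coeff_layer[where ci="- of_real (k\<^sup>2)"]) (simp add: inner_at, simp add: at_polar_def outer Rt_def)
qed

text \<open>In the layer t^3 S S_r = \<alpha> (t S) (t^2 T_r), so the weighted coefficient equals
  \<alpha> \<beta> \<gamma>1 / r.\<close>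

lemma bounded_coeff_n_w2: "bounded_coeff_on U (\<lambda>x. at_polar (pal_n \<sigma>0 \<sigma>1 \<rho> R1) x * of_real ((cmod (w x))\<^sup>2))"
proof -
  let ?G = "\<lambda>p. pal_alpha \<sigma>0 \<sigma>1 * param_beta \<sigma>0 \<sigma>1 \<rho> p * param_gamma1 \<sigma>1 \<rho> p / complex_of_real (fst p)"
  have "continuous_on (layer_params \<rho>) ?G"
    using param_nonzero[OF _ \<rho> \<sigma>1] by (auto intro!: continuous_intros continuous_param[OF \<rho> \<sigma>1])
  then show ?thesis
  proof (rule bounded_coeff_layer[where ci=1])
    show "at_polar (pal_n \<sigma>0 \<sigma>1 \<rho> R1) x * of_real ((cmod (w x))\<^sup>2) = 1" if "x \<notin> sing" "norm x < Rt x" for x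
      using that by (simp add: inner_at w_inner)
    fix x assume x: "x \<notin> sing" "at_polar (in_PAL \<rho> R1) x"
    interpret pt: pal_point k \<sigma>0 \<sigma>1 \<rho> "norm x" "polar_angle x" R1
      by (rule pal_point_at[OF x])
    have "(cmod (w x))\<^sup>2 = pt.t ^ 3"
      using pt.r(1) cmod_layer_w_power2[OF pt.R_pos pt.denom_pos] by (simp add: w_outer Rt_def)
    then have "at_polar (pal_n \<sigma>0 \<sigma>1 \<rho> R1) x * of_real ((cmod (w x))\<^sup>2) =
        (of_real (R1 (polar_angle x)) + pt.\<alpha> * of_real pt.T) * (pt.\<alpha> * of_real pt.Tr) / of_real (norm x) * of_real (pt.t ^ 3)"
      using pt.r(1) by (simp add: at_polar_def pal_n_def pal_S_layer pt.S_derivs)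
    also have "\<dots> = pt.\<alpha> * pal_beta \<sigma>0 \<sigma>1 \<rho> R1 (norm x) (polar_angle x) * of_real (pal_gamma1 \<sigma>1 \<rho> R1 (norm x) (polar_angle x)) / of_real (norm x)"
      by (simp add: pt.pal_aux_layer power2_eq_square power3_eq_cube mult_ac)
    finally show "at_polar (pal_n \<sigma>0 \<sigma>1 \<rho> R1) x * of_real ((cmod (w x))\<^sup>2) = ?G (norm x, Rt x, deriv R1 (polar_angle x))"
      by (simp add: outer_at[OF x])
  qed
qed

text \<open>The product rule exhibits a weak gradient of w v, so the choice in
  \<open>weak_grad\<close> is meaningful, and uniqueness identifies it almost everywhere.\<close>

lemma weak_grad_w_mult:
  assumes "has_weak_grad U v (weak_grad U v)"
  shows "AE x in lebesgue. x \<in> U \<longrightarrow> weak_grad U (\<lambda>y. w y * v y) x = w x *s weak_grad U v x + v x *s w_grad x"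
proof -
  have g: "has_weak_grad U (\<lambda>y. w y * v y) (\<lambda>x. w x *s weak_grad U v x + v x *s grad w x)"
    by (rule has_weak_grad_mult[OF open_U assms locally_lipschitz_w sing w_differentiable continuous_grad_w])
  have "has_weak_grad U (\<lambda>y. w y * v y) (weak_grad U (\<lambda>y. w y * v y))"
    using someI[of "has_weak_grad U (\<lambda>y. w y * v y)", OF g] by (simp add: weak_grad_def)
  from has_weak_grad_unique[OF open_U this g] AE_notin_negligible[OF sing(2)]
  show ?thesis
  proof eventually_elim
    case (elim x)
    have "grad w x = w_grad x" if "x \<in> U"
      using U_split[OF that elim(2)] w_C1_outer(2)[OF elim(2)] w_C1_inner(2)[of x] inner_at(6)[OF elim(2)]
      by (auto simp: vec_eq_iff)
    with elim show ?case by simp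
  qed
qed

text \<open>The definitions differentiate the conjugate of \<open>w\<close>, whereas the expanded
  form contains the conjugate of the gradient of \<open>w\<close>. The two agree at points of
  \<open>U\<close> off \<open>sing\<close>.\<close>

lemma nbreve_split:
  assumes "x \<in> U" "x \<notin> sing"
  shows "at_polar (nbreve k \<sigma>0 \<sigma>1 \<rho> R1) x =
      bdot (cnj_vec (at_polar (polar_grad (pal_w k \<sigma>1 \<rho> R1)) x))
        (at_polar (pal_B \<sigma>0 \<sigma>1 \<rho> R1) x *v at_polar (polar_grad (pal_w k \<sigma>1 \<rho> R1)) x)
      - of_real (k\<^sup>2) * (at_polar (pal_n \<sigma>0 \<sigma>1 \<rho> R1) x * of_real ((cmod (w x))\<^sup>2))"
    "at_polar (pvec k \<sigma>0 \<sigma>1 \<rho> R1) x = w x *s (at_polar (pal_B \<sigma>0 \<sigma>1 \<rho> R1) x *v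
        cnj_vec (at_polar (polar_grad (pal_w k \<sigma>1 \<rho> R1)) x))"
proof -
  have "polar_grad (\<lambda>s \<phi>. cnj (pal_w k \<sigma>1 \<rho> R1 s \<phi>)) (norm x) (polar_angle x) =
      cnj_vec (at_polar (polar_grad (pal_w k \<sigma>1 \<rho> R1)) x)"
    using U_split[OF assms]
  proof (elim disjE conjE)
    assume "x \<in> inner_region"
    then have "0 < norm x" "norm x < R1 (polar_angle x)"
      using not_sing(1)[OF assms(2)] by (auto simp: Rt_def)
    note inner = inner_coefficients(7,8)[OF this R1_isCont]
    show ?thesis
      by (simp add: inner at_polar_def cnj_vec_def vec_eq_iff)
  next
    assume "at_polar (in_PAL \<rho> R1) x"
    then interpret pt: pal_point k \<sigma>0 \<sigma>1 \<rho> "norm x" "polar_angle x" R1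
      by (rule pal_point_at[OF assms(2)])
    show ?thesis
      by (simp add: pt.polar_grad_w at_polar_def cnj_vec_def vec_eq_iff forall_2)
  qed
  then show "at_polar (nbreve k \<sigma>0 \<sigma>1 \<rho> R1) x =
      bdot (cnj_vec (at_polar (polar_grad (pal_w k \<sigma>1 \<rho> R1)) x))
        (at_polar (pal_B \<sigma>0 \<sigma>1 \<rho> R1) x *v at_polar (polar_grad (pal_w k \<sigma>1 \<rho> R1)) x)
      - of_real (k\<^sup>2) * (at_polar (pal_n \<sigma>0 \<sigma>1 \<rho> R1) x * of_real ((cmod (w x))\<^sup>2))"
    "at_polar (pvec k \<sigma>0 \<sigma>1 \<rho> R1) x = w x *s (at_polar (pal_B \<sigma>0 \<sigma>1 \<rho> R1) x *v
        cnj_vec (at_polar (polar_grad (pal_w k \<sigma>1 \<rho> R1)) x))"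
    by (simp_all add: at_polar_def nbreve_def pvec_def)
qed

text \<open>The four terms and the mass term are integrable on their own, each being a bounded
  coefficient times a product of square integrable functions. The original integrand inherits its
  integral from their sum through equality almost everywhere.\<close>

lemma form_identity:
  assumes v: "v \<in> H1 U" and \<phi>: "\<phi> \<in> H1 U"
  shows "pal_form k \<sigma>0 \<sigma>1 \<rho> R1 D v \<phi> =
      L2_inner_vec U (\<lambda>x. (rot (polar_angle x) ** at_polar (Bbreve k \<sigma>0 \<sigma>1 \<rho> R1) x ** transpose (rot (polar_angle x))) *v weak_grad U v x) (weak_grad U \<phi>)
    + L2_inner U (\<lambda>x. bdot (rot (polar_angle x) *v at_polar (pvec k \<sigma>0 \<sigma>1 \<rho> R1) x) (weak_grad U v x)) \<phi>
    + L2_inner U v (\<lambda>x. bdot (rot (polar_angle x) *v cnj_vec (at_polar (qvec k \<sigma>0 \<sigma>1 \<rho> R1) x)) (weak_grad U \<phi> x))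
    + L2_inner U (\<lambda>x. at_polar (nbreve k \<sigma>0 \<sigma>1 \<rho> R1) x * v x) \<phi>"
proof -
  note v = H1_weak_grad[OF open_U v] and \<phi> = H1_weak_grad[OF open_U \<phi>]
  let ?g = "weak_grad U v" and ?h = "weak_grad U \<phi>" and ?R = "\<lambda>x. rot (polar_angle x)"
  let ?Bb = "at_polar (Bbreve k \<sigma>0 \<sigma>1 \<rho> R1)" and ?p = "at_polar (pvec k \<sigma>0 \<sigma>1 \<rho> R1)"
    and ?q = "at_polar (qvec k \<sigma>0 \<sigma>1 \<rho> R1)" and ?nb = "at_polar (nbreve k \<sigma>0 \<sigma>1 \<rho> R1)"
    and ?n = "at_polar (pal_n \<sigma>0 \<sigma>1 \<rho> R1)" and ?C = "at_polar (pal_C \<sigma>0 \<sigma>1 \<rho> R1)"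
  define F1 where "F1 x = bdot ((?R x ** ?Bb x ** transpose (?R x)) *v ?g x) (cnj_vec (?h x))" for x
  define F2 where "F2 x = bdot (?R x *v ?p x) (?g x) * cnj (\<phi> x)" for x
  define F3 where "F3 x = v x * cnj (bdot (?R x *v cnj_vec (?q x)) (?h x))" for x
  define F4 where "F4 x = ?nb x * v x * cnj (\<phi> x)" for x
  \<comment> \<open>\<open>F4\<close> already contains the mass term with the factor -k^2. Adding
    \<open>k^2\<close> times \<open>N0\<close> removes it, so that the sum matches the pure gradient
    integrand \<open>A\<close>.\<close>
  define N0 where "N0 x = ?n x * of_real ((cmod (w x))\<^sup>2) * v x * cnj (\<phi> x)" for x
  define A where "A x = bdot (?C x *v weak_grad U (\<lambda>y. w y * v y) x) (cnj_vec (weak_grad U (\<lambda>y. w y * \<phi> y) x))" for x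
  have gi: "square_integrable_on U (\<lambda>x. ?g x $ i)" and hi: "square_integrable_on U (\<lambda>x. ?h x $ i)" for i
    using v(3) \<phi>(3) by (auto intro: square_integrable_nth)
  have R: "bounded_coeff_on U (\<lambda>x. ?R x $ i $ j)" for i j
    using exhaust_2[of i] exhaust_2[of j] bounded_coeff_angle bounded_coeff_minus[OF bounded_coeff_angle(2)]
    by (auto simp: rot_def)
  have RBR: "bounded_coeff_on U (\<lambda>x. (?R x ** ?Bb x ** transpose (?R x)) $ i $ j)" for i j
    unfolding matrix_matrix_mult_def transpose_def sum_2
    by (simp add: sum_2) (intro bounded_coeff_add bounded_coeff_mult R bounded_coefficients)
  have Rp: "bounded_coeff_on U (\<lambda>x. (?R x *v ?p x) $ i)" "bounded_coeff_on U (\<lambda>x. (?R x *v ?q x) $ i)" for i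
    unfolding matrix_vector_mult_def sum_2
    by (simp_all add: sum_2) (intro bounded_coeff_add bounded_coeff_mult R bounded_coefficients)+
  have "set_integrable lebesgue U (\<lambda>x. \<Sum>i\<in>UNIV. \<Sum>j\<in>UNIV. (?R x ** ?Bb x ** transpose (?R x)) $ i $ j * (?g x $ j * cnj (?h x $ i)))"
    unfolding sum_2 by (intro set_integral_add square_integrable_product RBR gi hi)
  also have "(\<lambda>x. \<Sum>i\<in>UNIV. \<Sum>j\<in>UNIV. (?R x ** ?Bb x ** transpose (?R x)) $ i $ j * (?g x $ j * cnj (?h x $ i))) = F1"
    by (simp add: fun_eq_iff F1_def bdot_def cnj_vec_def matrix_vector_mult_def[of "_ ** _"] sum_distrib_right mult.assoc)
  finally have F1: "set_integrable lebesgue U F1" .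
  have "set_integrable lebesgue U (\<lambda>x. \<Sum>i\<in>UNIV. (?R x *v ?p x) $ i * (?g x $ i * cnj (\<phi> x)))"
    unfolding sum_2 by (intro set_integral_add square_integrable_product Rp gi \<phi>)
  also have "(\<lambda>x. \<Sum>i\<in>UNIV. (?R x *v ?p x) $ i * (?g x $ i * cnj (\<phi> x))) = F2"
    by (simp add: fun_eq_iff F2_def bdot_def sum_distrib_right mult.assoc)
  finally have F2: "set_integrable lebesgue U F2" .
  have "set_integrable lebesgue U (\<lambda>x. \<Sum>i\<in>UNIV. (?R x *v ?q x) $ i * (v x * cnj (?h x $ i)))"
    unfolding sum_2 by (intro set_integral_add square_integrable_product Rp hi v)
  also have "(\<lambda>x. \<Sum>i\<in>UNIV. (?R x *v ?q x) $ i * (v x * cnj (?h x $ i))) = F3"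
    unfolding F3_def cnj_vec_rot[symmetric]
    by (simp add: fun_eq_iff bdot_def cnj_vec_def sum_distrib_left mult.left_commute)
  finally have F3: "set_integrable lebesgue U F3" .
  have F4: "set_integrable lebesgue U F4"
    using square_integrable_product[OF bounded_coefficients(4) v(2) \<phi>(2)] by (simp add: F4_def[abs_def] mult.assoc)
  have N0: "set_integrable lebesgue U N0"
    using square_integrable_product[OF bounded_coeff_n_w2 v(2) \<phi>(2)] by (simp add: N0_def[abs_def] mult.assoc)
  have kN0: "set_integrable lebesgue U (\<lambda>x. of_real (k\<^sup>2) * N0 x)"
    using N0 by (rule set_integrable_mult_right[rotated])
  have "AE x in lebesgue. x \<in> U \<longrightarrow> F1 x + F2 x + F3 x + F4 x + of_real (k\<^sup>2) * N0 x = A x"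
    using weak_grad_w_mult[OF v(1)] weak_grad_w_mult[OF \<phi>(1)] AE_notin_negligible[OF sing(2)]
  proof eventually_elim
    case (elim x)
    show ?case
    proof
      assume x: "x \<in> U"
      let ?B = "at_polar (pal_B \<sigma>0 \<sigma>1 \<rho> R1) x" and ?b = "at_polar (polar_grad (pal_w k \<sigma>1 \<rho> R1)) x"
      have sym: "?B $ 2 $ 1 = ?B $ 1 $ 2"
        by (simp add: at_polar_def pal_B_def Let_def)
      have "A x = bdot ((?R x ** ?B ** transpose (?R x)) *v (w x *s ?g x + v x *s (?R x *v ?b)))
          (cnj_vec (w x *s ?h x + \<phi> x *s (?R x *v ?b)))"
        using elim x by (simp add: A_def w_grad_def at_polar_def pal_C_def)
      also have "\<dots> = bdot ((?R x ** smult_mat (of_real ((cmod (w x))\<^sup>2)) ?B ** transpose (?R x)) *v ?g x) (cnj_vec (?h x))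
        + bdot (?R x *v (w x *s (?B *v cnj_vec ?b))) (?g x) * cnj (\<phi> x)
        + v x * cnj (bdot (?R x *v cnj_vec (cnj (w x) *s (?B *v ?b))) (?h x))
        + bdot (cnj_vec ?b) (?B *v ?b) * v x * cnj (\<phi> x)"
        by (rule product_form_expand[OF sym])
      also have "smult_mat (of_real ((cmod (w x))\<^sup>2)) ?B = ?Bb x"
        by (simp add: at_polar_def Bbreve_def)
      also have "w x *s (?B *v cnj_vec ?b) = ?p x"
        by (rule nbreve_split(2)[OF x elim(3), symmetric])
      also have "cnj (w x) *s (?B *v ?b) = ?q x"
        by (simp add: at_polar_def qvec_def)
      also have "bdot (cnj_vec ?b) (?B *v ?b) * v x * cnj (\<phi> x) = F4 x + of_real (k\<^sup>2) * N0 x"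
        by (simp add: F4_def N0_def nbreve_split(1)[OF x elim(3)] algebra_simps)
      finally show "F1 x + F2 x + F3 x + F4 x + of_real (k\<^sup>2) * N0 x = A x"
        by (simp add: F1_def F2_def F3_def)
    qed
  qed
  note int = F1 F2 F3 F4 set_integral_add(1)[OF F1 F2] set_integral_add(1)[OF set_integral_add(1)[OF F1 F2] F3]
    set_integral_add(1)[OF set_integral_add(1)[OF set_integral_add(1)[OF F1 F2] F3] F4]
  \<comment> \<open>The integrand \<open>A\<close> involves chosen weak gradients; its integral is
    computed by replacing it with the integrable sum.\<close>
  from set_integral_AE_eq[OF set_integral_add(1)[OF int(7) kN0] \<open>AE x in lebesgue. x \<in> U \<longrightarrow> F1 x + F2 x + F3 x + F4 x + of_real (k\<^sup>2) * N0 x = A x\<close>]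
  have "(LINT x:U|lebesgue. A x) = (LINT x:U|lebesgue. F1 x) + (LINT x:U|lebesgue. F2 x) + (LINT x:U|lebesgue. F3 x)
      + (LINT x:U|lebesgue. F4 x) + of_real (k\<^sup>2) * (LINT x:U|lebesgue. N0 x)"
    by (simp only: set_integral_add(2)[OF int(7) kN0] set_integral_add(2)[OF int(6) F4] set_integral_add(2)[OF int(5) F3]
        set_integral_add(2)[OF F1 F2] set_integral_mult_right)
  then show ?thesis
    unfolding pal_form_def Let_def L2_inner_vec_def L2_inner_def
    unfolding A_def F1_def F2_def F3_def F4_def N0_def by simp
qed

end

theorem theorem2:
  fixes k \<sigma>0 \<sigma>1 \<rho> :: real and R1 :: "real \<Rightarrow> real" and D :: "(real^2) set"
  assumes "k > 0" and "\<sigma>0 > 0" and "\<sigma>1 > 0" and "\<rho> > 1"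
    and "star_boundary R1" and "scatterer R1 D"
  shows
    "(\<forall>v \<phi>. v \<in> H1_0 (frontier D) (Omega_c \<rho> R1 D) \<and> \<phi> \<in> H1_0 (frontier D) (Omega_c \<rho> R1 D) \<longrightarrow>
        (let U = Omega_c \<rho> R1 D;
             T = (\<lambda>x. rot (polar_angle x));
             Bb = at_polar (Bbreve k \<sigma>0 \<sigma>1 \<rho> R1);
             p = at_polar (pvec k \<sigma>0 \<sigma>1 \<rho> R1);
             q = at_polar (qvec k \<sigma>0 \<sigma>1 \<rho> R1);
             nb = at_polar (nbreve k \<sigma>0 \<sigma>1 \<rho> R1)
         in pal_form k \<sigma>0 \<sigma>1 \<rho> R1 D v \<phi> =
              L2_inner_vec U (\<lambda>x. (T x ** Bb x ** transpose (T x)) *v weak_grad U v x) (weak_grad U \<phi>)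
            + L2_inner U (\<lambda>x. bdot (T x *v p x) (weak_grad U v x)) \<phi>
            + L2_inner U v (\<lambda>x. bdot (T x *v cnj_vec (q x)) (weak_grad U \<phi> x))
            + L2_inner U (\<lambda>x. nb x * v x) \<phi>))
     \<and>
     (\<forall>x \<in> Omega R1 D. x \<noteq> 0 \<longrightarrow>
        at_polar (Bbreve k \<sigma>0 \<sigma>1 \<rho> R1) x = mat 1 \<and>
        at_polar (pvec k \<sigma>0 \<sigma>1 \<rho> R1) x = 0 \<and>
        at_polar (qvec k \<sigma>0 \<sigma>1 \<rho> R1) x = 0 \<and>
        at_polar (nbreve k \<sigma>0 \<sigma>1 \<rho> R1) x = - of_real (k\<^sup>2))
     \<and>
     (\<forall>r0 \<theta>. in_PAL \<rho> R1 r0 \<theta> \<and> R1 differentiable (at \<theta>) \<longrightarrow>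
        (let r = complex_of_real r0;
             R = complex_of_real (R1 \<theta>);
             R' = complex_of_real (deriv R1 \<theta>);
             s1 = complex_of_real \<sigma>1;
             \<kappa> = complex_of_real k;
             \<alpha> = pal_alpha \<sigma>0 \<sigma>1;
             \<beta> = pal_beta \<sigma>0 \<sigma>1 \<rho> R1 r0 \<theta>;
             t = complex_of_real (pal_t \<sigma>1 \<rho> R1 r0 \<theta>);
             \<tau> = complex_of_real (pal_tau \<sigma>1 \<rho> R1 r0 \<theta>);
             \<gamma>1 = complex_of_real (pal_gamma1 \<sigma>1 \<rho> R1 r0 \<theta>);
             \<gamma>2 = complex_of_real (pal_gamma2 \<sigma>1 \<rho> R1 r0 \<theta>);
             Bb = Bbreve k \<sigma>0 \<sigma>1 \<rho> R1 r0 \<theta>;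
             f1 = (\<lambda>z. - (\<beta> * s1 / (\<alpha> * r)) * (3 * t / (2 * R) + z) * t\<^sup>2
                     - (3 * R' * s1 / (2 * r * R * \<alpha> * \<beta>) * (t + \<alpha> * \<tau> / R)
                        + z * s1 * R' / (r * \<alpha> * \<beta>)) * (R' * t\<^sup>2 + \<alpha> * \<gamma>2) * t\<^sup>2);
             f2 = (\<lambda>z. 3 * R' * \<gamma>1 * s1 / (2 * R * \<beta>) * (t + \<alpha> * \<tau> / R) * t\<^sup>2
                     + z * s1 * (R' * \<gamma>1 / \<beta>) * t\<^sup>2)
         in nbreve k \<sigma>0 \<sigma>1 \<rho> R1 r0 \<theta> =
              \<kappa>\<^sup>2 * (\<beta> * s1\<^sup>2 / \<alpha> - \<alpha> * \<beta> + s1\<^sup>2 * R'\<^sup>2 * t\<^sup>2 / (\<alpha> * \<beta>)) * (\<gamma>1 / r)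
              + 9 * \<gamma>1 * s1\<^sup>2 * t\<^sup>2 / (4 * r * R\<^sup>2)
                * (\<beta> / \<alpha> + R'\<^sup>2 / (\<alpha> * \<beta> * R\<^sup>2) * (R * t + \<alpha> * \<tau>)\<^sup>2)
          \<and> Bb $ 1 $ 1 = \<beta> * t\<^sup>2 / (\<alpha> * \<gamma>1 * r) * (t\<^sup>2 + (R' * t\<^sup>2 + \<alpha> * \<gamma>2)\<^sup>2 / \<beta>\<^sup>2)
          \<and> Bb $ 1 $ 2 = - (R' * t\<^sup>2 + \<alpha> * \<gamma>2) * (t\<^sup>2 / \<beta>)
          \<and> Bb $ 2 $ 1 = Bb $ 1 $ 2
          \<and> Bb $ 2 $ 2 = \<alpha> * \<gamma>1 * r / \<beta> * t\<^sup>2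
          \<and> pvec k \<sigma>0 \<sigma>1 \<rho> R1 r0 \<theta> = vector [f1 (\<i> * \<kappa>), f2 (\<i> * \<kappa>)]
          \<and> qvec k \<sigma>0 \<sigma>1 \<rho> R1 r0 \<theta> = vector [f1 (- \<i> * \<kappa>), f2 (- \<i> * \<kappa>)]))"
proof -
  interpret periodic_boundary R1
    using assms(5) by unfold_locales
  obtain P M where PM: "finite P" "0 \<in> P" "P \<subseteq> {0..2 * pi}" "M-lipschitz_on UNIV R1"
    "\<And>x. x \<in> {0..2*pi} - P \<Longrightarrow> R1 differentiable (at x) \<and> \<bar>deriv R1 x\<bar> \<le> M \<and> isCont (deriv R1) x"
    using lipschitz by metis
  interpret pal_domain R1 P M k \<sigma>0 \<sigma>1 \<rho> D
    using PM assms by unfold_locales auto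
  show ?thesis
  \<comment> \<open>Case 1 is the form identity, cases 2 to 5 are the values in the inner domain,
    and case 6 is the list of closed forms in the layer.\<close>
  proof (intro conjI allI impI ballI, goal_cases)
    case (1 v \<phi>)
    then show ?case
      unfolding Let_def by (intro form_identity) (auto simp: H1_0_def)
  next
    case (6 r0 \<theta>)
    then interpret pt: pal_point k \<sigma>0 \<sigma>1 \<rho> r0 \<theta> R1
      using \<sigma>0 \<sigma>1 \<rho> R1_pos by unfold_locales auto
    show ?case
      by (rule pt.layer_coefficients)
  qed (simp_all add: at_polar_def Omega_def star_domain_def inner_coefficients[OF _ _ R1_isCont])
qed

end
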